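(* Let $n\ge2$, let $X=C(Y)$ be an $n$-dimensional metric cone over a closed Riemannian manifold $(Y,h)$ of dimension $n-1$, and let $\mathcal{L}_V=\Delta_g+V$, where $r^2V=:V_0\in\mathcal{C}^\infty(Y)$ is real-valued and such that $\Delta_h+V_0(\theta)+(n-2)^2/4$ is a strictly positive operator on $L^2(Y)$ with smallest eigenvalue $\nu_0^2$, $\nu_0>0$. Let $q>\frac{2n}{n-1}$ and, in the case $0<\nu_0<\frac{n-2}2$, assume in addition $q<\frac{2n}{n-2-2\nu_0}$. Then there is a constant $C$ such that for every $M>0$ and every Schwartz function $f$ on $X$ whose distorted Fourier transform satisfies $\operatorname{supp}(\hat f)\subset\{\rho\sim M\}$, the solution $u$ of $$(\partial_t^2+\mathcal{L}_V)u=0\ \text{ on }\mathbb{R}\times X,\qquad u(0,r,\theta)=0,\quad\partial_tu(0,r,\theta)=f(r,\theta)$$ satisfies $$\|u(t,r,\theta)\|_{L^q_t(\mathbb{R};L^q_{\mathrm{rad}}(L^2_{\mathrm{sph}}))}\le C\,M^{\frac{n-1}2-\frac{n+1}q}\,\|f\|_{\dot H^{-\frac12}(X)}.$$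
   Context: Metric cone: $X=C(Y)=(0,\infty)_r\times Y$ with metric $g=dr^2+r^2h$, where $(Y,h)$ is a closed Riemannian manifold of dimension $n-1$. $\Delta_h$ is the positive Laplace–Beltrami operator on $(Y,h)$. $\Delta_g$ is the Friedrichs extension of the positive Laplace–Beltrami operator on $X$ from $\mathcal{C}_c^\infty$ of the interior $(0,\infty)\times Y$. $V=V_0(\theta)r^{-2}$, so $\mathcal{L}_V=-\partial_r^2-\frac{n-1}r\partial_r+\frac1{r^2}(\Delta_h+V_0(\theta))$. Spectral decomposition on $Y$: let $\nu_0^2<\nu_1^2<\cdots\to\infty$ (with $\nu_j>0$) be the distinct eigenvalues of $\Delta_h+V_0+(n-2)^2/4$ on $L^2(Y)$, let $\Lambda_\infty=\{\nu_j\}_{j\ge0}$, and for $\nu\in\Lambda_\infty$ let $d(\nu)$ be the multiplicity of $\nu^2$ and $\{Y_{\nu,\ell}\}_{1\le\ell\le d(\nu)}$ an orthonormal basis of its eigenspace. Write $f(r,\theta)=\sum_{\nu\in\Lambda_\infty}\sum_{\ell=1}^{d(\nu)}a_{\nu,\ell}(r)Y_{\nu,\ell}(\theta)$ with $a_{\nu,\ell}(r)=\int_Yf(r,\theta)\overline{Y_{\nu,\ell}(\theta)}\,dh$, and $b_{\nu,\ell}=\mathcal{H}_\nu a_{\nu,\ell}$, where $$(\mathcal{H}_\nu a)(\rho)=\int_0^\infty(r\rho)^{-\frac{n-2}2}J_\nu(r\rho)\,a(r)\,r^{n-1}\,dr$$ is the Hankel transform ($J_\nu$ the Bessel function of order $\nu$).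 Distorted Fourier transform: $\hat f(\rho,\omega)=\sum_{\nu,\ell}Y_{\nu,\ell}(\omega)\,b_{\nu,\ell}(\rho)$. The condition $\operatorname{supp}(\hat f)\subset\{\rho\sim M\}$ means $\hat f(\rho,\omega)=0$ unless $C_0^{-1}M\le\rho\le C_0M$, for a fixed constant $C_0>1$ (the constant $C$ may depend on $C_0$). The solution $u$ is $u(t)=\frac{\sin(t\sqrt{\mathcal{L}_V})}{\sqrt{\mathcal{L}_V}}f$, i.e. $$u(t,r,\theta)=\sum_{\nu\in\Lambda_\infty}\sum_{\ell=1}^{d(\nu)}Y_{\nu,\ell}(\theta)\int_0^\infty(r\rho)^{-\frac{n-2}2}J_\nu(r\rho)\sin(t\rho)\,b_{\nu,\ell}(\rho)\,\rho^{n-2}\,d\rho .$$ Norms: $L^q_{\mathrm{rad}}(L^2_{\mathrm{sph}})=L^q_{r^{n-1}dr}((0,\infty);L^2_\theta(Y))$, and $\|f\|_{\dot H^{-1/2}(X)}=\|\mathcal{L}_V^{-1/4}f\|_{L^2(X)}=\Big(\sum_{\nu,\ell}\int_0^\infty|\rho^{-1/2}b_{\nu,\ell}(\rho)|^2\rho^{n-1}d\rho\Big)^{1/2}$. Schwartz function on $X$: $f\in\mathcal{C}^\infty((0,\infty)\times Y)$ with $\sup_{r,\theta}|r^N\partial_r^k\Delta_h^mf(r,\theta)|<\infty$ for all integers $N,k,m\ge0$. *)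

theory Defs
  imports "HOL-Analysis.Analysis"
begin

subsection \<open>Smooth functions on open subsets of Euclidean spaces\<close>

primrec Ck_on :: "nat \<Rightarrow> 'a::euclidean_space set \<Rightarrow> ('a \<Rightarrow> 'b::real_normed_vector) \<Rightarrow> bool" where
  "Ck_on 0 S f \<longleftrightarrow> continuous_on S f"
| "Ck_on (Suc k) S f \<longleftrightarrow>
     f differentiable_on S \<and> (\<forall>b\<in>Basis. Ck_on k S (\<lambda>x. frechet_derivative f (at x) b))"

definition smooth_on :: "'a::euclidean_space set \<Rightarrow> ('a \<Rightarrow> 'b::real_normed_vector) \<Rightarrow> bool" where
  "smooth_on S f \<longleftrightarrow> (\<forall>k. Ck_on k S f)"

definition partial_deriv :: "'m \<Rightarrow> (real^'m \<Rightarrow> 'b::real_normed_vector) \<Rightarrow> real^'m \<Rightarrow> 'b" where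
  "partial_deriv i f x = frechet_derivative f (at x) (axis i 1)"


subsection \<open>Closed Riemannian manifolds\<close>

text \<open>
  The underlying space is the whole type \<open>'y\<close> and the dimension is \<open>CARD('m)\<close>. A chart is a pair
  of its domain and its coordinate map, whose values outside the domain are irrelevant.
  The metric is given by its Gram matrix in each chart, at each point of the chart domain.
  The volume measure is a field of the record only for convenience: by
  \<open>riemannian_volume\<close> below it is determined by the charts and the metric.
\<close>

type_synonym ('y, 'm) chart = "'y set \<times> ('y \<Rightarrow> real^'m)"

record ('y, 'm::finite) riem_manifold =
  charts :: "('y, 'm) chart set"
  gram :: "('y, 'm) chart \<Rightarrow> 'y \<Rightarrow> real^'m^'m"
  vol :: "'y measure"

definition coord_image :: "('y, 'm::finite) chart \<Rightarrow> (real^'m) set" where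
  "coord_image c = snd c ` fst c"

definition coord_inv :: "('y, 'm::finite) chart \<Rightarrow> real^'m \<Rightarrow> 'y" where
  "coord_inv c = inv_into (fst c) (snd c)"

definition smooth_atlas :: "('y::topological_space, 'm::finite) chart set \<Rightarrow> bool" where
  "smooth_atlas A \<longleftrightarrow>
     (\<Union>c\<in>A. fst c) = UNIV \<and>
     (\<forall>c\<in>A. open (fst c) \<and> open (coord_image c) \<and> inj_on (snd c) (fst c) \<and>
            homeomorphism (fst c) (coord_image c) (snd c) (coord_inv c)) \<and>
     (\<forall>c\<in>A. \<forall>c'\<in>A. smooth_on (snd c ` (fst c \<inter> fst c')) (snd c' \<circ> coord_inv c))"

definition riemannian_metric ::
  "('y, 'm::finite) chart set \<Rightarrow> (('y, 'm) chart \<Rightarrow> 'y \<Rightarrow> real^'m^'m) \<Rightarrow> bool" where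
  "riemannian_metric A G \<longleftrightarrow>
     (\<forall>c\<in>A. smooth_on (coord_image c) (\<lambda>x. G c (coord_inv c x)) \<and>
        (\<forall>y\<in>fst c. transpose (G c y) = G c y \<and> (\<forall>v. v \<noteq> 0 \<longrightarrow> v \<bullet> (G c y *v v) > 0))) \<and>
     (\<forall>c\<in>A. \<forall>c'\<in>A. \<forall>y\<in>fst c \<inter> fst c'.
        let J = matrix (frechet_derivative (snd c' \<circ> coord_inv c) (at (snd c y)))
        in G c y = transpose J ** G c' y ** J)"

definition riemannian_volume ::
  "('y::topological_space, 'm::finite) chart set \<Rightarrow> (('y, 'm) chart \<Rightarrow> 'y \<Rightarrow> real^'m^'m) \<Rightarrow>
    'y measure \<Rightarrow> bool" where
  "riemannian_volume A G \<mu> \<longleftrightarrow>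
     sets \<mu> = sets borel \<and>
     (\<forall>c\<in>A. \<forall>B\<in>sets borel. B \<subseteq> fst c \<longrightarrow>
        emeasure \<mu> B = (\<integral>\<^sup>+x\<in>snd c ` B. ennreal (sqrt (det (G c (coord_inv c x)))) \<partial>lborel))"

definition closed_riemannian_manifold ::
  "('y::{t2_space, second_countable_topology}, 'm::finite) riem_manifold \<Rightarrow> bool" where
  "closed_riemannian_manifold Y \<longleftrightarrow>
     compact (UNIV :: 'y set) \<and> smooth_atlas (charts Y) \<and>
     riemannian_metric (charts Y) (gram Y) \<and> riemannian_volume (charts Y) (gram Y) (vol Y)"

definition smooth_map ::
  "('y, 'm::finite) riem_manifold \<Rightarrow> ('y \<Rightarrow> 'b::real_normed_vector) \<Rightarrow> bool" where
  "smooth_map Y f \<longleftrightarrow> (\<forall>c\<in>charts Y. smooth_on (coord_image c) (f \<circ> coord_inv c))"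

text \<open>
  The positive Laplace--Beltrami operator in local coordinates,
  \<open>- |h|^(-1/2) \<Sum>i. \<partial>i (|h|^(1/2) \<Sum>j. h^ij \<partial>j f)\<close>. As its value does not depend on the
  chart, \<open>is_laplacian Y f g\<close> (that is, \<open>g = \<Delta>_h f\<close>) asks for the formula in every chart.
\<close>

definition laplacian_in_chart ::
  "('y, 'm::finite) riem_manifold \<Rightarrow> ('y, 'm) chart \<Rightarrow> ('y \<Rightarrow> complex) \<Rightarrow> 'y \<Rightarrow> complex" where
  "laplacian_in_chart Y c f y =
     (let G = (\<lambda>x. gram Y c (coord_inv c x));
          w = (\<lambda>x. sqrt (det (G x)));
          x0 = snd c y
      in - ((\<Sum>i\<in>UNIV. partial_deriv i
               (\<lambda>x. w x *\<^sub>R (\<Sum>j\<in>UNIV. (matrix_inv (G x) $ i $ j) *\<^sub>R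
                                     partial_deriv j (f \<circ> coord_inv c) x)) x0)
            /\<^sub>R w x0))"

definition is_laplacian ::
  "('y, 'm::finite) riem_manifold \<Rightarrow> ('y \<Rightarrow> complex) \<Rightarrow> ('y \<Rightarrow> complex) \<Rightarrow> bool" where
  "is_laplacian Y f g \<longleftrightarrow> (\<forall>c\<in>charts Y. \<forall>y\<in>fst c. g y = laplacian_in_chart Y c f y)"


subsection \<open>The operator on the cross-section and its spectral decomposition\<close>

definition L2_inner :: "'y measure \<Rightarrow> ('y \<Rightarrow> complex) \<Rightarrow> ('y \<Rightarrow> complex) \<Rightarrow> complex" where
  "L2_inner \<mu> f g = (\<integral>y. f y * cnj (g y) \<partial>\<mu>)"

text \<open>
  \<open>link_op Y V0 n f g\<close>: \<open>f\<close> is smooth and \<open>g = (\<Delta>_h + V0 + (n-2)^2/4) f\<close>. The operator on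
  \<open>L^2(Y)\<close> is the closure of this one, and by elliptic regularity all its eigenfunctions are
  smooth.
\<close>

definition link_op ::
  "('y, 'm::finite) riem_manifold \<Rightarrow> ('y \<Rightarrow> real) \<Rightarrow> nat \<Rightarrow> ('y \<Rightarrow> complex) \<Rightarrow> ('y \<Rightarrow> complex) \<Rightarrow> bool"
  where
  "link_op Y V0 n f g \<longleftrightarrow> smooth_map Y f \<and>
     (\<exists>L. is_laplacian Y f L \<and>
          (\<forall>y. g y = L y + of_real (V0 y) * f y + of_real ((real n - 2)\<^sup>2 / 4) * f y))"

definition strictly_positive_link_op ::
  "('y, 'm::finite) riem_manifold \<Rightarrow> ('y \<Rightarrow> real) \<Rightarrow> nat \<Rightarrow> bool" where
  "strictly_positive_link_op Y V0 n \<longleftrightarrow>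
     (\<exists>\<epsilon>>0. \<forall>f g. link_op Y V0 n f g \<longrightarrow>
        Re (L2_inner (vol Y) g f) \<ge> \<epsilon> * Re (L2_inner (vol Y) f f))"

definition eigenspace ::
  "('y, 'm::finite) riem_manifold \<Rightarrow> ('y \<Rightarrow> real) \<Rightarrow> nat \<Rightarrow> real \<Rightarrow> ('y \<Rightarrow> complex) set" where
  "eigenspace Y V0 n lam = {f. link_op Y V0 n f (\<lambda>y. of_real lam * f y)}"

definition is_eigenvalue ::
  "('y, 'm::finite) riem_manifold \<Rightarrow> ('y \<Rightarrow> real) \<Rightarrow> nat \<Rightarrow> real \<Rightarrow> bool" where
  "is_eigenvalue Y V0 n lam \<longleftrightarrow> (\<exists>f\<in>eigenspace Y V0 n lam. \<exists>y. f y \<noteq> 0)"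

definition smallest_eigenvalue ::
  "('y, 'm::finite) riem_manifold \<Rightarrow> ('y \<Rightarrow> real) \<Rightarrow> nat \<Rightarrow> real \<Rightarrow> bool" where
  "smallest_eigenvalue Y V0 n lam \<longleftrightarrow>
     is_eigenvalue Y V0 n lam \<and> (\<forall>lam'. is_eigenvalue Y V0 n lam' \<longrightarrow> lam \<le> lam')"

definition Lambda_inf ::
  "('y, 'm::finite) riem_manifold \<Rightarrow> ('y \<Rightarrow> real) \<Rightarrow> nat \<Rightarrow> real set" where
  "Lambda_inf Y V0 n = {\<nu>. \<nu> > 0 \<and> is_eigenvalue Y V0 n (\<nu>\<^sup>2)}"

text \<open>
  For each \<open>\<nu>\<close>, the functions \<open>e \<nu> 1, ..., e \<nu> (d \<nu>)\<close> are an orthonormal basis of the eigenspace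
  of \<open>\<nu>^2\<close>; in particular \<open>d \<nu>\<close> is its multiplicity.
\<close>

definition orthonormal_eigenbases ::
  "('y, 'm::finite) riem_manifold \<Rightarrow> ('y \<Rightarrow> real) \<Rightarrow> nat \<Rightarrow> (real \<Rightarrow> nat) \<Rightarrow>
    (real \<Rightarrow> nat \<Rightarrow> 'y \<Rightarrow> complex) \<Rightarrow> bool" where
  "orthonormal_eigenbases Y V0 n d e \<longleftrightarrow>
     (\<forall>\<nu>\<in>Lambda_inf Y V0 n.
        (\<forall>l\<in>{1..d \<nu>}. e \<nu> l \<in> eigenspace Y V0 n (\<nu>\<^sup>2)) \<and>
        (\<forall>l\<in>{1..d \<nu>}. \<forall>l'\<in>{1..d \<nu>}.
            L2_inner (vol Y) (e \<nu> l) (e \<nu> l') = (if l = l' then 1 else 0)) \<and>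
        (\<forall>f\<in>eigenspace Y V0 n (\<nu>\<^sup>2).
            \<exists>k. \<forall>y. f y = (\<Sum>l = 1..d \<nu>. k l * e \<nu> l y)))"

definition mode_index ::
  "('y, 'm::finite) riem_manifold \<Rightarrow> ('y \<Rightarrow> real) \<Rightarrow> nat \<Rightarrow> (real \<Rightarrow> nat) \<Rightarrow> (real \<times> nat) set" where
  "mode_index Y V0 n d = (SIGMA \<nu>:Lambda_inf Y V0 n. {1..d \<nu>})"


subsection \<open>Norms\<close>

definition ennreal_powr :: "ennreal \<Rightarrow> real \<Rightarrow> ennreal" where
  "ennreal_powr x p = (if x = \<infinity> then \<infinity> else ennreal (enn2real x powr p))"

definition Lq_norm :: "'a measure \<Rightarrow> real \<Rightarrow> ('a \<Rightarrow> ennreal) \<Rightarrow> ennreal" where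
  "Lq_norm \<mu> q F = ennreal_powr (\<integral>\<^sup>+x. ennreal_powr (F x) q \<partial>\<mu>) (1 / q)"

definition radial_measure :: "nat \<Rightarrow> real measure" where
  "radial_measure n = density lborel (\<lambda>r. ennreal (indicator {0<..} r * r ^ (n - 1)))"

definition mixed_norm ::
  "('y, 'm::finite) riem_manifold \<Rightarrow> nat \<Rightarrow> real \<Rightarrow> (real \<Rightarrow> real \<Rightarrow> 'y \<Rightarrow> complex) \<Rightarrow> ennreal" where
  "mixed_norm Y n q u =
     Lq_norm lborel q (\<lambda>t.
       Lq_norm (radial_measure n) q (\<lambda>r.
         Lq_norm (vol Y) 2 (\<lambda>\<theta>. ennreal (cmod (u t r \<theta>)))))"

text \<open>Unconditional convergence in \<open>L^2\<close> of the series over \<open>I\<close> to (the class of) \<open>s\<close>.\<close>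

definition has_L2_sum ::
  "'y measure \<Rightarrow> ('i \<Rightarrow> 'y \<Rightarrow> complex) \<Rightarrow> 'i set \<Rightarrow> ('y \<Rightarrow> complex) \<Rightarrow> bool" where
  "has_L2_sum \<mu> g I s \<longleftrightarrow>
     s \<in> borel_measurable \<mu> \<and>
     ((\<lambda>F. Lq_norm \<mu> 2 (\<lambda>y. ennreal (cmod (s y - (\<Sum>i\<in>F. g i y))))) \<longlongrightarrow> 0)
       (finite_subsets_at_top I)"


subsection \<open>Functions on the cone, Hankel transform and wave propagator\<close>

text \<open>
  Functions on the cone \<open>X = (0,\<infinity>) \<times> Y\<close> are curried; their values at \<open>r \<le> 0\<close> are irrelevant.
\<close>

definition smooth_on_cone ::
  "('y, 'm::finite) riem_manifold \<Rightarrow> (real \<Rightarrow> 'y \<Rightarrow> complex) \<Rightarrow> bool" where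
  "smooth_on_cone Y f \<longleftrightarrow>
     (\<forall>c\<in>charts Y. smooth_on ({0<..} \<times> coord_image c) (\<lambda>(r, x). f r (coord_inv c x)))"

text \<open>In the following definition \<open>F m\<close> is \<open>\<Delta>_h^m f\<close>.\<close>

definition schwartz_on_cone ::
  "('y, 'm::finite) riem_manifold \<Rightarrow> (real \<Rightarrow> 'y \<Rightarrow> complex) \<Rightarrow> bool" where
  "schwartz_on_cone Y f \<longleftrightarrow>
     smooth_on_cone Y f \<and>
     (\<exists>F. F 0 = f \<and>
        (\<forall>m. \<forall>r>0. is_laplacian Y (F m r) (F (Suc m) r)) \<and>
        (\<forall>N k m. \<exists>B. \<forall>r>0. \<forall>\<theta>.
           cmod (r ^ N *\<^sub>R ((\<lambda>g s. vector_derivative g (at s)) ^^ k) (\<lambda>s. F m s \<theta>) r) \<le> B))"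

definition bessel_J :: "real \<Rightarrow> real \<Rightarrow> real" where
  "bessel_J \<nu> x =
     (\<Sum>k. (-1) ^ k / (fact k * Gamma (\<nu> + real k + 1)) * (x / 2) powr (2 * real k + \<nu>))"

definition hankel_kernel :: "nat \<Rightarrow> real \<Rightarrow> real \<Rightarrow> real" where
  "hankel_kernel n \<nu> z = z powr (- ((real n - 2) / 2)) * bessel_J \<nu> z"

definition hankel :: "nat \<Rightarrow> real \<Rightarrow> (real \<Rightarrow> complex) \<Rightarrow> real \<Rightarrow> complex" where
  "hankel n \<nu> a \<rho> =
     (LINT r:{0<..}|lborel. of_real (hankel_kernel n \<nu> (r * \<rho>)) * a r * of_real (r ^ (n - 1)))"

text \<open>The coefficient \<open>b\<close> of \<open>f\<close>; the mode \<open>i\<close> is a pair \<open>(\<nu>, l)\<close>.\<close>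

definition hankel_coeff ::
  "('y, 'm::finite) riem_manifold \<Rightarrow> nat \<Rightarrow> (real \<Rightarrow> nat \<Rightarrow> 'y \<Rightarrow> complex) \<Rightarrow>
    (real \<Rightarrow> 'y \<Rightarrow> complex) \<Rightarrow> real \<times> nat \<Rightarrow> real \<Rightarrow> complex" where
  "hankel_coeff Y n e f i = hankel n (fst i) (\<lambda>r. L2_inner (vol Y) (f r) (e (fst i) (snd i)))"

definition is_distorted_FT ::
  "('y, 'm::finite) riem_manifold \<Rightarrow> ('y \<Rightarrow> real) \<Rightarrow> nat \<Rightarrow> (real \<Rightarrow> nat) \<Rightarrow>
    (real \<Rightarrow> nat \<Rightarrow> 'y \<Rightarrow> complex) \<Rightarrow> (real \<Rightarrow> 'y \<Rightarrow> complex) \<Rightarrow> (real \<Rightarrow> 'y \<Rightarrow> complex) \<Rightarrow> bool" where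
  "is_distorted_FT Y V0 n d e f fhat \<longleftrightarrow>
     (\<forall>\<rho>>0. has_L2_sum (vol Y)
        (\<lambda>i \<omega>. e (fst i) (snd i) \<omega> * hankel_coeff Y n e f i \<rho>)
        (mode_index Y V0 n d) (fhat \<rho>))"

text \<open>
  \<open>u = sin(t L^(1/2)) / L^(1/2) f\<close>, the solution of the wave equation with data \<open>(0, f)\<close>, where
  the functional calculus of \<open>L = \<Delta>_g + V\<close> is that given by the Hankel transform.
\<close>

definition is_wave_solution ::
  "('y, 'm::finite) riem_manifold \<Rightarrow> ('y \<Rightarrow> real) \<Rightarrow> nat \<Rightarrow> (real \<Rightarrow> nat) \<Rightarrow>
    (real \<Rightarrow> nat \<Rightarrow> 'y \<Rightarrow> complex) \<Rightarrow> (real \<Rightarrow> 'y \<Rightarrow> complex) \<Rightarrow>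
    (real \<Rightarrow> real \<Rightarrow> 'y \<Rightarrow> complex) \<Rightarrow> bool" where
  "is_wave_solution Y V0 n d e f u \<longleftrightarrow>
     (\<forall>t. \<forall>r>0. has_L2_sum (vol Y)
        (\<lambda>i \<theta>. e (fst i) (snd i) \<theta> *
           (LINT \<rho>:{0<..}|lborel. of_real (hankel_kernel n (fst i) (r * \<rho>) * sin (t * \<rho>)) *
              hankel_coeff Y n e f i \<rho> * of_real (\<rho> ^ (n - 2))))
        (mode_index Y V0 n d) (u t r))"

text \<open>The norm of \<open>L^(-1/4) f\<close> in \<open>L^2(X)\<close>, with \<open>L = \<Delta>_g + V\<close>.\<close>

definition H_minus_half_norm ::
  "('y, 'm::finite) riem_manifold \<Rightarrow> ('y \<Rightarrow> real) \<Rightarrow> nat \<Rightarrow> (real \<Rightarrow> nat) \<Rightarrow>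
    (real \<Rightarrow> nat \<Rightarrow> 'y \<Rightarrow> complex) \<Rightarrow> (real \<Rightarrow> 'y \<Rightarrow> complex) \<Rightarrow> ennreal" where
  "H_minus_half_norm Y V0 n d e f =
     ennreal_powr
       (\<integral>\<^sup>+i. (\<integral>\<^sup>+\<rho>. ennreal ((\<rho> powr (-1/2) * cmod (hankel_coeff Y n e f i \<rho>))\<^sup>2)
                  \<partial>radial_measure n)
          \<partial>count_space (mode_index Y V0 n d))
       (1 / 2)"

end

theory Submission
  imports Defs "HOL-Probability.Probability"
begin

text \<open>
  The solution separates into modes. Its coefficient in the mode \<open>i\<close> of order \<open>\<nu>_i\<close> is \<open>r^(-(n-2)/2)\<close> times the
  sine transform, from \<open>\<rho>\<close> to \<open>t\<close>, of \<open>J_\<nu>_i(r \<rho>) b_i(\<rho>) \<rho>^((n-2)/2)\<close>, and the norm over the cross-section is the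
  \<open>l^2\<close> sum over the modes, because the eigenfunctions are orthonormal.

  For fixed \<open>r\<close> everything lives on \<open>\<rho>\<close> of size \<open>M\<close>. There a sine transform is bounded in the supremum norm
  by the Cauchy-Schwarz inequality and in \<open>L^2\<close> by Plancherel's inequality; interpolating between the two, with \<open>q > 2\<close>,
  gives the \<open>L^q\<close> norm in time (\<open>strans_family_Lp\<close>). What remains is an \<open>L^(q/2)\<close> norm in \<open>r\<close> of the average of
  \<open>r^(-(n-2)) J_\<nu>_i(r \<rho>)^2\<close> over the measure \<open>|b_i(\<rho>)|^2 \<rho>^(n-2) d\<rho>\<close> on pairs \<open>(i, \<rho>)\<close>, whose total mass is exactly
  the squared \<open>H^(-1/2)\<close> norm of the data. By Jensen's inequality it is enough to bound, uniformly in the order, the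
  moments \<open>\<integral> r^\<alpha> |J_\<nu>(r)|^q dr\<close> with \<open>\<alpha> = n - 1 - q (n-2)/2\<close> (\<open>wave_family_estimate\<close>); the scaling \<open>r \<rho>\<close> produces the
  power of \<open>M\<close>.

  These moments are where the range of \<open>q\<close> enters (\<open>bessel_integral_uniform\<close>, \<open>exponent_conditions\<close>). Convergence at
  infinity is \<open>q > 2n/(n-1)\<close>. Convergence at 0 for the smallest order is the condition with \<open>\<nu>0\<close>. For large orders the
  mass near the turning point \<open>r = \<nu>\<close> must not grow, which requires the sharp bound
  \<open>J_\<nu>(r)^4 (|r^2 - \<nu>^2| + \<nu>^(4/3)) \<le> C\<close> of \<open>bessel_J_uniform\<close>. It is proved from the differential equation and the recurrences: a
  regularised WKB energy increases beyond the turning point, so it is bounded by its limit at infinity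
  (\<open>Q_mono\<close>), and that limit has period 1 in the order, by the recurrences (\<open>bessel_energy_at_top\<close>).

  Orthogonality of eigenfunctions for different eigenvalues is Green's formula on the cross-section (\<open>green\<close>). It
  gives the norm of the solution, and it shows that the support condition on the distorted Fourier
  transform holds for the coefficient of every mode (\<open>has_L2_sum_zero\<close>).
\<close>

section \<open>Bessel functions: power series and differential equation\<close>

definition bcoef :: "real \<Rightarrow> nat \<Rightarrow> real" where
  "bcoef \<nu> k = (-1) ^ k / (fact k * Gamma (\<nu> + real k + 1))"

text \<open>The entire factor of the Bessel function: \<open>J_\<nu>(x)\<close> is \<open>(x/2)^\<nu>\<close> times its value at \<open>x^2/4\<close>.\<close>

definition bser :: "real \<Rightarrow> real \<Rightarrow> real" where
  "bser \<nu> z = (\<Sum>k. bcoef \<nu> k * z ^ k)"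

lemma Gamma_lower_bound: "\<exists>c>0. \<forall>x\<ge>1. c \<le> Gamma (x::real)"
proof -
  have "continuous_on {1..2::real} Gamma"
    by (intro continuous_intros) (auto elim!: nonpos_Ints_cases)
  then obtain a :: real where a: "a \<in> {1..2}" "\<And>y. y \<in> {1..2} \<Longrightarrow> Gamma a \<le> Gamma y"
    using continuous_attains_inf[of "{1..2::real}" Gamma] by auto
  have g: "Gamma a > 0" using a(1) by (intro Gamma_real_pos) auto
  have "min (Gamma a) 1 \<le> Gamma x" if "x \<ge> 1" for x :: real
  proof (cases "x \<le> 2")
    case True
    then show ?thesis using a(2)[of x] that by auto
  next
    case False
    then have "Gamma 2 < Gamma x" by (intro Gamma_real_strict_mono) auto
    moreover have "Gamma (2::real) = 1" using Gamma_fact[of 1, where 'a=real] by simp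
    ultimately show ?thesis by simp
  qed
  then show ?thesis using g by (intro exI[of _ "min (Gamma a) 1"]) auto
qed

lemma Gamma_Suc_pos: "x > 0 \<Longrightarrow> Gamma (x + 1) = x * Gamma (x::real)"
  by (rule Gamma_plus1) (auto elim!: nonpos_Ints_cases)

lemma bcoef_Suc: assumes "\<nu> \<ge> 0" shows "diffs (bcoef \<nu>) k = - bcoef (\<nu> + 1) k"
  by (simp add: diffs_def bcoef_def divide_simps del: of_nat_Suc)
     (simp add: algebra_simps)

lemma bcoef_Gamma: assumes "\<nu> \<ge> 0" shows "Gamma (\<nu> + real k + 1) \<ge> Gamma (\<nu> + 1)"
proof (induction k)
  case (Suc k)
  have "Gamma (\<nu> + real (Suc k) + 1) = (\<nu> + real k + 1) * Gamma (\<nu> + real k + 1)"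
    using Gamma_Suc_pos[of "\<nu> + real k + 1"] assms by (simp add: add_ac)
  also have "\<dots> \<ge> 1 * Gamma (\<nu> + real k + 1)"
    using assms by (intro mult_right_mono) (auto intro!: Gamma_real_nonneg)
  finally show ?case using Suc by simp
qed auto

lemma bcoef_bound: assumes "\<nu> \<ge> 0"
  shows "\<bar>bcoef \<nu> k\<bar> \<le> inverse (Gamma (\<nu> + 1)) * inverse (fact k)"
proof -
  have p: "Gamma (\<nu> + 1) > 0" using assms by simp
  have "inverse (Gamma (\<nu> + real k + 1)) \<le> inverse (Gamma (\<nu> + 1))"
    using bcoef_Gamma[OF assms, of k] p by (simp add: le_imp_inverse_le)
  then have "inverse (Gamma (\<nu> + real k + 1)) * inverse (fact k) \<le> inverse (Gamma (\<nu> + 1)) * inverse (fact k)"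
    by (intro mult_right_mono) auto
  moreover have "Gamma (\<nu> + real k + 1) > 0" using assms by (intro Gamma_real_pos) auto
  ultimately show ?thesis by (simp add: bcoef_def abs_mult divide_inverse mult.commute)
qed

lemma bser_term_bound: assumes "\<nu> \<ge> 0"
  shows "norm (bcoef \<nu> k * z ^ k) \<le> inverse (Gamma (\<nu> + 1)) * (inverse (fact k) * \<bar>z\<bar> ^ k)"
  using mult_right_mono[OF bcoef_bound[OF assms, of k], of "\<bar>z\<bar> ^ k"]
  by (simp add: abs_mult power_abs mult.assoc)

lemma bser_summable: assumes "\<nu> \<ge> 0"
  shows "summable (\<lambda>k. bcoef \<nu> k * z ^ k)"
  by (rule summable_comparison_test'[OF _ bser_term_bound[OF assms]])
     (intro summable_mult summable_exp)

lemma bser_bound: assumes "\<nu> \<ge> 0" shows "\<bar>bser \<nu> z\<bar> \<le> inverse (Gamma (\<nu> + 1)) * exp \<bar>z\<bar>"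
proof -
  have s: "summable (\<lambda>k. inverse (Gamma (\<nu> + 1)) * (inverse (fact k) * \<bar>z\<bar> ^ k))"
    by (intro summable_mult summable_exp)
  have "norm (bser \<nu> z) \<le> (\<Sum>k. inverse (Gamma (\<nu> + 1)) * (inverse (fact k) * \<bar>z\<bar> ^ k))"
    unfolding bser_def by (rule norm_suminf_le[OF bser_term_bound[OF assms] s])
  also have "\<dots> = inverse (Gamma (\<nu> + 1)) * exp \<bar>z\<bar>"
    by (subst suminf_mult) (auto intro!: summable_exp simp: exp_def divide_inverse mult.commute scaleR_conv_of_real)
  finally show ?thesis by simp
qed

lemma bser_deriv: assumes "\<nu> \<ge> 0" shows "(bser \<nu> has_real_derivative - bser (\<nu> + 1) z) (at z)"
proof -
  have "((\<lambda>z. \<Sum>k. bcoef \<nu> k * z ^ k) has_real_derivative (\<Sum>k. diffs (bcoef \<nu>) k * z ^ k)) (at z)"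
    by (intro termdiffs_strong_converges_everywhere bser_summable assms)
  moreover have "(\<Sum>k. diffs (bcoef \<nu>) k * z ^ k) = - bser (\<nu> + 1) z"
    using suminf_minus[OF bser_summable[of "\<nu> + 1" z]] assms by (simp add: bcoef_Suc bser_def)
  ultimately show ?thesis by (simp add: bser_def[abs_def])
qed

lemma bcoef_rec: assumes "\<nu> \<ge> 0"
  shows "bcoef (\<nu> + 2) k + (\<nu> + 1) * - bcoef (\<nu> + 1) (Suc k) + bcoef \<nu> (Suc k) = 0"
proof -
  have g: "Gamma (\<nu> + real k + 3) = (\<nu> + real k + 2) * Gamma (\<nu> + real k + 2)"
    using Gamma_Suc_pos[of "\<nu> + real k + 2"] assms by (simp add: add_ac)
  have p: "Gamma (\<nu> + real k + 2) > 0" using assms by (intro Gamma_real_pos) auto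
  have q: "\<nu> + real k + 2 > 0" using assms by auto
  have e: "bcoef (\<nu> + 2) k = (-1)^k / (fact k * ((\<nu> + real k + 2) * Gamma (\<nu> + real k + 2)))"
    "bcoef (\<nu> + 1) (Suc k) = - ((-1)^k / ((real k + 1) * fact k * ((\<nu> + real k + 2) * Gamma (\<nu> + real k + 2))))"
    "bcoef \<nu> (Suc k) = - ((-1)^k / ((real k + 1) * fact k * Gamma (\<nu> + real k + 2)))"
    using g by (simp_all add: bcoef_def add_ac)
  define X where "X = (-1)^k / ((real k + 1) * fact k * ((\<nu> + real k + 2) * Gamma (\<nu> + real k + 2)))"
  have m: "real k + 1 \<noteq> 0" using of_nat_0_le_iff[of k] by linarith
  have "bcoef (\<nu> + 2) k = X * (real k + 1)" "bcoef (\<nu> + 1) (Suc k) = - X"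
    "bcoef \<nu> (Suc k) = - (X * (\<nu> + real k + 2))"
    unfolding e X_def using p q m by simp_all
  then show ?thesis by (simp add: algebra_simps)
qed

lemma bser_rec: assumes "\<nu> \<ge> 0"
  shows "z * bser (\<nu> + 2) z - (\<nu> + 1) * bser (\<nu> + 1) z + bser \<nu> z = 0"
proof -
  have s: "bser \<mu> z = bcoef \<mu> 0 + (\<Sum>k. bcoef \<mu> (Suc k) * z ^ Suc k)"
     "summable (\<lambda>k. bcoef \<mu> (Suc k) * z ^ Suc k)" if "\<mu> \<ge> 0" for \<mu>
    using suminf_split_head[OF bser_summable[OF that, of z]]
      summable_Suc_iff[THEN iffD2, OF bser_summable[OF that, of z]] by (simp_all only: bser_def) simp
  have t: "z * bser (\<nu> + 2) z = (\<Sum>k. bcoef (\<nu> + 2) k * z ^ Suc k)"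
      "summable (\<lambda>k. bcoef (\<nu> + 2) k * z ^ Suc k)"
    using suminf_mult[OF bser_summable[of "\<nu> + 2" z], of z] summable_mult[OF bser_summable[of "\<nu> + 2" z], of z] assms
    by (auto simp: bser_def mult_ac)
  have z: "- (\<nu> + 1) * bcoef (\<nu> + 1) 0 + bcoef \<nu> 0 = 0"
  proof -
    have "Gamma (\<nu> + 1 + 1) = (\<nu> + 1) * Gamma (\<nu> + 1)" by (rule Gamma_Suc_pos) (use assms in simp)
    moreover have "Gamma (\<nu> + 1) > 0" "\<nu> + 1 \<noteq> 0" using assms by auto
    ultimately show ?thesis by (simp add: bcoef_def divide_simps)
  qed
  have "z * bser (\<nu> + 2) z - (\<nu> + 1) * bser (\<nu> + 1) z + bser \<nu> z
    = (\<Sum>k. bcoef (\<nu> + 2) k * z ^ Suc k) + (- (\<nu> + 1)) * (\<Sum>k. bcoef (\<nu>+1) (Suc k) * z ^ Suc k)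
      + (\<Sum>k. bcoef \<nu> (Suc k) * z ^ Suc k)"
  proof -
    have e: "bser (\<nu> + 1) z = bcoef (\<nu> + 1) 0 + (\<Sum>k. bcoef (\<nu> + 1) (Suc k) * z ^ Suc k)"
      "bser \<nu> z = bcoef \<nu> 0 + (\<Sum>k. bcoef \<nu> (Suc k) * z ^ Suc k)"
      by (rule s(1), use assms in simp)+
    show ?thesis unfolding t(1) e distrib_left using z by linarith
  qed
  also have "\<dots> = (\<Sum>k. bcoef (\<nu> + 2) k * z ^ Suc k + (- (\<nu> + 1)) * (bcoef (\<nu>+1) (Suc k) * z ^ Suc k)
      + bcoef \<nu> (Suc k) * z ^ Suc k)"
    by (intro sums_unique sums_add sums_mult summable_sums s(2) t(2)) (use assms in auto)
  also have "\<dots> = (\<Sum>k. (bcoef (\<nu> + 2) k + (\<nu> + 1) * - bcoef (\<nu> + 1) (Suc k) + bcoef \<nu> (Suc k)) * z ^ Suc k)"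
    by (simp add: algebra_simps)
  also have "\<dots> = 0" using bcoef_rec[OF assms] by simp
  finally show ?thesis .
qed

lemma bessel_J_bser: assumes "x > 0" and that: "\<nu> \<ge> 0"
  shows "bessel_J \<nu> x = (x/2) powr \<nu> * bser \<nu> ((x/2)^2)"
proof -
  have "(x/2) powr (2 * real k + \<nu>) = (x/2) powr \<nu> * ((x/2)^2)^k" for k
    using assms powr_realpow[of "x/2" "2*k"] by (simp add: powr_add power_mult)
  then have "bessel_J \<nu> x = (\<Sum>k. (x/2) powr \<nu> * (bcoef \<nu> k * ((x/2)^2)^k))"
    by (simp add: bessel_J_def bcoef_def mult_ac)
  then show ?thesis using suminf_mult[OF bser_summable[OF that, of "(x/2)^2"]] by (simp add: bser_def)
qed

lemma bessel_J_deriv: assumes "x > 0" "\<nu> \<ge> 0"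
  shows "(bessel_J \<nu> has_real_derivative (\<nu> / x * bessel_J \<nu> x - bessel_J (\<nu> + 1) x)) (at x)"
proof -
  have "((\<lambda>x. (x/2) powr \<nu> * bser \<nu> ((x/2)^2)) has_real_derivative
     (\<nu> / x * ((x/2) powr \<nu> * bser \<nu> ((x/2)^2)) - (x/2) powr (\<nu>+1) * bser (\<nu>+1) ((x/2)^2))) (at x)"
  proof -
    have 1: "((\<lambda>x. (x/2) powr \<nu>) has_real_derivative (\<nu> / x * (x/2) powr \<nu>)) (at x)"
      using assms by (auto intro!: derivative_eq_intros simp: powr_diff)
    have 2: "((\<lambda>x. bser \<nu> ((x/2)^2)) has_real_derivative (- bser (\<nu>+1) ((x/2)^2) * (x/2))) (at x)"
      by (rule DERIV_chain2[OF bser_deriv[OF assms(2)]])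
         (auto intro!: derivative_eq_intros simp: field_simps power2_eq_square)
    show ?thesis by (rule DERIV_cong[OF DERIV_mult[OF 1 2]])
       (use assms in \<open>simp add: powr_add algebra_simps\<close>)
  qed
  then have *: "((\<lambda>x. (x/2) powr \<nu> * bser \<nu> ((x/2)^2)) has_real_derivative
     (\<nu> / x * bessel_J \<nu> x - bessel_J (\<nu> + 1) x)) (at x)"
    using assms by (simp only: bessel_J_bser)
  show ?thesis
    by (rule has_field_derivative_transform_within_open[OF *, of "{0<..}"])
       (use assms in \<open>auto simp: bessel_J_bser\<close>)
qed

lemma bessel_J_rec: assumes "x > 0" "\<nu> \<ge> 0"
  shows "bessel_J (\<nu> + 2) x = 2 * (\<nu> + 1) / x * bessel_J (\<nu> + 1) x - bessel_J \<nu> x"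
proof -
  have "(x/2) powr (\<nu> + 2) = (x/2) powr \<nu> * (x/2)^2" "(x/2) powr (\<nu> + 1) = (x/2) powr \<nu> * (x/2)"
    using assms by (simp_all add: powr_add)
  then have "bessel_J (\<nu> + 2) x = (x/2) powr \<nu> * ((x/2)^2 * bser (\<nu> + 2) ((x/2)^2))"
    and 1: "bessel_J (\<nu> + 1) x = (x/2) powr \<nu> * (x/2) * bser (\<nu> + 1) ((x/2)^2)"
    and "bessel_J \<nu> x = (x/2) powr \<nu> * bser \<nu> ((x/2)^2)"
    using assms by (simp_all add: bessel_J_bser)
  moreover have "2 * (\<nu> + 1) / x * bessel_J (\<nu> + 1) x = (x/2) powr \<nu> * ((\<nu> + 1) * bser (\<nu> + 1) ((x/2)^2))"
    unfolding 1 using assms by simp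
  moreover have "(x/2)^2 * bser (\<nu> + 2) ((x/2)^2) = (\<nu> + 1) * bser (\<nu> + 1) ((x/2)^2) - bser \<nu> ((x/2)^2)"
    using bser_rec[OF assms(2), of "(x/2)^2"] by simp
  ultimately show ?thesis by (simp add: right_diff_distrib)
qed

text \<open>
  This is \<open>x J_\<nu>'(x)\<close>. In the variable \<open>log x\<close> Bessel's equation reads \<open>y'' = (\<nu>^2 - x^2) y\<close>, without a
  first-order term, so the pair \<open>(J, Z)\<close> satisfies \<open>x J' = Z\<close> and \<open>x Z' = (\<nu>^2 - x^2) J\<close>. All bounds below
  come from quadratic forms in \<open>(J, Z)\<close> that are monotone along this system.
\<close>

definition bessel_Z :: "real \<Rightarrow> real \<Rightarrow> real" where
  "bessel_Z \<nu> x = \<nu> * bessel_J \<nu> x - x * bessel_J (\<nu> + 1) x"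

lemma DERIV_bessel_J: assumes "x > 0" "\<nu> \<ge> 0"
  shows "(bessel_J \<nu> has_real_derivative bessel_Z \<nu> x / x) (at x)"
  using bessel_J_deriv[OF assms] assms by (simp add: bessel_Z_def diff_divide_distrib)

lemma DERIV_bessel_Z: assumes "x > 0" "\<nu> \<ge> 0"
  shows "(bessel_Z \<nu> has_real_derivative (\<nu>\<^sup>2 - x\<^sup>2) * bessel_J \<nu> x / x) (at x)"
proof -
  note d = bessel_J_deriv[OF assms] bessel_J_deriv[OF assms(1), of "\<nu> + 1"]
  have r: "bessel_J (\<nu> + 1 + 1) x = 2 * (\<nu> + 1) / x * bessel_J (\<nu> + 1) x - bessel_J \<nu> x"
    using bessel_J_rec[OF assms] by (simp add: add.assoc)
  have "(bessel_Z \<nu> has_real_derivative (\<nu> * (\<nu> / x * bessel_J \<nu> x - bessel_J (\<nu> + 1) x) -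
    (bessel_J (\<nu> + 1) x + ((\<nu> + 1) / x * bessel_J (\<nu> + 1) x - bessel_J (\<nu> + 1 + 1) x) * x))) (at x)"
    unfolding bessel_Z_def[abs_def] using assms by (auto intro!: derivative_eq_intros d)
  then show ?thesis unfolding r by (rule DERIV_cong) (use assms in \<open>simp add: field_simps power2_eq_square\<close>)
qed

lemma bessel_J_small:
  "\<exists>c>0. \<forall>\<nu>\<ge>0. \<forall>x>0. \<bar>bessel_J \<nu> x\<bar> \<le> c * (x/2) powr \<nu> * exp (x\<^sup>2/4)"
proof -
  obtain c where c: "c > 0" "\<And>x. x \<ge> 1 \<Longrightarrow> c \<le> Gamma (x::real)" using Gamma_lower_bound by auto
  have "\<bar>bessel_J \<nu> x\<bar> \<le> inverse c * (x/2) powr \<nu> * exp (x\<^sup>2/4)" if "\<nu> \<ge> 0" "x > 0" for \<nu> x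
  proof -
    have "\<bar>bser \<nu> ((x/2)\<^sup>2)\<bar> \<le> inverse (Gamma (\<nu> + 1)) * exp (x\<^sup>2/4)"
      using bser_bound[OF that(1), of "(x/2)\<^sup>2"] by (simp add: power_divide)
    also have "\<dots> \<le> inverse c * exp (x\<^sup>2/4)"
      using c(2)[of "\<nu> + 1"] c(1) that by (intro mult_right_mono le_imp_inverse_le) auto
    finally have "(x/2) powr \<nu> * \<bar>bser \<nu> ((x/2)\<^sup>2)\<bar> \<le> (x/2) powr \<nu> * (inverse c * exp (x\<^sup>2/4))"
      by (intro mult_left_mono) auto
    then show ?thesis using that by (simp add: bessel_J_bser abs_mult mult_ac)
  qed
  then show ?thesis using c(1) by (intro exI[of _ "inverse c"]) auto
qed

lemma bessel_JZ_at_0: assumes "\<nu> > 0"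
  shows "(bessel_J \<nu> \<longlongrightarrow> 0) (at_right 0)" "(bessel_Z \<nu> \<longlongrightarrow> 0) (at_right 0)"
proof -
  obtain c where c: "c > 0" "\<And>\<nu> x. \<nu> \<ge> 0 \<Longrightarrow> x > 0 \<Longrightarrow> \<bar>bessel_J \<nu> x\<bar> \<le> c * (x/2) powr \<nu> * exp (x\<^sup>2/4)"
    using bessel_J_small by blast
  have J: "(bessel_J \<mu> \<longlongrightarrow> 0) (at_right 0)" if "\<mu> > 0" for \<mu>
  proof (rule Lim_null_comparison)
    show "\<forall>\<^sub>F x in at_right 0. norm (bessel_J \<mu> x) \<le> c * (x/2) powr \<mu> * exp (x\<^sup>2/4)"
      using c(2)[of \<mu>] that by (auto simp: eventually_at_filter)
    have "((\<lambda>x. c * (x/2) powr \<mu> * exp (x\<^sup>2/4)) \<longlongrightarrow> c * (0/2) powr \<mu> * exp (0\<^sup>2/4)) (at_right 0)"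
      using that by (intro tendsto_intros) (auto simp: eventually_at_filter)
    then show "((\<lambda>x. c * (x/2) powr \<mu> * exp (x\<^sup>2/4)) \<longlongrightarrow> 0) (at_right 0)" by simp
  qed
  show "(bessel_J \<nu> \<longlongrightarrow> 0) (at_right 0)" by (rule J[OF assms])
  have "((\<lambda>x. \<nu> * bessel_J \<nu> x - x * bessel_J (\<nu> + 1) x) \<longlongrightarrow> \<nu> * 0 - 0 * 0) (at_right 0)"
    using assms by (intro tendsto_intros J) auto
  then show "(bessel_Z \<nu> \<longlongrightarrow> 0) (at_right 0)" by (simp add: bessel_Z_def[abs_def])
qed

section \<open>Uniform pointwise bounds for Bessel functions\<close>

lemma mono_from_DERIV:
  fixes f :: "real \<Rightarrow> real"
  assumes "a \<le> b" "\<And>x. a \<le> x \<Longrightarrow> x \<le> b \<Longrightarrow> (f has_real_derivative f' x) (at x)"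
    "\<And>x. a \<le> x \<Longrightarrow> x \<le> b \<Longrightarrow> 0 \<le> f' x"
  shows "f a \<le> f b"
  using assms by (intro DERIV_nonneg_imp_nondecreasing[of a b f]) auto

text \<open>The monotone quantities below the turning point all vanish at the origin.\<close>

lemma nonneg_from_DERIV:
  fixes f :: "real \<Rightarrow> real"
  assumes "0 < b" "\<And>x. 0 < x \<Longrightarrow> x \<le> b \<Longrightarrow> (f has_real_derivative f' x) (at x)"
    "\<And>x. 0 < x \<Longrightarrow> x \<le> b \<Longrightarrow> 0 \<le> f' x" "(f \<longlongrightarrow> 0) (at_right 0)"
  shows "0 \<le> f b"
proof (rule tendsto_upperbound[OF assms(4)])
  have "\<forall>\<^sub>F x in at_right 0. x \<in> {0<..<b}" using assms(1) by (rule eventually_at_right_real)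
  then show "\<forall>\<^sub>F x in at_right 0. f x \<le> f b"
    by eventually_elim (rule mono_from_DERIV[where f'=f'], use assms in auto)
qed auto

text \<open>
  Below the turning point \<open>x = \<nu>\<close> the equation is repulsive: the derivatives in \<open>log x\<close> of
  \<open>Z^2 - (\<nu>^2 - x^2) J^2\<close> and of \<open>J Z\<close> are \<open>2 x^2 J^2\<close> and \<open>Z^2 + (\<nu>^2 - x^2) J^2\<close>.
\<close>

lemma bessel_below_turning_point: assumes "\<nu> > 0" "0 < x" "x \<le> \<nu>"
  shows "(\<nu>\<^sup>2 - x\<^sup>2) * (bessel_J \<nu> x)\<^sup>2 \<le> (bessel_Z \<nu> x)\<^sup>2" (is ?A)
    and "0 \<le> bessel_J \<nu> x * bessel_Z \<nu> x" (is ?B)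
proof -
  note d = DERIV_bessel_J DERIV_bessel_Z
  note l = bessel_JZ_at_0[OF assms(1)]
  have le: "y\<^sup>2 \<le> \<nu>\<^sup>2" if "0 < y" "y \<le> x" for y using that assms by (intro power_mono) auto
  have "0 \<le> (bessel_Z \<nu> x)\<^sup>2 - (\<nu>\<^sup>2 - x\<^sup>2) * (bessel_J \<nu> x)\<^sup>2"
  proof (rule nonneg_from_DERIV[where f="(\<lambda>x. (bessel_Z \<nu> x)\<^sup>2 - (\<nu>\<^sup>2 - x\<^sup>2) * (bessel_J \<nu> x)\<^sup>2)" and b=x and f'="\<lambda>x. 2 * x * (bessel_J \<nu> x)\<^sup>2"])
    show "((\<lambda>x. (bessel_Z \<nu> x)\<^sup>2 - (\<nu>\<^sup>2 - x\<^sup>2) * (bessel_J \<nu> x)\<^sup>2) has_real_derivative 2 * y * (bessel_J \<nu> y)\<^sup>2) (at y)"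
      if "0 < y" "y \<le> x" for y
      using that assms by (auto intro!: derivative_eq_intros d simp: field_simps power2_eq_square)
    have "((\<lambda>x. (bessel_Z \<nu> x)\<^sup>2 - (\<nu>\<^sup>2 - x\<^sup>2) * (bessel_J \<nu> x)\<^sup>2) \<longlongrightarrow> 0\<^sup>2 - (\<nu>\<^sup>2 - 0\<^sup>2) * 0\<^sup>2) (at_right 0)"
      by (intro tendsto_intros l)
    then show "((\<lambda>x. (bessel_Z \<nu> x)\<^sup>2 - (\<nu>\<^sup>2 - x\<^sup>2) * (bessel_J \<nu> x)\<^sup>2) \<longlongrightarrow> 0) (at_right 0)" by simp
  qed (use assms in auto)
  then show ?A by simp
  show ?B
  proof (rule nonneg_from_DERIV[where f="(\<lambda>x. bessel_J \<nu> x * bessel_Z \<nu> x)" and b=x and f'="\<lambda>x. ((bessel_Z \<nu> x)\<^sup>2 + (\<nu>\<^sup>2 - x\<^sup>2) * (bessel_J \<nu> x)\<^sup>2) / x"])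
    show "((\<lambda>x. bessel_J \<nu> x * bessel_Z \<nu> x) has_real_derivative ((bessel_Z \<nu> y)\<^sup>2 + (\<nu>\<^sup>2 - y\<^sup>2) * (bessel_J \<nu> y)\<^sup>2) / y) (at y)"
      if "0 < y" "y \<le> x" for y
      using that assms by (auto intro!: derivative_eq_intros d simp: field_simps power2_eq_square)
    have "((\<lambda>x. bessel_J \<nu> x * bessel_Z \<nu> x) \<longlongrightarrow> 0 * 0) (at_right 0)"
      by (intro tendsto_intros l)
    then show "((\<lambda>x. bessel_J \<nu> x * bessel_Z \<nu> x) \<longlongrightarrow> 0) (at_right 0)" by simp
    show "0 \<le> ((bessel_Z \<nu> y)\<^sup>2 + (\<nu>\<^sup>2 - y\<^sup>2) * (bessel_J \<nu> y)\<^sup>2) / y" if "0 < y" "y \<le> x" for y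
      using that le[OF that] by auto
  qed (use assms in auto)
qed

lemma bessel_below_mono: assumes "\<nu> > 0" "0 < x" "x \<le> y" "y \<le> \<nu>"
  shows "(bessel_J \<nu> x)\<^sup>2 \<le> (bessel_J \<nu> y)\<^sup>2" and "(bessel_Z \<nu> x)\<^sup>2 \<le> (bessel_Z \<nu> y)\<^sup>2"
proof -
  note d = DERIV_bessel_J DERIV_bessel_Z
  have JZ: "0 \<le> bessel_J \<nu> s * bessel_Z \<nu> s" if "x \<le> s" "s \<le> y" for s
    using that assms by (intro bessel_below_turning_point) auto
  show "(bessel_J \<nu> x)\<^sup>2 \<le> (bessel_J \<nu> y)\<^sup>2"
  proof (rule mono_from_DERIV[where f="(\<lambda>x. (bessel_J \<nu> x)\<^sup>2)" and a=x and b=y and f'="\<lambda>s. 2 * (bessel_J \<nu> s * bessel_Z \<nu> s) / s"])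
    show "((\<lambda>x. (bessel_J \<nu> x)\<^sup>2) has_real_derivative 2 * (bessel_J \<nu> s * bessel_Z \<nu> s) / s) (at s)"
      if "x \<le> s" "s \<le> y" for s
      using that assms by (auto intro!: derivative_eq_intros d)
    show "0 \<le> 2 * (bessel_J \<nu> s * bessel_Z \<nu> s) / s" if "x \<le> s" "s \<le> y" for s
      using JZ[OF that] that assms by auto
  qed (use assms in auto)
  show "(bessel_Z \<nu> x)\<^sup>2 \<le> (bessel_Z \<nu> y)\<^sup>2"
  proof (rule mono_from_DERIV[where f="(\<lambda>x. (bessel_Z \<nu> x)\<^sup>2)" and a=x and b=y and f'="\<lambda>s. 2 * ((\<nu>\<^sup>2 - s\<^sup>2) * (bessel_J \<nu> s * bessel_Z \<nu> s)) / s"])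
    show "((\<lambda>x. (bessel_Z \<nu> x)\<^sup>2) has_real_derivative 2 * ((\<nu>\<^sup>2 - s\<^sup>2) * (bessel_J \<nu> s * bessel_Z \<nu> s)) / s) (at s)"
      if "x \<le> s" "s \<le> y" for s
      using that assms by (auto intro!: derivative_eq_intros d)
    show "0 \<le> 2 * ((\<nu>\<^sup>2 - s\<^sup>2) * (bessel_J \<nu> s * bessel_Z \<nu> s)) / s" if "x \<le> s" "s \<le> y" for s
    proof -
      have "s\<^sup>2 \<le> \<nu>\<^sup>2" using that assms by (intro power_mono) auto
      then show ?thesis using JZ[OF that] that assms by auto
    qed
  qed (use assms in auto)
qed

text \<open>
  The two inequalities of \<open>bessel_below_turning_point\<close> say that \<open>J^2\<close> has logarithmic derivative at least
  \<open>2 sqrt (\<nu>^2 - x^2)\<close> with respect to \<open>log x\<close>, which is at least \<open>\<nu>\<close> on this range.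
\<close>

lemma bessel_below_decay: assumes "\<nu> > 0" "0 < x" "x \<le> \<nu>/2"
  shows "(bessel_J \<nu> x)\<^sup>2 \<le> (bessel_J \<nu> (\<nu>/2))\<^sup>2 * (2 * x / \<nu>) powr \<nu>"
proof -
  note d = DERIV_bessel_J DERIV_bessel_Z
  have JZ: "\<nu> * (bessel_J \<nu> s)\<^sup>2 \<le> 2 * (bessel_J \<nu> s * bessel_Z \<nu> s)" if "0 < s" "s \<le> \<nu>/2" for s
  proof -
    have "(\<nu>/2)\<^sup>2 * (bessel_J \<nu> s)\<^sup>2 \<le> (\<nu>\<^sup>2 - s\<^sup>2) * (bessel_J \<nu> s)\<^sup>2"
    proof (rule mult_right_mono)
      have "s\<^sup>2 \<le> (\<nu>/2)\<^sup>2" using that by (intro power_mono) auto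
      moreover have "(\<nu>/2)\<^sup>2 = \<nu>\<^sup>2 / 4" by (simp add: power_divide)
      ultimately show "(\<nu>/2)\<^sup>2 \<le> \<nu>\<^sup>2 - s\<^sup>2" using zero_le_power2[of \<nu>] by linarith
    qed auto
    also have "\<dots> \<le> (bessel_Z \<nu> s)\<^sup>2" using that assms by (intro bessel_below_turning_point) auto
    finally have "(\<nu>/2 * \<bar>bessel_J \<nu> s\<bar>)\<^sup>2 \<le> \<bar>bessel_Z \<nu> s\<bar>\<^sup>2" by (simp add: power_mult_distrib power_divide)
    then have "\<nu>/2 * \<bar>bessel_J \<nu> s\<bar> \<le> \<bar>bessel_Z \<nu> s\<bar>" by (rule power2_le_imp_le) auto
    then have "\<bar>bessel_J \<nu> s\<bar> * (\<nu>/2 * \<bar>bessel_J \<nu> s\<bar>) \<le> \<bar>bessel_J \<nu> s\<bar> * \<bar>bessel_Z \<nu> s\<bar>" by (intro mult_left_mono) auto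
    also have "\<dots> = bessel_J \<nu> s * bessel_Z \<nu> s"
      using bessel_below_turning_point(2)[of \<nu> s] that assms by (simp add: abs_mult[symmetric])
    finally show ?thesis by (simp add: power2_eq_square abs_mult[symmetric] mult_ac)
  qed
  have "(bessel_J \<nu> x)\<^sup>2 * x powr (-\<nu>) \<le> (bessel_J \<nu> (\<nu>/2))\<^sup>2 * (\<nu>/2) powr (-\<nu>)"
  proof (rule mono_from_DERIV[where f="(\<lambda>x. (bessel_J \<nu> x)\<^sup>2 * x powr (-\<nu>))" and a=x and b="\<nu>/2" and f'="\<lambda>s. (2 * (bessel_J \<nu> s * bessel_Z \<nu> s) - \<nu> * (bessel_J \<nu> s)\<^sup>2) * s powr (-\<nu>) / s"])
    show "((\<lambda>x. (bessel_J \<nu> x)\<^sup>2 * x powr (-\<nu>)) has_real_derivative (2 * (bessel_J \<nu> s * bessel_Z \<nu> s) - \<nu> * (bessel_J \<nu> s)\<^sup>2) * s powr (-\<nu>) / s) (at s)"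
      if "x \<le> s" "s \<le> \<nu>/2" for s
      using that assms by (auto intro!: derivative_eq_intros d simp: powr_diff field_simps)
    show "0 \<le> (2 * (bessel_J \<nu> s * bessel_Z \<nu> s) - \<nu> * (bessel_J \<nu> s)\<^sup>2) * s powr (-\<nu>) / s" if "x \<le> s" "s \<le> \<nu>/2" for s
      using JZ[of s] that assms by auto
  qed (use assms in auto)
  then have "(bessel_J \<nu> x)\<^sup>2 \<le> (bessel_J \<nu> (\<nu>/2))\<^sup>2 * ((\<nu>/2) powr (-\<nu>) * x powr \<nu>)"
    using assms by (simp add: powr_minus field_simps)
  also have "(\<nu>/2) powr (-\<nu>) * x powr \<nu> = (2 * x / \<nu>) powr \<nu>"
    using assms by (simp add: powr_minus powr_divide powr_mult field_simps)
  finally show ?thesis .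
qed

text \<open>This is \<open>x (J_\<nu>(x)^2 + J_\<nu>'(x)^2)\<close>, which tends to \<open>2/\<pi>\<close> at infinity for every order.\<close>

abbreviation bessel_energy :: "real \<Rightarrow> real \<Rightarrow> real" where
  "bessel_energy \<nu> x \<equiv> x * (bessel_J \<nu> x)\<^sup>2 + (bessel_Z \<nu> x)\<^sup>2 / x"

text \<open>
  The function \<open>v = sqrt x J_\<nu>(x)\<close> solves \<open>v'' + v = (\<nu>^2 - 1/4) v / x^2\<close>, so the derivative of \<open>v^2 + v'^2\<close> is
  at most \<open>|\<nu>^2 - 1/4| / x^2\<close> times itself, and this factor is integrable at infinity. The constant grows
  exponentially in \<open>N^2\<close>; for large orders only the limit at infinity is used.
\<close>

lemma bessel_bounded_order: "\<exists>K>0. \<forall>\<nu>\<in>{0..N}. \<forall>x\<ge>1. bessel_energy \<nu> x \<le> K"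
proof -
  note d = DERIV_bessel_J DERIV_bessel_Z
  obtain c where c: "c > 0" "\<And>\<nu> x. \<nu> \<ge> 0 \<Longrightarrow> x > 0 \<Longrightarrow> \<bar>bessel_J \<nu> x\<bar> \<le> c * (x/2) powr \<nu> * exp (x\<^sup>2/4)"
    using bessel_J_small by blast
  define b where "b = c * exp (1/4)"
  have J1: "\<bar>bessel_J \<nu> 1\<bar> \<le> b" if "\<nu> \<ge> 0" for \<nu>
  proof -
    have "(1/2) powr \<nu> \<le> (1::real)" using that by (intro powr_le1) auto
    then have "c * (1/2) powr \<nu> * exp (1\<^sup>2/4) \<le> c * 1 * exp (1/4)"
      using c(1) by (intro mult_mono) auto
    then show ?thesis using c(2)[OF that, of 1] by (simp add: b_def)
  qed
  define \<mu> where "\<mu> = N\<^sup>2 + 1"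
  \<comment> \<open>For \<open>v = sqrt x J\<close> this is \<open>v^2 + v'^2\<close>, because \<open>v' = (Z + J/2) / sqrt x\<close>.\<close>
  define E where "E = (\<lambda>\<nu> x. x * (bessel_J \<nu> x)\<^sup>2 + (bessel_Z \<nu> x + bessel_J \<nu> x / 2)\<^sup>2 / x)"
  have mono: "E \<nu> x * exp (\<mu> / x) \<le> E \<nu> 1 * exp (\<mu> / 1)" if nu: "\<nu> \<in> {0..N}" and x: "x \<ge> 1" for \<nu> x
  proof -
    define E' where "E' = (\<lambda>s. 2 * (\<nu>\<^sup>2 - 1/4) * bessel_J \<nu> s * (bessel_Z \<nu> s + bessel_J \<nu> s / 2) / s\<^sup>2)"
    have "- (E \<nu> 1 * exp (\<mu> / 1)) \<le> - (E \<nu> x * exp (\<mu> / x))"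
    proof (rule mono_from_DERIV[where f="\<lambda>s. - (E \<nu> s * exp (\<mu> / s))" and a=1 and b=x and
            f'="\<lambda>s. - ((E' s - \<mu> / s\<^sup>2 * E \<nu> s) * exp (\<mu> / s))"])
      fix s assume s: "1 \<le> s" "s \<le> x"
      have dE: "(E \<nu> has_real_derivative E' s) (at s)"
        unfolding E_def E'_def using s nu
        by (auto intro!: derivative_eq_intros d simp: field_simps power2_eq_square)
      show "((\<lambda>s. - (E \<nu> s * exp (\<mu> / s))) has_real_derivative - ((E' s - \<mu> / s\<^sup>2 * E \<nu> s) * exp (\<mu> / s))) (at s)"
        using s by (auto intro!: derivative_eq_intros dE simp: field_simps power2_eq_square)
      define J where "J = bessel_J \<nu> s"
      define V where "V = bessel_Z \<nu> s + bessel_J \<nu> s / 2"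
      have "2 * \<bar>J\<bar> * \<bar>V\<bar> \<le> s * J\<^sup>2 + V\<^sup>2 / s"
      proof -
        have "0 \<le> (s * \<bar>J\<bar> - \<bar>V\<bar>)\<^sup>2 / s" using s by auto
        also have "\<dots> = s * J\<^sup>2 + V\<^sup>2 / s - 2 * \<bar>J\<bar> * \<bar>V\<bar>"
          using s by (simp add: field_simps power2_eq_square)
        finally show ?thesis by simp
      qed
      then have 1: "2 * \<bar>J\<bar> * \<bar>V\<bar> \<le> E \<nu> s" by (simp add: E_def J_def V_def)
      have "\<nu>\<^sup>2 \<le> N\<^sup>2" using nu by (intro power_mono) auto
      then have 2: "\<bar>\<nu>\<^sup>2 - 1/4\<bar> \<le> \<mu>" using zero_le_power2[of \<nu>] unfolding \<mu>_def abs_le_iff by linarith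
      have "E' s \<le> \<bar>\<nu>\<^sup>2 - 1/4\<bar> * (2 * \<bar>J\<bar> * \<bar>V\<bar>) / s\<^sup>2"
      proof -
        have "E' s = (\<nu>\<^sup>2 - 1/4) * (2 * J * V) / s\<^sup>2"
          by (simp add: E'_def J_def V_def algebra_simps)
        also have "\<dots> \<le> \<bar>(\<nu>\<^sup>2 - 1/4) * (2 * J * V) / s\<^sup>2\<bar>" by (rule abs_ge_self)
        also have "\<dots> = \<bar>\<nu>\<^sup>2 - 1/4\<bar> * (2 * \<bar>J\<bar> * \<bar>V\<bar>) / s\<^sup>2"
          unfolding abs_divide abs_mult by simp
        finally show ?thesis .
      qed
      also have "\<dots> \<le> \<mu> * E \<nu> s / s\<^sup>2"
        by (intro divide_right_mono mult_mono 1 2) (auto simp: \<mu>_def)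
      finally show "0 \<le> - ((E' s - \<mu> / s\<^sup>2 * E \<nu> s) * exp (\<mu> / s))" by (simp add: mult_le_0_iff)
    qed (use x in auto)
    then show ?thesis by simp
  qed
  define B where "B = (b\<^sup>2 + (\<bar>N\<bar> * b + b + b/2)\<^sup>2) * exp \<mu>"
  have b0: "b > 0" using c(1) by (simp add: b_def)
  have EB: "E \<nu> x \<le> B" if nu: "\<nu> \<in> {0..N}" and x: "x \<ge> 1" for \<nu> x
  proof -
    have E0: "E \<nu> x \<ge> 0" using x by (auto simp: E_def)
    have Z: "\<bar>bessel_Z \<nu> 1\<bar> \<le> \<bar>N\<bar> * b + b"
    proof -
      have "\<bar>bessel_Z \<nu> 1\<bar> \<le> \<nu> * \<bar>bessel_J \<nu> 1\<bar> + \<bar>bessel_J (\<nu>+1) 1\<bar>"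
        unfolding bessel_Z_def using nu abs_triangle_ineq4[of "\<nu> * bessel_J \<nu> 1" "1 * bessel_J (\<nu>+1) 1"]
        by (simp add: abs_mult)
      also have "\<dots> \<le> \<bar>N\<bar> * b + b" using nu J1[of \<nu>] J1[of "\<nu>+1"]
        by (intro add_mono mult_mono) auto
      finally show ?thesis .
    qed
    have "E \<nu> x \<le> E \<nu> x * exp (\<mu> / x)" using E0 x by (simp add: mult_le_cancel_left1 \<mu>_def)
    also have "\<dots> \<le> E \<nu> 1 * exp \<mu>" using mono[OF that] by simp
    also have "E \<nu> 1 \<le> b\<^sup>2 + (\<bar>N\<bar> * b + b + b/2)\<^sup>2"
    proof -
      have "(bessel_J \<nu> 1)\<^sup>2 \<le> b\<^sup>2" using J1[of \<nu>] nu by (intro abs_le_square_iff[THEN iffD1]) auto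
      moreover have "(bessel_Z \<nu> 1 + bessel_J \<nu> 1 / 2)\<^sup>2 \<le> (\<bar>N\<bar> * b + b + b/2)\<^sup>2"
      proof (rule abs_le_square_iff[THEN iffD1])
        have "\<bar>bessel_Z \<nu> 1 + bessel_J \<nu> 1 / 2\<bar> \<le> \<bar>N\<bar> * b + b + b/2"
          using Z J1[of \<nu>] nu by (auto simp: abs_le_iff)
        then show "\<bar>bessel_Z \<nu> 1 + bessel_J \<nu> 1 / 2\<bar> \<le> \<bar>\<bar>N\<bar> * b + b + b/2\<bar>" by linarith
      qed
      ultimately show ?thesis by (simp add: E_def)
    qed
    finally show ?thesis by (simp add: B_def)
  qed
  have "bessel_energy \<nu> x \<le> 3 * B" if nu: "\<nu> \<in> {0..N}" and x: "x \<ge> 1" for \<nu> x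
  proof -
    define J where "J = bessel_J \<nu> x"
    define Z where "Z = bessel_Z \<nu> x"
    have "0 \<le> (Z + J)\<^sup>2 / x" using x by simp
    then have "Z\<^sup>2 / x \<le> 2 * (Z + J/2)\<^sup>2 / x + J\<^sup>2 / 2 / x"
      using x by (simp add: field_simps power2_eq_square)
    also have "J\<^sup>2 / 2 / x \<le> x * J\<^sup>2"
    proof -
      have "J\<^sup>2 / (2 * x) \<le> J\<^sup>2 / 1" using x by (intro divide_left_mono) auto
      then have "J\<^sup>2 / 2 / x \<le> J\<^sup>2 / 1" by (simp add: field_simps)
      also have "\<dots> \<le> x * J\<^sup>2" using x by (simp add: mult_le_cancel_right1)
      finally show ?thesis .
    qed
    finally have "x * J\<^sup>2 + Z\<^sup>2 / x \<le> 2 * (x * J\<^sup>2 + (Z + J/2)\<^sup>2 / x)" by simp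
    also have "\<dots> \<le> 2 * B" using EB[OF that] by (simp add: E_def J_def Z_def)
    also have "2 * B \<le> 3 * B" by (simp add: B_def)
    finally show ?thesis by (simp add: J_def Z_def)
  qed
  moreover have "3 * B > 0" using b0 unfolding B_def
    by (intro mult_pos_pos add_pos_nonneg) auto
  ultimately show ?thesis by blast
qed

text \<open>
  By the recurrences \<open>J_(\<nu>+1) = (\<nu>/x) J_\<nu> - J_\<nu>'\<close> and \<open>J_(\<nu>+1)' = J_\<nu> - ((\<nu>+1)/x) J_(\<nu>+1)\<close> the pair
  \<open>(J, J')\<close> for the order \<open>\<nu> + 1\<close> is, up to an error of size \<open>1/x\<close>, a rotation of the pair for \<open>\<nu>\<close>. Hence the
  energy at infinity has period 1 in \<open>\<nu>\<close>.
\<close>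

lemma bessel_energy_step:
  assumes "\<nu> \<ge> 0"
  defines "W \<equiv> (bessel_energy)"
  shows "\<exists>C\<ge>0. \<forall>x\<ge>1. W (\<nu> + 1) x \<le> (1 + C / x) * W \<nu> x"
proof -
  define m where "m = \<nu> + \<nu>\<^sup>2"
  define C where "C = m + ((\<nu>+1) + (\<nu>+1)\<^sup>2) * (2 + m)"
  have m0: "m \<ge> 0" using assms(1) by (simp add: m_def)
  have C0: "C \<ge> 0" using assms(1) m0 by (auto simp: C_def)
  have "W (\<nu> + 1) x \<le> (1 + C / x) * W \<nu> x" if x: "x \<ge> 1" for x
  proof -
    define t where "t = 1 / x"
    have t: "0 < t" "t \<le> 1" using x by (auto simp: t_def)
    then have t2: "t\<^sup>2 \<le> t" by (simp add: power2_eq_square mult_le_cancel_left1)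
    define a where "a = bessel_J \<nu> x"
    define b where "b = bessel_Z \<nu> x * t"
    define a1 where "a1 = bessel_J (\<nu> + 1) x"
    define b1 where "b1 = bessel_Z (\<nu> + 1) x * t"
    have xt: "x * t = 1" using x by (simp add: t_def)
    have a1: "a1 = \<nu> * t * a - b"
      using x by (simp add: a1_def a_def b_def t_def bessel_Z_def field_simps)
    have b1: "b1 = a - (\<nu> + 1) * t * a1"
    proof -
      have "bessel_J (\<nu> + 1 + 1) x = 2 * (\<nu> + 1) / x * bessel_J (\<nu> + 1) x - bessel_J \<nu> x"
        using bessel_J_rec[of x \<nu>] x assms(1) by (simp add: add.assoc)
      then show ?thesis using x
        by (simp add: b1_def a1_def a_def t_def bessel_Z_def field_simps)
    qed
    have W: "W \<nu> x = x * (a\<^sup>2 + b\<^sup>2)" "W (\<nu> + 1) x = x * (a1\<^sup>2 + b1\<^sup>2)"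
      using x by (auto simp: W_def a_def b_def a1_def b1_def t_def field_simps power2_eq_square)
    define S where "S = a\<^sup>2 + b\<^sup>2"
    have S0: "S \<ge> 0" "a\<^sup>2 \<le> S" by (auto simp: S_def)
    have ab: "2 * \<bar>u * v\<bar> \<le> u\<^sup>2 + v\<^sup>2" for u v :: real
      using zero_le_power2[of "\<bar>u\<bar> - \<bar>v\<bar>"] by (simp add: power2_diff abs_mult)
    have 1: "a1\<^sup>2 \<le> b\<^sup>2 + m * t * S"
    proof -
      have "a1\<^sup>2 = b\<^sup>2 + \<nu>\<^sup>2 * t\<^sup>2 * a\<^sup>2 - \<nu> * t * (2 * (a * b))"
        by (simp add: a1 power2_eq_square algebra_simps)
      also have "\<dots> \<le> b\<^sup>2 + \<nu>\<^sup>2 * t * S + \<nu> * t * S"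
      proof -
        have "\<nu>\<^sup>2 * t\<^sup>2 * a\<^sup>2 \<le> \<nu>\<^sup>2 * t * S" using S0 t2 t by (intro mult_mono mult_left_mono) auto
        moreover have "\<nu> * t * (- (2 * (a * b))) \<le> \<nu> * t * S"
          using ab[of a b] t assms(1) by (intro mult_left_mono) (auto simp: S_def abs_le_iff)
        ultimately show ?thesis by simp
      qed
      finally show ?thesis by (simp add: m_def algebra_simps)
    qed
    have 2: "a1\<^sup>2 \<le> (1 + m) * S"
    proof -
      have "m * t * S \<le> m * 1 * S" using t m0 S0 by (intro mult_mono mult_left_mono) auto
      moreover have "b\<^sup>2 \<le> S" by (simp add: S_def)
      ultimately show ?thesis using 1 by (simp add: algebra_simps)
    qed
    have 3: "b1\<^sup>2 \<le> a\<^sup>2 + t * (((\<nu>+1) + (\<nu>+1)\<^sup>2) * ((2 + m) * S))"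
    proof -
      have "b1\<^sup>2 = a\<^sup>2 + (\<nu>+1)\<^sup>2 * (t\<^sup>2 * a1\<^sup>2) + (\<nu>+1) * t * (- (2 * (a * a1)))"
        by (simp add: b1 power2_eq_square algebra_simps)
      also have "\<dots> \<le> a\<^sup>2 + (\<nu>+1)\<^sup>2 * (t * ((2+m) * S)) + (\<nu>+1) * t * ((2+m) * S)"
      proof -
        have "(\<nu>+1)\<^sup>2 * (t\<^sup>2 * a1\<^sup>2) \<le> (\<nu>+1)\<^sup>2 * (t * ((2+m) * S))"
          using 2 S0 t2 t by (intro mult_left_mono mult_mono) (auto simp: algebra_simps)
        moreover have "(\<nu>+1) * t * (- (2 * (a * a1))) \<le> (\<nu>+1) * t * ((2+m) * S)"
          using ab[of a a1] t assms(1) 2 S0 by (intro mult_left_mono) (auto simp: algebra_simps abs_le_iff)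
        ultimately show ?thesis by simp
      qed
      finally show ?thesis by (simp add: algebra_simps)
    qed
    have "a1\<^sup>2 + b1\<^sup>2 \<le> S + t * (C * S)"
      using 1 3 by (simp add: C_def S_def algebra_simps)
    then have "x * (a1\<^sup>2 + b1\<^sup>2) \<le> x * (S + t * (C * S))" using x by (intro mult_left_mono) auto
    then show ?thesis unfolding W S_def[symmetric] by (simp add: t_def algebra_simps)
  qed
  then show ?thesis using C0 by blast
qed

text \<open>
  The orders in \<open>[0,1]\<close> bound the energy at infinity for all orders. How far out the bound starts to hold
  depends on \<open>\<nu>\<close>, but the bound does not; the factor \<open>c > 1\<close> in the induction absorbs the errors of the
  finitely many steps.
\<close>

lemma bessel_energy_at_top:
  defines "W \<equiv> (bessel_energy)"
  shows "\<exists>K>0. \<forall>\<nu>\<ge>0. \<forall>\<^sub>F x in at_top. W \<nu> x \<le> K"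
proof -
  obtain K where K: "K > 0" "\<And>\<nu> x. \<nu> \<in> {0..1} \<Longrightarrow> x \<ge> 1 \<Longrightarrow> W \<nu> x \<le> K"
    using bessel_bounded_order[of 1] unfolding W_def by blast
  have *: "\<forall>c>1. \<forall>\<^sub>F x in at_top. W (\<nu> + real k) x \<le> c * K" if nu: "\<nu> \<in> {0..1}" for \<nu> k
  proof (induction k)
    case 0
    have "\<forall>\<^sub>F x in at_top. W \<nu> x \<le> c * K" if "c > 1" for c
      using eventually_ge_at_top[of 1]
    proof eventually_elim
      case (elim x)
      have "W \<nu> x \<le> 1 * K" using K(2)[OF nu elim] by simp
      also have "\<dots> \<le> c * K" using that K(1) by (intro mult_right_mono) auto
      finally show ?case .
    qed
    then show ?case by simp
  next
    case (Suc k)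
    obtain C where C: "C \<ge> 0" "\<And>x. x \<ge> 1 \<Longrightarrow> W (\<nu> + real k + 1) x \<le> (1 + C / x) * W (\<nu> + real k) x"
      using bessel_energy_step[of "\<nu> + real k"] nu unfolding W_def by auto
    have "\<forall>\<^sub>F x in at_top. W (\<nu> + real (Suc k)) x \<le> c * K" if c: "c > 1" for c
    proof -
      have s: "sqrt c > 1" using c by simp
      have "((\<lambda>x. 1 + C / x) \<longlongrightarrow> 1 + 0) at_top"
        by (intro tendsto_add tendsto_const tendsto_divide_0[OF tendsto_const] filterlim_at_top_imp_at_infinity filterlim_ident)
      then have "\<forall>\<^sub>F x in at_top. 1 + C / x < sqrt c" using s by (intro order_tendstoD) auto
      moreover have "\<forall>\<^sub>F x in at_top. W (\<nu> + real k) x \<le> sqrt c * K" using Suc s by blast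
      ultimately show ?thesis using eventually_ge_at_top[of 1]
      proof eventually_elim
        case (elim x)
        have "W (\<nu> + real (Suc k)) x \<le> (1 + C / x) * W (\<nu> + real k) x"
          using C(2)[of x] elim by (simp add: add_ac)
        also have "\<dots> \<le> sqrt c * (sqrt c * K)"
          using elim C(1) K(1) s by (intro mult_mono) (auto simp: W_def)
        also have "\<dots> = c * K" using c by (simp add: mult.assoc[symmetric])
        finally show ?case .
      qed
    qed
    then show ?case by blast
  qed
  have "\<forall>\<^sub>F x in at_top. W \<nu> x \<le> 2 * K" if "\<nu> \<ge> 0" for \<nu>
  proof -
    have "\<nu> = frac \<nu> + real (nat \<lfloor>\<nu>\<rfloor>)" using that by (simp add: frac_def)
    moreover have "frac \<nu> \<in> {0..1}" using frac_lt_1[of \<nu>] frac_ge_0[of \<nu>] by auto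
    ultimately show ?thesis using *[of "frac \<nu>" "nat \<lfloor>\<nu>\<rfloor>"] by auto
  qed
  then show ?thesis using K(1) by (intro exI[of _ "2 * K"]) auto
qed

text \<open>
  Put \<open>y(s) = J_\<nu>(e^s)\<close> and \<open>p = e^(2s) - \<nu>^2\<close>, so that \<open>y'' + p y = 0\<close>. For every function \<open>a\<close> the form
  \<open>a y'^2 - a' y y' + (a p + a''/2) y^2\<close> has derivative \<open>(b/2 + 2 p a' + p' a) y^2\<close>, where \<open>b\<close> is the third
  derivative of \<open>a\<close>. The WKB amplitude   \<open>a = p^(-1/2)\<close> cancels the last two terms, but it is singular at the turning point and \<open>b < 0\<close>.
  The amplitude \<open>a = (p + 4 m^2)^(-1/2)\<close> with \<open>m = \<nu>^(2/3)\<close> agrees with it away from the turning point and,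
  since \<open>4 m^2\<close> is the size of \<open>p\<close> at the edge of the transition zone, leaves a nonnegative
  derivative. So the form, called \<open>Q\<close> below, increases towards its value at infinity, which is the energy
  bounded in \<open>bessel_energy_at_top\<close>. In the definitions \<open>T\<close> is \<open>a\<close>, and \<open>\<beta> = \<nu>^2 - 4 m^2\<close>.
\<close>

locale bessel_large_order =
  fixes \<nu> m :: real
  assumes m: "m \<ge> 9" and nu: "\<nu> > 0" and nu_m: "\<nu>\<^sup>2 = m ^ 3"
begin

definition \<beta> where "\<beta> = m ^ 3 - 4 * m\<^sup>2"
definition T where "T r = inverse (sqrt (r\<^sup>2 - \<beta>))"
definition Q where "Q r = T r * (bessel_Z \<nu> r)\<^sup>2 + r\<^sup>2 * T r ^ 3 * bessel_J \<nu> r * bessel_Z \<nu> r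
   + (T r * (r\<^sup>2 - \<nu>\<^sup>2) + r\<^sup>2 * T r ^ 3 * (1 + 3 * \<beta> * (T r)\<^sup>2) / 2) * (bessel_J \<nu> r)\<^sup>2"

lemma beta_alt: "\<beta> = m\<^sup>2 * (m - 4)" by (simp add: \<beta>_def algebra_simps power2_eq_square power3_eq_cube)

lemma beta_pos: "\<beta> > 0" using m by (simp add: beta_alt)

lemma P_ge: "r \<ge> \<nu> \<Longrightarrow> r\<^sup>2 - \<beta> \<ge> 4 * m\<^sup>2"
  using power_mono[of \<nu> r 2] nu by (simp add: \<beta>_def nu_m)

lemma T_props: assumes "r \<ge> \<nu>"
  shows "T r > 0" "(T r)\<^sup>2 * (r\<^sup>2 - \<beta>) = 1" "(T r)\<^sup>2 * (4 * m\<^sup>2) \<le> 1" "r\<^sup>2 * (T r)\<^sup>2 = 1 + \<beta> * (T r)\<^sup>2"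
proof -
  have p: "r\<^sup>2 - \<beta> > 0" using P_ge[OF assms] m by (smt (verit) zero_less_power)
  show "T r > 0" using p by (simp add: T_def)
  show 1: "(T r)\<^sup>2 * (r\<^sup>2 - \<beta>) = 1" using p by (simp add: T_def power_inverse)
  have "(T r)\<^sup>2 * (4 * m\<^sup>2) \<le> (T r)\<^sup>2 * (r\<^sup>2 - \<beta>)" using P_ge[OF assms] by (intro mult_left_mono) auto
  then show "(T r)\<^sup>2 * (4 * m\<^sup>2) \<le> 1" using 1 by simp
  show "r\<^sup>2 * (T r)\<^sup>2 = 1 + \<beta> * (T r)\<^sup>2" using 1 by (simp add: algebra_simps)
qed

lemma DERIV_T: assumes "r \<ge> \<nu>" shows "(T has_real_derivative (- r * T r ^ 3)) (at r)"
proof -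
  have p: "r\<^sup>2 - \<beta> > 0" using P_ge[OF assms] m by (smt (verit) zero_less_power)
  have "((\<lambda>r. inverse (sqrt (r\<^sup>2 - \<beta>))) has_real_derivative (- r * T r ^ 3)) (at r)"
    using p by (auto intro!: derivative_eq_intros simp: T_def field_simps power3_eq_cube power2_eq_square)
  then show ?thesis by (simp add: T_def[abs_def])
qed

lemma DERIV_Q: assumes "r \<ge> \<nu>"
  shows "(Q has_real_derivative (r * T r ^ 3 * (8 * m\<^sup>2 - (1 + 12 * (\<beta> * (T r)\<^sup>2) + 15 * (\<beta> * (T r)\<^sup>2)\<^sup>2) / 2)
    * (bessel_J \<nu> r)\<^sup>2)) (at r)"
proof -
  have r: "r > 0" using assms nu by simp
  note d = DERIV_bessel_J[OF r] DERIV_bessel_Z[OF r] DERIV_T[OF assms]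
  define t where "t = T r"
  define J where "J = bessel_J \<nu> r"
  define Z where "Z = bessel_Z \<nu> r"
  \<comment> \<open>The coefficients of \<open>J Z\<close> and \<open>J^2\<close> in the derivative; the one of \<open>Z^2\<close> is 0.\<close>
  define JZc where "JZc = 3 * r * t^3 - 3 * r^3 * t^5 + 3 * r * \<beta> * t^5"
  define JJc where "JJc = 2 * (r * t^3 * (\<nu>\<^sup>2 - r\<^sup>2)) + 2 * r * t + r * t^3 * (1 + 3 * \<beta> * t\<^sup>2)
     - 3/2 * r^3 * t^5 * (1 + 3 * \<beta> * t\<^sup>2) - 3 * \<beta> * r^3 * t^7"
  have "(Q has_real_derivative (JZc * (J * Z) + JJc * J\<^sup>2)) (at r)"
  proof -
    have dZ2: "((\<lambda>r. (bessel_Z \<nu> r)\<^sup>2) has_real_derivative (2 * Z * ((\<nu>\<^sup>2 - r\<^sup>2) * J / r))) (at r)"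
      using nu by (auto intro!: derivative_eq_intros d simp: Z_def J_def)
    have dJ2: "((\<lambda>r. (bessel_J \<nu> r)\<^sup>2) has_real_derivative (2 * J * (Z / r))) (at r)"
      using nu by (auto intro!: derivative_eq_intros d simp: Z_def J_def)
    have dJZ: "((\<lambda>r. bessel_J \<nu> r * bessel_Z \<nu> r) has_real_derivative (Z\<^sup>2 / r + (\<nu>\<^sup>2 - r\<^sup>2) * J\<^sup>2 / r)) (at r)"
      using nu by (auto intro!: derivative_eq_intros d simp: Z_def J_def power2_eq_square)
    have dc: "((\<lambda>r. r\<^sup>2 * T r ^ 3) has_real_derivative (2 * r * t^3 - 3 * r^3 * t^5)) (at r)"
      by (auto intro!: derivative_eq_intros d simp: t_def power_numeral_reduce algebra_simps)
    have de: "((\<lambda>r. 1 + 3 * \<beta> * (T r)\<^sup>2) has_real_derivative (- 6 * \<beta> * r * t^4)) (at r)"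
      by (auto intro!: derivative_eq_intros d simp: t_def power_numeral_reduce algebra_simps)
    have df: "((\<lambda>r. T r * (r\<^sup>2 - \<nu>\<^sup>2)) has_real_derivative (- r * t^3 * (r\<^sup>2 - \<nu>\<^sup>2) + 2 * r * t)) (at r)"
      by (auto intro!: derivative_eq_intros d simp: t_def power_numeral_reduce algebra_simps)
    have Q: "Q = (\<lambda>r. T r * (bessel_Z \<nu> r)\<^sup>2 + (r\<^sup>2 * T r ^ 3) * (bessel_J \<nu> r * bessel_Z \<nu> r)
      + (T r * (r\<^sup>2 - \<nu>\<^sup>2) + 1/2 * ((r\<^sup>2 * T r ^ 3) * (1 + 3 * \<beta> * (T r)\<^sup>2))) * (bessel_J \<nu> r)\<^sup>2)"
      by (rule ext) (simp add: Q_def)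
    define r' where "r' = 1 / r"
    have rr: "r * r' = 1" "u / r = u * r'" for u using r by (auto simp: r'_def)
    show ?thesis unfolding Q
    proof (rule DERIV_cong[OF DERIV_add[OF DERIV_add[OF DERIV_mult[OF d(3) dZ2] DERIV_mult[OF dc dJZ]]
         DERIV_mult[OF DERIV_add[OF df DERIV_cmult[OF DERIV_mult[OF dc de]]] dJ2]]])
      have rr2: "r\<^sup>2 * r' = r" "r^3 * r' = r\<^sup>2" "r^4 * r' = r^3" using r by (auto simp: r'_def power_numeral_reduce)
      have "- r * T r ^ 3 * (bessel_Z \<nu> r)\<^sup>2 + 2 * Z * ((\<nu>\<^sup>2 - r\<^sup>2) * J / r) * T r +
        ((2 * r * t^3 - 3 * r^3 * t^5) * (bessel_J \<nu> r * bessel_Z \<nu> r) + (Z\<^sup>2 / r + (\<nu>\<^sup>2 - r\<^sup>2) * J\<^sup>2 / r) * (r\<^sup>2 * T r ^ 3)) +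
        ((- r * t^3 * (r\<^sup>2 - \<nu>\<^sup>2) + 2 * r * t + 1/2 * ((2 * r * t^3 - 3 * r^3 * t^5) * (1 + 3 * \<beta> * (T r)\<^sup>2)
           + (- 6 * \<beta> * r * t^4) * (r\<^sup>2 * T r ^ 3))) * (bessel_J \<nu> r)\<^sup>2 +
         2 * J * (Z / r) * (T r * (r\<^sup>2 - \<nu>\<^sup>2) + 1/2 * ((r\<^sup>2 * T r ^ 3) * (1 + 3 * \<beta> * (T r)\<^sup>2))))
        = JZc * (J * Z) + JJc * J\<^sup>2 + (r\<^sup>2 * r' - r) * (t^3 * (Z\<^sup>2 + (\<nu>\<^sup>2 - r\<^sup>2) * J\<^sup>2) + J * Z * t^3 * (1 + 3 * \<beta> * t\<^sup>2))"
        unfolding J_def[symmetric] Z_def[symmetric] t_def[symmetric] JZc_def JJc_def rr(2)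
        by (simp add: algebra_simps power_numeral_reduce)
      also have "\<dots> = JZc * (J * Z) + JJc * J\<^sup>2" using rr2(1) by simp
      finally show "- r * T r ^ 3 * (bessel_Z \<nu> r)\<^sup>2 + 2 * Z * ((\<nu>\<^sup>2 - r\<^sup>2) * J / r) * T r +
        ((2 * r * t^3 - 3 * r^3 * t^5) * (bessel_J \<nu> r * bessel_Z \<nu> r) + (Z\<^sup>2 / r + (\<nu>\<^sup>2 - r\<^sup>2) * J\<^sup>2 / r) * (r\<^sup>2 * T r ^ 3)) +
        ((- r * t^3 * (r\<^sup>2 - \<nu>\<^sup>2) + 2 * r * t + 1/2 * ((2 * r * t^3 - 3 * r^3 * t^5) * (1 + 3 * \<beta> * (T r)\<^sup>2)
           + (- 6 * \<beta> * r * t^4) * (r\<^sup>2 * T r ^ 3))) * (bessel_J \<nu> r)\<^sup>2 +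
         2 * J * (Z / r) * (T r * (r\<^sup>2 - \<nu>\<^sup>2) + 1/2 * ((r\<^sup>2 * T r ^ 3) * (1 + 3 * \<beta> * (T r)\<^sup>2))))
        = JZc * (J * Z) + JJc * J\<^sup>2" .
    qed
  qed
  moreover have c: "r\<^sup>2 * t\<^sup>2 = 1 + \<beta> * t\<^sup>2" using T_props(4)[OF assms] by (simp add: t_def)
  moreover have "JZc = 0"
  proof -
    have "JZc = 3 * r * t^3 * (1 - r\<^sup>2 * t\<^sup>2 + \<beta> * t\<^sup>2)"
      unfolding JZc_def by (simp add: algebra_simps power_numeral_reduce)
    then show ?thesis using c by simp
  qed
  moreover have "JJc = r * t ^ 3 * (8 * m\<^sup>2 - (1 + 12 * (\<beta> * t\<^sup>2) + 15 * (\<beta> * t\<^sup>2)\<^sup>2) / 2)"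
  proof -
    have "JJc = r * t^3 * (2 * (\<nu>\<^sup>2 - r\<^sup>2) + (1 + 3 * (\<beta> * t\<^sup>2)) - 3/2 * (r\<^sup>2 * t\<^sup>2) * (1 + 3 * (\<beta> * t\<^sup>2))
       - 3 * (\<beta> * t\<^sup>2) * (r\<^sup>2 * t\<^sup>2)) + 2 * r * t * 1"
      unfolding JJc_def by (simp add: algebra_simps power_numeral_reduce)
    also have "(1::real) = t\<^sup>2 * (r\<^sup>2 - \<beta>)" using T_props(2)[OF assms] by (simp add: t_def)
    also have "2 * r * t * (t\<^sup>2 * (r\<^sup>2 - \<beta>)) = r * t^3 * (2 * (r\<^sup>2 - \<beta>))"
      by (simp add: algebra_simps power_numeral_reduce)
    finally have "JJc = r * t^3 * (2 * (\<nu>\<^sup>2 - r\<^sup>2) + (1 + 3 * (\<beta> * t\<^sup>2)) - 3/2 * (r\<^sup>2 * t\<^sup>2) * (1 + 3 * (\<beta> * t\<^sup>2))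
       - 3 * (\<beta> * t\<^sup>2) * (r\<^sup>2 * t\<^sup>2)) + r * t^3 * (2 * (r\<^sup>2 - \<beta>))"
      using T_props(2)[OF assms] by (simp add: t_def)
    also have "\<dots> = r * t^3 * (2 * (\<nu>\<^sup>2 - \<beta>) - (1 + 12 * (\<beta> * t\<^sup>2) + 15 * (\<beta> * t\<^sup>2)\<^sup>2) / 2)"
      unfolding c by (simp add: algebra_simps power2_eq_square)
    also have "2 * (\<nu>\<^sup>2 - \<beta>) = 8 * m\<^sup>2" by (simp add: nu_m \<beta>_def)
    finally show ?thesis .
  qed
  ultimately show ?thesis by (simp add: t_def J_def)
qed

lemma Q_mono: assumes "\<nu> \<le> r" "r \<le> s" shows "Q r \<le> Q s"
proof (rule mono_from_DERIV[OF assms(2) DERIV_Q])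
  fix x assume x: "r \<le> x" "x \<le> s"
  define y where "y = \<beta> * (T x)\<^sup>2"
  have y0: "y \<ge> 0" using beta_pos by (simp add: y_def)
  have "4 * y = (m - 4) * ((T x)\<^sup>2 * (4 * m\<^sup>2))" by (simp add: y_def beta_alt algebra_simps)
  also have "\<dots> \<le> (m - 4) * 1" using T_props(3)[of x] assms x m by (intro mult_left_mono) auto
  finally have y1: "4 * y \<le> m" by simp
  have "(4 * y)\<^sup>2 \<le> m\<^sup>2" using y1 y0 by (intro power_mono) auto
  then have y2: "16 * y\<^sup>2 \<le> m\<^sup>2" by (simp add: power_mult_distrib)
  have "9 * m \<le> m\<^sup>2" "81 \<le> m\<^sup>2" using m power_mono[of 9 m 2] by (auto simp: power2_eq_square)
  then have "1 + 12 * y + 15 * y\<^sup>2 \<le> 16 * m\<^sup>2" using y1 y2 y0 by linarith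
  then have "0 \<le> x * T x ^ 3 * (8 * m\<^sup>2 - (1 + 12 * y + 15 * y\<^sup>2) / 2)"
    using T_props(1)[of x] assms x nu by (intro mult_nonneg_nonneg) auto
  then show "0 \<le> x * T x ^ 3 * (8 * m\<^sup>2 - (1 + 12 * (\<beta> * (T x)\<^sup>2) + 15 * (\<beta> * (T x)\<^sup>2)\<^sup>2) / 2) * (bessel_J \<nu> x)\<^sup>2"
    by (simp add: y_def)
qed (use assms in auto)

lemma Q_le_energy: assumes "r \<ge> 2 * \<nu>" "r \<ge> 4"
  shows "Q r \<le> 3 * (r * (bessel_J \<nu> r)\<^sup>2 + (bessel_Z \<nu> r)\<^sup>2 / r)"
proof -
  have r: "r \<ge> \<nu>" "r > 0" using assms nu by auto
  define t where "t = T r"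
  define J where "J = bessel_J \<nu> r"
  define Z where "Z = bessel_Z \<nu> r"
  define W where "W = r * J\<^sup>2 + Z\<^sup>2 / r"
  have t0: "t > 0" using T_props(1)[OF r(1)] by (simp add: t_def)
  have nr: "4 * \<nu>\<^sup>2 \<le> r\<^sup>2" using power_mono[of "2 * \<nu>" r 2] assms nu by (simp add: power_mult_distrib)
  have b: "\<beta> \<le> \<nu>\<^sup>2" by (simp add: \<beta>_def nu_m)
  have "t\<^sup>2 * (3 * r\<^sup>2) \<le> t\<^sup>2 * (4 * (r\<^sup>2 - \<beta>))" using nr b by (intro mult_left_mono) auto
  also have "\<dots> = 4 * (t\<^sup>2 * (r\<^sup>2 - \<beta>))" by (simp add: algebra_simps)
  also have "\<dots> = 4" using T_props(2)[OF r(1)] by (simp add: t_def)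
  finally have rt2: "(r * t)\<^sup>2 \<le> 4/3" by (simp add: power_mult_distrib mult_ac)
  then have "(r * t)\<^sup>2 \<le> 2\<^sup>2" by simp
  then have rt: "r * t \<le> 2" by (rule power2_le_imp_le) simp
  have bt: "\<beta> * t\<^sup>2 \<le> 1/3"
  proof -
    have "\<beta> * t\<^sup>2 \<le> (r\<^sup>2 / 4) * t\<^sup>2" using nr b by (intro mult_right_mono) auto
    then show ?thesis using rt2 by (simp add: power_mult_distrib)
  qed
  have rt3: "r * (r\<^sup>2 * t^3) \<le> 8/3"
  proof -
    have "r * (r\<^sup>2 * t^3) = (r * t)\<^sup>2 * (r * t)" by (simp add: power2_eq_square power3_eq_cube algebra_simps)
    also have "\<dots> \<le> 4/3 * 2" using rt2 rt r t0 by (intro mult_mono) auto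
    finally show ?thesis by simp
  qed
  have r23: "r\<^sup>2 * t^3 \<le> 2/3"
  proof -
    have "4 * (r\<^sup>2 * t^3) \<le> r * (r\<^sup>2 * t^3)" using assms(2) t0 by (intro mult_right_mono) auto
    then show ?thesis using rt3 by simp
  qed
  have W0: "Z\<^sup>2 / r \<le> W" "r * J\<^sup>2 \<le> W" "J\<^sup>2 \<le> W / 4" "0 \<le> W"
  proof -
    show "Z\<^sup>2 / r \<le> W" "r * J\<^sup>2 \<le> W" "0 \<le> W" using r by (auto simp: W_def)
    have "4 * J\<^sup>2 \<le> r * J\<^sup>2" using assms(2) by (intro mult_right_mono) auto
    then show "J\<^sup>2 \<le> W / 4" using r by (simp add: W_def) (smt (verit) divide_nonneg_pos zero_le_power2)
  qed
  have JZ: "J * Z \<le> W / 2"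
  proof -
    have "0 \<le> (r * J - Z)\<^sup>2 / r" using r by auto
    also have "\<dots> = W - 2 * (J * Z)"
      using r by (simp add: W_def field_simps power2_eq_square)
    finally show ?thesis by simp
  qed
  have "Q r = (r * t) * (Z\<^sup>2 / r) + r\<^sup>2 * t^3 * (J * Z) + t * (r\<^sup>2 - \<nu>\<^sup>2) * J\<^sup>2 + r\<^sup>2 * t^3 * ((1 + 3 * (\<beta> * t\<^sup>2)) / 2 * J\<^sup>2)"
    using r by (simp add: Q_def t_def J_def Z_def algebra_simps)
  also have "\<dots> \<le> (r * t) * (Z\<^sup>2 / r) + 2/3 * (W / 2) + (r * t) * (r * J\<^sup>2) + 2/3 * (1 * (W / 4))"
  proof (intro add_mono order_refl)
    have "r\<^sup>2 * t^3 * (J * Z) \<le> r\<^sup>2 * t^3 * (W / 2)" using JZ t0 by (intro mult_left_mono) auto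
    also have "\<dots> \<le> 2/3 * (W / 2)" using r23 W0 by (intro mult_right_mono) auto
    finally show "r\<^sup>2 * t^3 * (J * Z) \<le> 2/3 * (W / 2)" .
    have "t * (r\<^sup>2 - \<nu>\<^sup>2) * J\<^sup>2 \<le> t * r\<^sup>2 * J\<^sup>2" using t0 by (intro mult_right_mono mult_left_mono) auto
    then show "t * (r\<^sup>2 - \<nu>\<^sup>2) * J\<^sup>2 \<le> (r * t) * (r * J\<^sup>2)" by (simp add: power2_eq_square algebra_simps)
    show "r\<^sup>2 * t^3 * ((1 + 3 * (\<beta> * t\<^sup>2)) / 2 * J\<^sup>2) \<le> 2/3 * (1 * (W / 4))"
      using r23 bt W0 t0 beta_pos by (intro mult_mono) auto
  qed
  also have "(r * t) * (Z\<^sup>2 / r) + 2/3 * (W / 2) + (r * t) * (r * J\<^sup>2) + 2/3 * (1 * (W / 4)) = (r * t) * W + W / 2"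
    by (simp add: W_def algebra_simps)
  also have "\<dots> \<le> 2 * W + W" using rt W0 by (intro add_mono mult_right_mono) auto
  finally have "Q r \<le> 3 * W" by simp
  then show ?thesis by (simp only: W_def J_def Z_def)
qed

lemma Q_bounded: assumes "\<forall>\<^sub>F x in at_top. bessel_energy \<nu> x \<le> K" "\<nu> \<le> r"
  shows "Q r \<le> 3 * K"
proof -
  have "\<forall>\<^sub>F x in at_top. bessel_energy \<nu> x \<le> K \<and> x \<ge> 2 * \<nu> \<and> x \<ge> 4 \<and> x \<ge> r"
    by (intro eventually_conj assms eventually_ge_at_top)
  then obtain x where "bessel_energy \<nu> x \<le> K" "x \<ge> 2 * \<nu>" "x \<ge> 4" "x \<ge> r"
    by (auto simp: eventually_at_top_linorder)
  then show ?thesis using Q_mono[of r x] Q_le_energy[of x] assms(2) by auto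
qed

text \<open>
  Completing the square in \<open>Z\<close> bounds \<open>Q\<close> below by \<open>T (p + (1 + y) (1 + 5 y) / 4) J^2\<close> with \<open>y = \<beta> T^2\<close> and
  \<open>p = r^2 - \<nu>^2\<close>. Where \<open>p\<close> is small compared to \<open>m^2\<close>, \<open>y\<close> is of size \<open>m\<close> and the second term takes
  over, so the bound does not degenerate at the turning point.
\<close>

lemma bessel_above: assumes K: "\<And>r. \<nu> \<le> r \<Longrightarrow> Q r \<le> K" and r: "\<nu> \<le> r"
  shows "(bessel_J \<nu> r)\<^sup>2 * sqrt (r\<^sup>2 - \<nu>\<^sup>2 + m\<^sup>2) \<le> 130 * K"
proof -
  define t where "t = T r"
  define J where "J = bessel_J \<nu> r"
  define Z where "Z = bessel_Z \<nu> r"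
  define y where "y = \<beta> * t\<^sup>2"
  define p where "p = r\<^sup>2 - \<nu>\<^sup>2"
  note T = T_props[OF r, folded t_def]
  have p0: "p \<ge> 0" using power_mono[of \<nu> r 2] nu r by (simp add: p_def)
  have y0: "y \<ge> 0" using beta_pos by (simp add: y_def)
  have P: "r\<^sup>2 - \<beta> = p + 4 * m\<^sup>2" by (simp add: p_def \<beta>_def nu_m)
  have q: "p + (1 + y) * (1 + 5 * y) / 4 \<ge> (p + m\<^sup>2) / 65"
  proof (cases "p \<ge> m\<^sup>2")
    case True
    then have "(p + m\<^sup>2) / 65 \<le> p" using p0 by simp
    then show ?thesis using y0 by (smt (verit) divide_nonneg_nonneg mult_nonneg_nonneg)
  next
    case False
    have "m\<^sup>2 * (m - 4) = y * (r\<^sup>2 - \<beta>)" using T(2) by (simp add: y_def beta_alt[symmetric] mult_ac)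
    also have "\<dots> \<le> y * (5 * m\<^sup>2)" using False P y0 by (intro mult_left_mono) auto
    finally have "m\<^sup>2 * (m - 4) \<le> m\<^sup>2 * (5 * y)" by (simp add: mult_ac)
    then have "m - 4 \<le> 5 * y" using m by simp
    then have "m / 9 \<le> y" using m by simp
    then have "(m / 9)\<^sup>2 \<le> y\<^sup>2" using m by (intro power_mono) auto
    then have "5 * m\<^sup>2 / 324 \<le> 5 * y\<^sup>2 / 4" by (simp add: power_divide)
    also have "\<dots> \<le> (1 + y) * (1 + 5 * y) / 4" using y0 by (simp add: power2_eq_square algebra_simps)
    finally have "5 * m\<^sup>2 / 324 \<le> (1 + y) * (1 + 5 * y) / 4" .
    moreover have "(p + m\<^sup>2) / 65 \<le> p + 5 * m\<^sup>2 / 324" using p0 zero_le_power2[of m] by (simp add: field_simps)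
    ultimately show ?thesis by (rule order_trans[OF _ add_left_mono, rotated])
  qed
  have "Q r = t * Z\<^sup>2 + t * (r\<^sup>2 * t\<^sup>2) * J * Z + (t * p + t * (r\<^sup>2 * t\<^sup>2) * (1 + 3 * y) / 2) * J\<^sup>2"
    by (simp add: Q_def t_def J_def Z_def p_def y_def power2_eq_square power3_eq_cube algebra_simps)
  also have "\<dots> = t * (Z + (1 + y) * J / 2)\<^sup>2 + t * (p + (1 + y) * (1 + 5 * y) / 4) * J\<^sup>2"
    unfolding T(4) y_def[symmetric] by (simp add: power2_eq_square field_simps)
  finally have "t * (p + (1 + y) * (1 + 5 * y) / 4) * J\<^sup>2 \<le> Q r" using T(1) by simp
  moreover have "t * ((p + m\<^sup>2) / 65) * J\<^sup>2 \<le> t * (p + (1 + y) * (1 + 5 * y) / 4) * J\<^sup>2"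
    using q T(1) by (intro mult_right_mono mult_left_mono) auto
  moreover have "t * (p + m\<^sup>2) * J\<^sup>2 = 65 * (t * ((p + m\<^sup>2) / 65) * J\<^sup>2)" by simp
  ultimately have "t * (p + m\<^sup>2) * J\<^sup>2 \<le> 65 * K" using K[OF r] by linarith
  moreover have "sqrt (p + m\<^sup>2) \<le> 2 * (t * (p + m\<^sup>2))"
  proof -
    define s where "s = sqrt (p + m\<^sup>2)"
    have s0: "s \<ge> 0" "s\<^sup>2 = p + m\<^sup>2" using p0 by (auto simp: s_def)
    have "1 \<le> (2 * (t * s))\<^sup>2"
    proof -
      have "t\<^sup>2 * (r\<^sup>2 - \<beta>) \<le> t\<^sup>2 * (4 * s\<^sup>2)" using P s0 p0 by (intro mult_left_mono) auto
      then show ?thesis using T(2) by (simp add: power_mult_distrib mult_ac)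
    qed
    then have "1\<^sup>2 \<le> (2 * (t * s))\<^sup>2" by simp
    then have "1 \<le> 2 * (t * s)" by (rule power2_le_imp_le) (use T s0 in auto)
    then have "s * 1 \<le> s * (2 * (t * s))" using s0 by (intro mult_left_mono) auto
    also have "s * (2 * (t * s)) = 2 * (t * s\<^sup>2)" by (simp add: power2_eq_square)
    also have "\<dots> = 2 * (t * (p + m\<^sup>2))" by (simp only: s0)
    finally show ?thesis by (simp add: s_def)
  qed
  ultimately have "J\<^sup>2 * sqrt (p + m\<^sup>2) \<le> J\<^sup>2 * (2 * (t * (p + m\<^sup>2)))" "t * (p + m\<^sup>2) * J\<^sup>2 \<le> 65 * K"
    by (auto intro!: mult_left_mono)
  moreover have "J\<^sup>2 * (2 * (t * (p + m\<^sup>2))) = 2 * (t * (p + m\<^sup>2) * J\<^sup>2)" by simp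
  ultimately have "J\<^sup>2 * sqrt (p + m\<^sup>2) \<le> 130 * K" by linarith
  then show ?thesis by (simp add: J_def p_def)
qed

lemma bessel_Z_at_order: assumes K: "Q \<nu> \<le> K" shows "(bessel_Z \<nu> \<nu>)\<^sup>2 \<le> 4 * m * K"
proof -
  define t where "t = T \<nu>"
  define J where "J = bessel_J \<nu> \<nu>"
  define Z where "Z = bessel_Z \<nu> \<nu>"
  define y where "y = \<beta> * t\<^sup>2"
  note T = T_props[of \<nu>, folded t_def, OF order_refl]
  have y0: "y \<ge> 0" using beta_pos by (simp add: y_def)
  have t: "t * (2 * m) = 1"
  proof -
    have "\<nu>\<^sup>2 - \<beta> = (2 * m)\<^sup>2" by (simp add: \<beta>_def nu_m power_mult_distrib)
    then have "sqrt (\<nu>\<^sup>2 - \<beta>) = 2 * m" using m by (simp add: real_sqrt_unique)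
    then show ?thesis using m by (simp add: t_def T_def)
  qed
  have "Q \<nu> = t * Z\<^sup>2 + t * (\<nu>\<^sup>2 * t\<^sup>2) * J * Z + (t * (\<nu>\<^sup>2 * t\<^sup>2) * (1 + 3 * y) / 2) * J\<^sup>2"
    by (simp add: Q_def t_def J_def Z_def y_def power2_eq_square power3_eq_cube algebra_simps)
  also have "\<dots> = t * (Z\<^sup>2 / 2 + (Z + (1 + y) * J)\<^sup>2 / 2 + (1 + y) * y * J\<^sup>2)"
    unfolding T(4) y_def[symmetric] by (simp add: power2_eq_square field_simps)
  finally have "Q \<nu> * (2 * m) = (t * (2 * m)) * (Z\<^sup>2 / 2 + (Z + (1 + y) * J)\<^sup>2 / 2 + (1 + y) * y * J\<^sup>2)" by simp
  then have "Q \<nu> * (2 * m) = Z\<^sup>2 / 2 + (Z + (1 + y) * J)\<^sup>2 / 2 + (1 + y) * y * J\<^sup>2" using t by simp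
  then have "Z\<^sup>2 / 2 \<le> Q \<nu> * (2 * m)" using y0 by simp
  also have "\<dots> \<le> K * (2 * m)" using K m by (intro mult_right_mono) auto
  finally show ?thesis by (simp add: Z_def mult_ac)
qed

text \<open>
  Below the turning point \<open>J^2\<close> and \<open>Z^2\<close> increase, so their values at \<open>r = \<nu>\<close>, of sizes \<open>1/m\<close> and \<open>m\<close>, bound
  them; combined with \<open>(\<nu>^2 - r^2) J^2 \<le> Z^2\<close> this continues the bound to all \<open>r\<close>.
\<close>

lemma bessel_uniform: assumes K: "\<And>r. \<nu> \<le> r \<Longrightarrow> Q r \<le> K" and r: "0 < r"
  shows "bessel_J \<nu> r ^ 4 * (\<bar>r\<^sup>2 - \<nu>\<^sup>2\<bar> + m\<^sup>2) \<le> (130 * K)\<^sup>2 + 520 * K\<^sup>2"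
proof (cases "\<nu> \<le> r")
  case True
  have p0: "r\<^sup>2 - \<nu>\<^sup>2 \<ge> 0" using power_mono[of \<nu> r 2] nu True by simp
  have "((bessel_J \<nu> r)\<^sup>2 * sqrt (r\<^sup>2 - \<nu>\<^sup>2 + m\<^sup>2))\<^sup>2 \<le> (130 * K)\<^sup>2"
    using bessel_above[OF K True] p0 by (intro power_mono) auto
  then have "bessel_J \<nu> r ^ 4 * (r\<^sup>2 - \<nu>\<^sup>2 + m\<^sup>2) \<le> (130 * K)\<^sup>2"
    using p0 by (simp add: power_mult_distrib)
  then show ?thesis using p0 by (smt (verit) abs_of_nonneg zero_le_power2)
next
  case False
  have p0: "r\<^sup>2 \<le> \<nu>\<^sup>2" using power_mono[of r \<nu> 2] r False by simp
  have J0: "(bessel_J \<nu> \<nu>)\<^sup>2 * m \<le> 130 * K" using bessel_above[OF K order_refl] m by simp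
  have J1: "(bessel_J \<nu> r)\<^sup>2 \<le> (bessel_J \<nu> \<nu>)\<^sup>2" using bessel_below_mono(1)[of \<nu> r \<nu>] nu r False by simp
  have J1m: "(bessel_J \<nu> r)\<^sup>2 * m \<le> 130 * K"
    using mult_right_mono[OF J1, of m] J0 m by linarith
  have Z: "(\<nu>\<^sup>2 - r\<^sup>2) * (bessel_J \<nu> r)\<^sup>2 \<le> 4 * m * K"
    using bessel_below_turning_point(1)[of \<nu> r] bessel_below_mono(2)[of \<nu> r \<nu>] bessel_Z_at_order[OF K[OF order_refl]]
      nu r False by simp
  have K0: "K \<ge> 0" using J0 m by (smt (verit) mult_nonneg_nonneg zero_le_power2)
  have "((bessel_J \<nu> r)\<^sup>2 * m) * ((\<nu>\<^sup>2 - r\<^sup>2) * (bessel_J \<nu> r)\<^sup>2) \<le> 130 * K * (4 * m * K)"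
    by (rule mult_mono[OF J1m Z]) (use p0 K0 in auto)
  then have "m * (bessel_J \<nu> r ^ 4 * (\<nu>\<^sup>2 - r\<^sup>2)) \<le> m * (520 * K\<^sup>2)"
    by (simp add: power2_eq_square power_numeral_reduce mult_ac)
  then have 1: "bessel_J \<nu> r ^ 4 * (\<nu>\<^sup>2 - r\<^sup>2) \<le> 520 * K\<^sup>2" using m by simp
  have "((bessel_J \<nu> r)\<^sup>2 * m)\<^sup>2 \<le> (130 * K)\<^sup>2" using J1m m by (intro power_mono) auto
  then have 2: "bessel_J \<nu> r ^ 4 * m\<^sup>2 \<le> (130 * K)\<^sup>2" by (simp add: power_mult_distrib)
  have "\<bar>r\<^sup>2 - \<nu>\<^sup>2\<bar> = \<nu>\<^sup>2 - r\<^sup>2" using p0 by simp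
  then show ?thesis using 1 2 by (simp only: distrib_left)
qed

end

lemma bessel_J_uniform:
  "\<exists>C>0. \<forall>\<nu>\<ge>27. \<forall>r>0. bessel_J \<nu> r ^ 4 * (\<bar>r\<^sup>2 - \<nu>\<^sup>2\<bar> + \<nu> powr (4/3)) \<le> C"
proof -
  obtain K where K: "K > 0" "\<And>\<nu>. \<nu> \<ge> 0 \<Longrightarrow> \<forall>\<^sub>F x in at_top. bessel_energy \<nu> x \<le> K"
    using bessel_energy_at_top by blast
  have "bessel_J \<nu> r ^ 4 * (\<bar>r\<^sup>2 - \<nu>\<^sup>2\<bar> + \<nu> powr (4/3)) \<le> (130 * (3 * K))\<^sup>2 + 520 * (3 * K)\<^sup>2"
    if nu: "\<nu> \<ge> 27" and r: "r > 0" for \<nu> r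
  proof -
    \<comment> \<open>Orders from \<open>27 = 9^(3/2)\<close> on give \<open>m \<ge> 9\<close>, so that \<open>\<beta> = m^2 (m - 4)\<close> is comparable to \<open>\<nu>^2\<close>.\<close>
    define m where "m = \<nu> powr (2/3)"
    have m3: "m ^ 3 = \<nu>\<^sup>2" "m\<^sup>2 = \<nu> powr (4/3)"
      using nu by (simp_all add: m_def powr_power)
    have "27 powr (2/3) \<le> m" unfolding m_def using nu by (intro powr_mono2) auto
    moreover have "(27::real) powr (2/3) = 9"
    proof -
      have "(27::real) = 3 powr 3" by simp
      then have "(27::real) powr (2/3) = 3 powr (3 * (2/3))" by (simp only: powr_powr)
      then show ?thesis by simp
    qed
    ultimately have m: "m \<ge> 9" by simp
    interpret bessel_large_order \<nu> m using m nu m3 by unfold_locales auto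
    show ?thesis using bessel_uniform[OF Q_bounded[OF K(2)] r] nu by (simp add: m3)
  qed
  moreover have "(130 * (3 * K))\<^sup>2 + 520 * (3 * K)\<^sup>2 > 0" using K(1) by (intro add_pos_pos) auto
  ultimately show ?thesis by blast
qed

section \<open>Weighted moments of Bessel functions\<close>

abbreviation weighted_moment :: "real \<Rightarrow> real \<Rightarrow> (real \<Rightarrow> real) \<Rightarrow> ennreal" where
  "weighted_moment \<alpha> q J \<equiv> \<integral>\<^sup>+r. ennreal (r powr \<alpha> * \<bar>J r\<bar> powr q) * indicator {0<..} r \<partial>lborel"

lemma nn_integral_powr_0:
  assumes "a > (-1::real)" "c \<ge> 0"
  shows "(\<integral>\<^sup>+x. ennreal (x powr a) * indicator {0..c} x \<partial>lborel) = ennreal (c powr (a+1) / (a+1))"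
  by (rule nn_integral_has_integral_lebesgue'[OF _ has_integral_powr_from_0[OF assms]]) auto

lemma nn_integral_powr_inf:
  assumes "e < (-1::real)" "a > 0"
  shows "(\<integral>\<^sup>+x. ennreal (x powr e) * indicator {a..} x \<partial>lborel) = ennreal (-(a powr (e+1)) / (e+1))"
  by (rule nn_integral_has_integral_lebesgue'[OF _ has_integral_powr_to_inf[OF assms]]) auto

lemma nn_integral_abs_powr:
  assumes "a > (-1::real)" "c \<ge> 0"
  shows "(\<integral>\<^sup>+x. ennreal (\<bar>x - b\<bar> powr a) * indicator {b-c..b+c} x \<partial>lborel) \<le> ennreal (2 * c powr (a+1) / (a+1))"
proof -
  have "(\<integral>\<^sup>+x. ennreal (\<bar>x - b\<bar> powr a) * indicator {b-c..b+c} x \<partial>lborel)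
     = (\<integral>\<^sup>+x. ennreal (\<bar>x\<bar> powr a) * indicator {-c..c} x \<partial>lborel)"
    by (subst nn_integral_real_affine[where c=1 and t=b])
       (auto intro!: nn_integral_cong split: split_indicator)
  also have "\<dots> \<le> (\<integral>\<^sup>+x. ennreal (x powr a) * indicator {0..c} x + ennreal ((-x) powr a) * indicator {0..c} (-x) \<partial>lborel)"
    by (intro nn_integral_mono) (auto split: split_indicator simp: abs_if)
  also have "\<dots> = (\<integral>\<^sup>+x. ennreal (x powr a) * indicator {0..c} x \<partial>lborel) +
       (\<integral>\<^sup>+x. ennreal ((-x) powr a) * indicator {0..c} (-x) \<partial>lborel)"
    by (intro nn_integral_add) auto
  also have "(\<integral>\<^sup>+x. ennreal ((-x) powr a) * indicator {0..c} (-x) \<partial>lborel) = (\<integral>\<^sup>+x. ennreal (x powr a) * indicator {0..c} x \<partial>lborel)"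
    by (subst (2) nn_integral_real_affine[where c="-1" and t=0]) auto
  finally show ?thesis unfolding nn_integral_powr_0[OF assms] using assms
    by (simp flip: ennreal_plus)
qed

lemma borel_measurable_bessel_J [measurable]: "bessel_J \<nu> \<in> borel_measurable borel"
  unfolding bessel_J_def[abs_def] by measurable

lemma bessel_J_bounded_order:
  assumes "\<nu>0 > 0"
  shows "\<exists>A>0. \<forall>\<nu>\<in>{\<nu>0..N}. \<forall>r>0. (r \<le> 1 \<longrightarrow> \<bar>bessel_J \<nu> r\<bar> \<le> A * r powr \<nu>0) \<and> (r \<ge> 1 \<longrightarrow> \<bar>bessel_J \<nu> r\<bar> \<le> A * r powr (-1/2))"
proof -
  obtain c where c: "c > 0" "\<And>\<nu> x. \<nu> \<ge> 0 \<Longrightarrow> x > 0 \<Longrightarrow> \<bar>bessel_J \<nu> x\<bar> \<le> c * (x/2) powr \<nu> * exp (x\<^sup>2/4)"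
    using bessel_J_small by blast
  obtain K where K: "K > 0" "\<And>\<nu> x. \<nu> \<in> {0..N} \<Longrightarrow> x \<ge> 1 \<Longrightarrow> bessel_energy \<nu> x \<le> K"
    using bessel_bounded_order[of N] by blast
  define A where "A = max (c * exp (1/4)) (sqrt K)"
  have "\<bar>bessel_J \<nu> r\<bar> \<le> A * r powr \<nu>0" if "\<nu> \<in> {\<nu>0..N}" "r > 0" "r \<le> 1" for \<nu> r
  proof -
    have "(r/2) powr \<nu> \<le> r powr \<nu>" using that assms by (intro powr_mono2) auto
    also have "\<dots> \<le> r powr \<nu>0" using that assms by (intro powr_mono') auto
    finally have 1: "(r/2) powr \<nu> \<le> r powr \<nu>0" .
    have 2: "exp (r\<^sup>2/4) \<le> exp (1/4)" using that by (simp add: power_le_one)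
    have "\<bar>bessel_J \<nu> r\<bar> \<le> c * (r/2) powr \<nu> * exp (r\<^sup>2/4)" using c(2)[of \<nu> r] that assms by auto
    also have "\<dots> \<le> c * r powr \<nu>0 * exp (1/4)"
      using 1 2 c(1) by (intro mult_mono mult_left_mono) auto
    also have "\<dots> = (c * exp (1/4)) * r powr \<nu>0" by simp
    also have "\<dots> \<le> A * r powr \<nu>0" by (intro mult_right_mono) (auto simp: A_def)
    finally show ?thesis .
  qed
  moreover have "\<bar>bessel_J \<nu> r\<bar> \<le> A * r powr (-1/2)" if "\<nu> \<in> {\<nu>0..N}" "r \<ge> 1" for \<nu> r
  proof -
    have "r * (bessel_J \<nu> r)\<^sup>2 \<le> r * (bessel_J \<nu> r)\<^sup>2 + (bessel_Z \<nu> r)\<^sup>2 / r" using that by auto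
    also have "\<dots> \<le> K" using K(2)[of \<nu> r] that assms by auto
    finally have "(bessel_J \<nu> r)\<^sup>2 \<le> K / r" using that by (simp add: field_simps)
    then have "\<bar>bessel_J \<nu> r\<bar> \<le> sqrt (K / r)" by (intro real_le_rsqrt) simp
    also have "\<dots> = sqrt K * r powr (-1/2)" using that K(1)
      by (simp add: real_sqrt_divide powr_minus_divide powr_half_sqrt)
    also have "\<dots> \<le> A * r powr (-1/2)" by (intro mult_right_mono) (auto simp: A_def)
    finally show ?thesis .
  qed
  moreover have "A > 0" using c(1) by (auto simp: A_def less_max_iff_disj)
  ultimately show ?thesis by (intro exI[of _ A]) auto
qed

lemma powr_le_of_pow4:
  fixes j X :: real
  assumes "j ^ 4 * X \<le> C" "X > 0" "q \<ge> 0"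
  shows "\<bar>j\<bar> powr q \<le> C powr (q/4) * X powr (-(q/4))"
proof -
  have "0 \<le> j ^ 4 * X" using assms(2) by simp
  then have "C \<ge> 0" using assms(1) by linarith
  have "\<bar>j\<bar> powr q = (\<bar>j\<bar> powr 4) powr (q/4)" unfolding powr_powr by simp
  also have "\<bar>j\<bar> powr 4 = j ^ 4" by simp
  also have "(j^4) powr (q/4) \<le> (C / X) powr (q/4)"
  proof (intro powr_mono2)
    show "j ^ 4 \<le> C / X" using assms(1,2) by (simp add: pos_le_divide_eq)
  qed (use assms(3) in auto)
  also have "\<dots> = C powr (q/4) * X powr (-(q/4))"
    by (simp add: powr_divide powr_minus_divide assms less_imp_le[OF assms(2)] \<open>C \<ge> 0\<close>)
  finally show ?thesis .
qed

text \<open>For bounded orders the powers \<open>r^\<nu>0\<close> at 0 and \<open>r^(-1/2)\<close> at infinity bound the function uniformly.\<close>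

lemma bessel_integral_bounded_order:
  fixes \<alpha> q \<nu>0 :: real
  assumes "\<nu>0 > 0" "q > 0" "\<alpha> + 1 + \<nu>0 * q > 0" "\<alpha> + 1 - q/2 < 0"
  shows "\<exists>K>0. \<forall>\<nu>\<in>{\<nu>0..N}. weighted_moment \<alpha> q (bessel_J \<nu>) \<le> ennreal K"
proof -
  obtain A where A: "A > 0" "\<And>\<nu> r. \<nu> \<in> {\<nu>0..N} \<Longrightarrow> r > 0 \<Longrightarrow> r \<le> 1 \<Longrightarrow> \<bar>bessel_J \<nu> r\<bar> \<le> A * r powr \<nu>0"
      "\<And>\<nu> r. \<nu> \<in> {\<nu>0..N} \<Longrightarrow> r > 0 \<Longrightarrow> r \<ge> 1 \<Longrightarrow> \<bar>bessel_J \<nu> r\<bar> \<le> A * r powr (-1/2)"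
    using bessel_J_bounded_order[OF assms(1), of N] by blast
  define K where "K = A powr q * (1 / (\<alpha> + 1 + \<nu>0 * q) + 1 / (q/2 - \<alpha> - 1))"
  have "weighted_moment \<alpha> q (bessel_J \<nu>) \<le> ennreal K" if "\<nu> \<in> {\<nu>0..N}" for \<nu>
  proof -
    have "weighted_moment \<alpha> q (bessel_J \<nu>)
      \<le> (\<integral>\<^sup>+r. ennreal (A powr q) * (ennreal (r powr (\<alpha> + \<nu>0 * q)) * indicator {0..1} r + ennreal (r powr (\<alpha> - q/2)) * indicator {1..} r) \<partial>lborel)"
    proof (intro nn_integral_mono)
      fix r :: real
      show "ennreal (r powr \<alpha> * \<bar>bessel_J \<nu> r\<bar> powr q) * indicator {0<..} r \<le>
         ennreal (A powr q) * (ennreal (r powr (\<alpha> + \<nu>0 * q)) * indicator {0..1} r + ennreal (r powr (\<alpha> - q/2)) * indicator {1..} r)"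
      proof (cases "r > 0")
        case r: True
        show ?thesis
        proof (cases "r \<le> 1")
          case True
          have "\<bar>bessel_J \<nu> r\<bar> powr q \<le> (A * r powr \<nu>0) powr q"
            using A(2)[OF that r True] assms by (intro powr_mono2) auto
          then have "r powr \<alpha> * \<bar>bessel_J \<nu> r\<bar> powr q \<le> r powr \<alpha> * (A * r powr \<nu>0) powr q" by (intro mult_left_mono) auto
          also have "\<dots> = A powr q * r powr (\<alpha> + \<nu>0 * q)"
            using A(1) by (simp add: powr_mult powr_powr powr_add)
          finally have "ennreal (r powr \<alpha> * \<bar>bessel_J \<nu> r\<bar> powr q) \<le> ennreal (A powr q) * ennreal (r powr (\<alpha> + \<nu>0 * q))"
            by (simp add: ennreal_mult[symmetric])
          also have "\<dots> \<le> ennreal (A powr q) * (ennreal (r powr (\<alpha> + \<nu>0 * q)) * indicator {0..1} r + ennreal (r powr (\<alpha> - q/2)) * indicator {1..} r)"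
            using r True by (intro mult_left_mono) auto
          finally show ?thesis using r by simp
        next
          case False
          have "\<bar>bessel_J \<nu> r\<bar> powr q \<le> (A * r powr (-1/2)) powr q"
            using A(3)[OF that r] False assms by (intro powr_mono2) auto
          then have "r powr \<alpha> * \<bar>bessel_J \<nu> r\<bar> powr q \<le> r powr \<alpha> * (A * r powr (-1/2)) powr q" by (intro mult_left_mono) auto
          also have "\<dots> = A powr q * (r powr \<alpha> * r powr (-1/2 * q))"
            using A(1) by (simp add: powr_mult powr_powr)
          also have "r powr \<alpha> * r powr (-1/2 * q) = r powr (\<alpha> - q/2)" by (simp add: powr_add[symmetric])
          finally have "ennreal (r powr \<alpha> * \<bar>bessel_J \<nu> r\<bar> powr q) \<le> ennreal (A powr q) * ennreal (r powr (\<alpha> - q/2))"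
            by (simp add: ennreal_mult[symmetric])
          then show ?thesis using r False by simp
        qed
      qed auto
    qed
    also have "\<dots> = ennreal (A powr q) * ((\<integral>\<^sup>+r. ennreal (r powr (\<alpha> + \<nu>0 * q)) * indicator {0..1} r \<partial>lborel) + (\<integral>\<^sup>+r. ennreal (r powr (\<alpha> - q/2)) * indicator {1..} r \<partial>lborel))"
      by (subst nn_integral_cmult) (auto simp: nn_integral_add)
    also have "\<dots> = ennreal (A powr q) * (ennreal (1 / (\<alpha> + 1 + \<nu>0 * q)) + ennreal (1 / (q/2 - \<alpha> - 1)))"
    proof -
      have e: "- (1::real) / (\<alpha> - q/2 + 1) = 1 / (q/2 - \<alpha> - 1)"
      proof -
        have "\<alpha> - q/2 + 1 = - (q/2 - \<alpha> - 1)" by simp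
        then show ?thesis by (simp only: minus_divide_divide)
      qed
      show ?thesis using nn_integral_powr_0[of "\<alpha> + \<nu>0 * q" 1] nn_integral_powr_inf[of "\<alpha> - q/2" 1] assms e
        by (simp add: algebra_simps)
    qed
    also have "\<dots> = ennreal K"
      using assms by (simp add: K_def ennreal_plus[symmetric] ennreal_mult[symmetric] del: ennreal_plus)
    finally show ?thesis .
  qed
  moreover have "K > 0" unfolding K_def using assms A(1) by (intro mult_pos_pos add_pos_pos) auto
  ultimately show ?thesis by blast
qed

text \<open>
  Up to \<open>\<nu>/2\<close> the function decays like a power \<open>(2r/\<nu>)^(\<nu>/2)\<close>, beyond \<open>2\<nu>\<close> it is at most \<open>C r^(-1/2)\<close>. In between,
  \<open>bessel_J_uniform\<close> gives \<open>|J|^q \<le> C (\<nu> |r - \<nu>| + \<nu>^(4/3))^(-q/4)\<close>. Of the exponent \<open>q/4\<close> a part \<open>s/4 < 1\<close> is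
  spent on the locally integrable factor \<open>|r - \<nu>|^(-s/4)\<close> and the rest on the power of \<open>\<nu>\<close>; the resulting power
  of \<open>\<nu>\<close> is \<open>\<alpha> + 1 - q/3 - s/6\<close>, and \<open>s\<close> is the smallest choice that makes it nonpositive.
\<close>

lemma bessel_integral_large_order:
  fixes \<alpha> q \<nu>0 :: real
  assumes "\<nu>0 > 0" "q > 0" "\<alpha> + 1 + \<nu>0 * q > 0" "\<alpha> + 1 - q/2 < 0" "\<alpha> + 1/3 - q/3 < 0"
  shows "\<exists>K>0. \<forall>\<nu>\<ge>max 27 (2 * \<nu>0). weighted_moment \<alpha> q (bessel_J \<nu>) \<le> ennreal K"
proof -
  obtain C where C: "C > 0" "\<And>\<nu> r. \<nu> \<ge> 27 \<Longrightarrow> r > 0 \<Longrightarrow> bessel_J \<nu> r ^ 4 * (\<bar>r\<^sup>2 - \<nu>\<^sup>2\<bar> + \<nu> powr (4/3)) \<le> C"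
    using bessel_J_uniform by blast
  \<comment> \<open>The last two hypotheses say that this \<open>s\<close> is less than \<open>q\<close> and less than 4.\<close>
  define s where "s = max 0 (6 * (\<alpha> + 1) - 2 * q)"
  have s: "0 \<le> s" "s < 4" "s \<le> q" "\<alpha> + 1 - q/3 - s/6 \<le> 0" using assms by (auto simp: s_def)
  define D where "D = C powr (q/4)"
  define a1 where "a1 = \<alpha> + \<nu>0 * q"
  define K1 where "K1 = D * 2 powr (q/2) / (a1 + 1) * 2 powr (- (\<alpha> + 1))"
  define K2 where "K2 = D * 2 powr \<bar>\<alpha>\<bar> * (2 / (1 - s/4))"
  define K3 where "K3 = D * 2 powr (q/2) * (1 / (q/2 - \<alpha> - 1))"
  have D0: "D > 0" using C(1) by (simp add: D_def)
  have q4: "q/4 \<ge> 0" using assms by simp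
  have main: "weighted_moment \<alpha> q (bessel_J \<nu>) \<le> ennreal (K1 + K2 + K3)"
    if "\<nu> \<ge> max 27 (2 * \<nu>0)" for \<nu>
  proof -
    have nu: "\<nu> \<ge> 27" "\<nu> \<ge> 2 * \<nu>0" using that by auto
    have J: "\<bar>bessel_J \<nu> r\<bar> powr q \<le> D * X powr (-(q/4))"
      if "r > 0" "X > 0" "X \<le> \<bar>r\<^sup>2 - \<nu>\<^sup>2\<bar> + \<nu> powr (4/3)" for r X
    proof -
      have "bessel_J \<nu> r ^ 4 * X \<le> bessel_J \<nu> r ^ 4 * (\<bar>r\<^sup>2 - \<nu>\<^sup>2\<bar> + \<nu> powr (4/3))"
        using that by (intro mult_left_mono) auto
      also have "\<dots> \<le> C" by (rule C(2)[OF nu(1) that(1)])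
      finally show ?thesis unfolding D_def using that assms by (intro powr_le_of_pow4) auto
    qed
    have far: "\<bar>bessel_J \<nu> r\<bar> powr q \<le> D * 2 powr (q/2) * R powr (-(q/2))"
      if "r > 0" "R > 0" "(R/2)\<^sup>2 \<le> \<bar>r\<^sup>2 - \<nu>\<^sup>2\<bar>" for r R
    proof -
      have "\<bar>bessel_J \<nu> r\<bar> powr q \<le> D * ((R/2)\<^sup>2) powr (-(q/4))"
        using that by (intro J) (auto intro: order_trans[OF that(3)])
      also have "((R/2)\<^sup>2) powr (-(q/4)) = ((R/2) powr 2) powr (-(q/4))" using that by simp
      also have "\<dots> = (R/2) powr (-(q/2))" unfolding powr_powr by simp
      also have "\<dots> = 2 powr (q/2) * R powr (-(q/2))"
        unfolding powr_divide by (simp add: powr_minus_divide)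
      finally show ?thesis by simp
    qed
    define w where "w = D * 2 powr (q/2) * \<nu> powr (-(q/2)) * (2/\<nu>) powr (\<nu>0 * q)"
    define v where "v = D * 2 powr \<bar>\<alpha>\<bar> * \<nu> powr (\<alpha> - (q - s)/3 - s/4)"
    have w0: "w \<ge> 0" "v \<ge> 0" using D0 by (auto simp: w_def v_def)
    let ?G1 = "\<lambda>r. ennreal (r powr a1) * indicator {0..\<nu>/2} r"
    let ?G2 = "\<lambda>r. ennreal (\<bar>r - \<nu>\<bar> powr (-(s/4))) * indicator {\<nu>-\<nu>..\<nu>+\<nu>} r"
    let ?G3 = "\<lambda>r. ennreal (r powr (\<alpha> - q/2)) * indicator {1..} r"
    have pt: "ennreal (r powr \<alpha> * \<bar>bessel_J \<nu> r\<bar> powr q) * indicator {0<..} r \<le>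
        ennreal w * (?G1 r)
       + ennreal v * (?G2 r)
       + ennreal (D * 2 powr (q/2)) * (?G3 r)"
      (is "?L \<le> ?A + ?B + ?C") if rnu: "r \<noteq> \<nu>" for r
    proof -
      consider "r \<le> 0" | "0 < r" "r \<le> \<nu>/2" | "\<nu>/2 < r" "r \<le> 2 * \<nu>" | "2 * \<nu> < r" by linarith
      then show ?thesis
      proof cases
        case 1
        then show ?thesis by simp
      next
        case 2
        have e1: "(\<bar>bessel_J \<nu> r\<bar> powr 2) \<le> (\<bar>bessel_J \<nu> (\<nu>/2)\<bar> powr 2) * (2 * r / \<nu>) powr \<nu>"
          using bessel_below_decay[of \<nu> r] 2 nu by simp
        have e0: "2 * r / \<nu> \<ge> 0" "2 * r / \<nu> \<le> 1" "2 * r / \<nu> > 0" using 2 nu by auto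
        have "\<bar>bessel_J \<nu> r\<bar> powr q = (\<bar>bessel_J \<nu> r\<bar> powr 2) powr (q/2)" unfolding powr_powr by simp
        also have "\<dots> \<le> ((\<bar>bessel_J \<nu> (\<nu>/2)\<bar> powr 2) * (2 * r / \<nu>) powr \<nu>) powr (q/2)"
          using e1 assms(2) by (intro powr_mono2) auto
        also have "\<dots> = \<bar>bessel_J \<nu> (\<nu>/2)\<bar> powr q * (2 * r / \<nu>) powr (\<nu> * (q/2))"
          unfolding powr_mult powr_powr by simp
        also have "\<dots> \<le> (D * 2 powr (q/2) * \<nu> powr (-(q/2))) * (2 * r / \<nu>) powr (\<nu>0 * q)"
        proof (intro mult_mono)
          show "\<bar>bessel_J \<nu> (\<nu>/2)\<bar> powr q \<le> D * 2 powr (q/2) * \<nu> powr (-(q/2))"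
          proof (rule far)
            have "\<bar>(\<nu>/2)\<^sup>2 - \<nu>\<^sup>2\<bar> = 3/4 * \<nu>\<^sup>2" by (simp add: power_divide)
            then show "(\<nu>/2)\<^sup>2 \<le> \<bar>(\<nu>/2)\<^sup>2 - \<nu>\<^sup>2\<bar>" by (simp add: power_divide)
          qed (use nu in auto)
          have "\<nu>0 * q \<le> \<nu> * (q/2)" using mult_right_mono[OF nu(2), of q] assms by simp
          then show "(2 * r / \<nu>) powr (\<nu> * (q/2)) \<le> (2 * r / \<nu>) powr (\<nu>0 * q)"
            using e0 by (intro powr_mono') auto
        qed (use D0 in auto)
        also have "2 * r / \<nu> = (2/\<nu>) * r" by simp
        also have "((2/\<nu>) * r) powr (\<nu>0 * q) = (2/\<nu>) powr (\<nu>0 * q) * r powr (\<nu>0 * q)"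
          by (rule powr_mult)
        finally have "\<bar>bessel_J \<nu> r\<bar> powr q \<le> w * r powr (\<nu>0 * q)" by (simp add: w_def mult_ac)
        then have "r powr \<alpha> * \<bar>bessel_J \<nu> r\<bar> powr q \<le> r powr \<alpha> * (w * r powr (\<nu>0 * q))" by (intro mult_left_mono) auto
        also have "\<dots> = w * r powr a1" by (simp add: a1_def powr_add)
        finally have "ennreal (r powr \<alpha> * \<bar>bessel_J \<nu> r\<bar> powr q) \<le> ennreal w * ennreal (r powr a1)"
          using w0 by (simp add: ennreal_mult[symmetric])
        then have "?L \<le> ?A" using 2 by simp
        then show ?thesis by (rule order_trans) (simp add: add.assoc)
      next
        case 3
        have r0: "r > 0" using 3 nu by simp
        define y where "y = \<nu> * \<bar>r - \<nu>\<bar>"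
        have y0: "y > 0" using rnu nu by (simp add: y_def)
        have "\<bar>r\<^sup>2 - \<nu>\<^sup>2\<bar> = (r + \<nu>) * \<bar>r - \<nu>\<bar>"
          using r0 nu by (simp add: power2_eq_square square_diff_square_factored abs_mult)
        then have y1: "y \<le> \<bar>r\<^sup>2 - \<nu>\<^sup>2\<bar>" using r0 by (simp add: y_def mult_right_mono)
        have "\<bar>bessel_J \<nu> r\<bar> powr q \<le> D * (y + \<nu> powr (4/3)) powr (-(q/4))"
          using r0 y0 y1 by (intro J) (auto intro!: add_pos_nonneg)
        also have "(y + \<nu> powr (4/3)) powr (-(q/4)) = (y + \<nu> powr (4/3)) powr (-((q-s)/4)) * (y + \<nu> powr (4/3)) powr (-(s/4))"
          by (simp add: powr_add[symmetric] field_simps)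
        also have "\<dots> \<le> (\<nu> powr (4/3)) powr (-((q-s)/4)) * y powr (-(s/4))"
          using y0 s nu by (intro mult_mono powr_mono2') auto
        also have "(\<nu> powr (4/3)) powr (-((q-s)/4)) = \<nu> powr (-((q-s)/3))"
          unfolding powr_powr by (rule arg_cong[where f="\<lambda>x. \<nu> powr x"]) (simp add: field_simps)
        also have "y powr (-(s/4)) = \<nu> powr (-(s/4)) * \<bar>r - \<nu>\<bar> powr (-(s/4))"
          unfolding y_def by (rule powr_mult)
        finally have j: "\<bar>bessel_J \<nu> r\<bar> powr q \<le> D * (\<nu> powr (-((q-s)/3)) * (\<nu> powr (-(s/4)) * \<bar>r - \<nu>\<bar> powr (-(s/4))))"
          using D0 by simp
        have ra: "r powr \<alpha> \<le> 2 powr \<bar>\<alpha>\<bar> * \<nu> powr \<alpha>"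
        proof (cases "\<alpha> \<ge> 0")
          case True
          then have "r powr \<alpha> \<le> (2 * \<nu>) powr \<alpha>" using 3 r0 by (intro powr_mono2) auto
          then show ?thesis using True by (simp add: powr_mult)
        next
          case False
          then have "r powr \<alpha> \<le> (\<nu>/2) powr \<alpha>" using 3 nu by (intro powr_mono2') auto
          also have "\<dots> = 2 powr (-\<alpha>) * \<nu> powr \<alpha>" unfolding powr_divide powr_minus_divide by simp
          finally show ?thesis using False by simp
        qed
        have "r powr \<alpha> * \<bar>bessel_J \<nu> r\<bar> powr q \<le> (2 powr \<bar>\<alpha>\<bar> * \<nu> powr \<alpha>) * (D * (\<nu> powr (-((q-s)/3)) * (\<nu> powr (-(s/4)) * \<bar>r - \<nu>\<bar> powr (-(s/4)))))"
          using j ra D0 by (intro mult_mono) auto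
        also have "\<dots> = D * 2 powr \<bar>\<alpha>\<bar> * (\<nu> powr \<alpha> * \<nu> powr (-((q-s)/3)) * \<nu> powr (-(s/4))) * \<bar>r - \<nu>\<bar> powr (-(s/4))" by simp
        also have "\<nu> powr \<alpha> * \<nu> powr (-((q-s)/3)) * \<nu> powr (-(s/4)) = \<nu> powr (\<alpha> - (q - s)/3 - s/4)"
          by (simp only: powr_add[symmetric] diff_conv_add_uminus)
        finally have "r powr \<alpha> * \<bar>bessel_J \<nu> r\<bar> powr q \<le> v * \<bar>r - \<nu>\<bar> powr (-(s/4))" by (simp add: v_def)
        then have "ennreal (r powr \<alpha> * \<bar>bessel_J \<nu> r\<bar> powr q) \<le> ennreal v * ennreal (\<bar>r - \<nu>\<bar> powr (-(s/4)))"
          using w0 by (simp add: ennreal_mult[symmetric])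
        then have "?L \<le> ?B" using 3 r0 by simp
        also have "?B \<le> ?A + ?B" by simp
        finally show ?thesis by (rule order_trans) simp
      next
        case 4
        have r0: "r > 0" "r \<ge> 1" using 4 nu by auto
        have "(2*\<nu>)\<^sup>2 \<le> r\<^sup>2" using 4 nu by (intro power_mono) auto
        then have "4 * \<nu>\<^sup>2 \<le> r\<^sup>2" by (simp add: power_mult_distrib)
        then have "(r/2)\<^sup>2 \<le> r\<^sup>2 - \<nu>\<^sup>2"
        proof -
          have "(r/2)\<^sup>2 = r\<^sup>2 / 4" by (simp add: power_divide)
          then show ?thesis using \<open>4 * \<nu>\<^sup>2 \<le> r\<^sup>2\<close> zero_le_power2[of r] by linarith
        qed
        then have "(r/2)\<^sup>2 \<le> \<bar>r\<^sup>2 - \<nu>\<^sup>2\<bar>" by linarith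
        then have "\<bar>bessel_J \<nu> r\<bar> powr q \<le> D * 2 powr (q/2) * r powr (-(q/2))" using r0 by (intro far) auto
        then have "r powr \<alpha> * \<bar>bessel_J \<nu> r\<bar> powr q \<le> r powr \<alpha> * (D * 2 powr (q/2) * r powr (-(q/2)))" by (intro mult_left_mono) auto
        also have "\<dots> = D * 2 powr (q/2) * (r powr \<alpha> * r powr (-(q/2)))" by simp
        also have "r powr \<alpha> * r powr (-(q/2)) = r powr (\<alpha> - q/2)" by (simp only: powr_add[symmetric] diff_conv_add_uminus)
        finally have "ennreal (r powr \<alpha> * \<bar>bessel_J \<nu> r\<bar> powr q) \<le> ennreal (D * 2 powr (q/2)) * ennreal (r powr (\<alpha> - q/2))"
          using D0 by (simp add: ennreal_mult[symmetric])
        then have "?L \<le> ?C" using r0 by simp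
        then show ?thesis by (rule order_trans) simp
      qed
    qed
    have "weighted_moment \<alpha> q (bessel_J \<nu>) \<le>
      (\<integral>\<^sup>+r. ennreal w * (?G1 r)
       + ennreal v * (?G2 r)
       + ennreal (D * 2 powr (q/2)) * (?G3 r) \<partial>lborel)"
      by (rule nn_integral_mono_AE) (use AE_lborel_singleton[of \<nu>] in eventually_elim, rule pt)
    also have "\<dots> = ennreal w * (\<integral>\<^sup>+r. ?G1 r \<partial>lborel)
       + ennreal v * (\<integral>\<^sup>+r. ?G2 r \<partial>lborel)
       + ennreal (D * 2 powr (q/2)) * (\<integral>\<^sup>+r. ?G3 r \<partial>lborel)"
      by (simp add: nn_integral_add nn_integral_cmult)
    also have "\<dots> \<le> ennreal w * ennreal ((\<nu>/2) powr (a1+1) / (a1+1))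
       + ennreal v * ennreal (2 * \<nu> powr (-(s/4)+1) / (-(s/4)+1))
       + ennreal (D * 2 powr (q/2)) * ennreal (- (1 powr (\<alpha> - q/2 + 1)) / (\<alpha> - q/2 + 1))"
    proof (intro add_mono mult_left_mono)
      show "(\<integral>\<^sup>+r. ?G1 r \<partial>lborel) \<le> ennreal ((\<nu>/2) powr (a1+1) / (a1+1))"
        using nn_integral_powr_0[of a1 "\<nu>/2"] assms nu by (simp add: a1_def add_ac)
      show "(\<integral>\<^sup>+r. ?G2 r \<partial>lborel) \<le> ennreal (2 * \<nu> powr (-(s/4)+1) / (-(s/4)+1))"
        by (rule nn_integral_abs_powr) (use s nu in auto)
      show "(\<integral>\<^sup>+r. ?G3 r \<partial>lborel) \<le> ennreal (- (1 powr (\<alpha> - q/2 + 1)) / (\<alpha> - q/2 + 1))"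
        using nn_integral_powr_inf[of "\<alpha> - q/2" 1] assms by simp
    qed auto
    also have "\<dots> \<le> ennreal K1 + ennreal K2 + ennreal K3"
    proof (intro add_mono)
      have a10: "a1 + 1 > 0" using assms by (simp add: a1_def add_ac)
      have p1: "\<nu> powr x \<le> 1" if "x \<le> 0" for x using powr_mono[OF that, of \<nu>] nu by simp
      have "w * ((\<nu>/2) powr (a1+1) / (a1+1)) = D * 2 powr (q/2) / (a1+1) * (\<nu> powr (-(q/2)) * (2/\<nu>) powr (\<nu>0 * q) * (\<nu>/2) powr (a1+1))"
        by (simp add: w_def)
      also have "\<nu> powr (-(q/2)) * (2/\<nu>) powr (\<nu>0 * q) * (\<nu>/2) powr (a1+1) = 2 powr (-(\<alpha>+1)) * \<nu> powr (\<alpha> + 1 - q/2)"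
      proof -
        have "(2/\<nu>) powr (\<nu>0 * q) = (\<nu>/2) powr (-(\<nu>0 * q))"
          unfolding powr_divide powr_minus_divide by simp
        then have "\<nu> powr (-(q/2)) * (2/\<nu>) powr (\<nu>0 * q) * (\<nu>/2) powr (a1+1) = \<nu> powr (-(q/2)) * (\<nu>/2) powr (\<alpha>+1)"
          by (simp add: mult.assoc powr_add[symmetric] a1_def)
        also have "(\<nu>/2) powr (\<alpha>+1) = 2 powr (-(\<alpha>+1)) * \<nu> powr (\<alpha>+1)" unfolding powr_divide powr_minus_divide by simp
        also have "\<nu> powr (-(q/2)) * (2 powr (-(\<alpha>+1)) * \<nu> powr (\<alpha>+1)) = 2 powr (-(\<alpha>+1)) * (\<nu> powr (\<alpha>+1) * \<nu> powr (-(q/2)))" by simp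
        also have "\<nu> powr (\<alpha>+1) * \<nu> powr (-(q/2)) = \<nu> powr (\<alpha> + 1 - q/2)" by (simp only: powr_add[symmetric] diff_conv_add_uminus)
        finally show ?thesis .
      qed
      also have "D * 2 powr (q/2) / (a1+1) * (2 powr (-(\<alpha>+1)) * \<nu> powr (\<alpha> + 1 - q/2)) \<le> D * 2 powr (q/2) / (a1+1) * (2 powr (-(\<alpha>+1)) * 1)"
        using a10 D0 assms by (intro mult_left_mono p1) auto
      finally have "w * ((\<nu>/2) powr (a1+1) / (a1+1)) \<le> K1" by (simp add: K1_def)
      then show "ennreal w * ennreal ((\<nu>/2) powr (a1+1) / (a1+1)) \<le> ennreal K1"
        using w0 by (simp add: ennreal_mult'[symmetric] ennreal_leI)
      have "v * (2 * \<nu> powr (-(s/4)+1) / (-(s/4)+1)) = D * 2 powr \<bar>\<alpha>\<bar> * (2 / (1 - s/4)) * (\<nu> powr (\<alpha> - (q - s)/3 - s/4) * \<nu> powr (-(s/4)+1))"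
        by (simp add: v_def)
      also have "\<nu> powr (\<alpha> - (q - s)/3 - s/4) * \<nu> powr (-(s/4)+1) = \<nu> powr (\<alpha> + 1 - q/3 - s/6)"
        unfolding powr_add[symmetric] by (rule arg_cong[where f="\<lambda>x. \<nu> powr x"]) (simp add: field_simps)
      also have "D * 2 powr \<bar>\<alpha>\<bar> * (2 / (1 - s/4)) * (\<nu> powr (\<alpha> + 1 - q/3 - s/6)) \<le> D * 2 powr \<bar>\<alpha>\<bar> * (2 / (1 - s/4)) * 1"
        using D0 s by (intro mult_left_mono p1) auto
      finally have "v * (2 * \<nu> powr (-(s/4)+1) / (-(s/4)+1)) \<le> K2" by (simp add: K2_def)
      then show "ennreal v * ennreal (2 * \<nu> powr (-(s/4)+1) / (-(s/4)+1)) \<le> ennreal K2"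
        using w0 by (simp add: ennreal_mult'[symmetric] ennreal_leI)
      have "\<alpha> - q/2 + 1 = - (q/2 - \<alpha> - 1)" by simp
      then have "- (1 powr (\<alpha> - q/2 + 1)) / (\<alpha> - q/2 + 1) = 1 / (q/2 - \<alpha> - 1)"
        by (simp only: powr_one_eq_one minus_divide_divide)
      then show "ennreal (D * 2 powr (q/2)) * ennreal (- (1 powr (\<alpha> - q/2 + 1)) / (\<alpha> - q/2 + 1)) \<le> ennreal K3"
        using D0 by (simp add: ennreal_mult'[symmetric] K3_def)
    qed
    also have "\<dots> = ennreal (K1 + K2 + K3)"
      using D0 assms s by (simp add: K1_def K2_def K3_def a1_def ennreal_plus[symmetric] add_ac del: ennreal_plus)
    finally show ?thesis .
  qed
  have "K1 > 0" "K2 > 0" "K3 > 0" using D0 assms s by (auto simp: K1_def K2_def K3_def a1_def add_ac)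
  then show ?thesis using main by (intro exI[of _ "K1 + K2 + K3"]) auto
qed

text \<open>
  The last three conditions are integrability at 0 for the smallest order, integrability at infinity, and absence
  of growth in \<open>\<nu>\<close> of the contribution of the transition zone.
\<close>

lemma bessel_integral_uniform:
  fixes \<alpha> q \<nu>0 :: real
  assumes "\<nu>0 > 0" "q > 0" "\<alpha> + 1 + \<nu>0 * q > 0" "\<alpha> + 1 - q/2 < 0" "\<alpha> + 1/3 - q/3 < 0"
  shows "\<exists>K>0. \<forall>\<nu>\<ge>\<nu>0. weighted_moment \<alpha> q (bessel_J \<nu>) \<le> ennreal K"
proof -
  define N where "N = max 27 (2 * \<nu>0)"
  obtain K1 where K1: "K1 > 0" "\<And>\<nu>. \<nu> \<in> {\<nu>0..N} \<Longrightarrow> weighted_moment \<alpha> q (bessel_J \<nu>) \<le> ennreal K1"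
    using bessel_integral_bounded_order[OF assms(1-4), of N] by blast
  obtain K2 where K2: "K2 > 0" "\<And>\<nu>. \<nu> \<ge> N \<Longrightarrow> weighted_moment \<alpha> q (bessel_J \<nu>) \<le> ennreal K2"
    using bessel_integral_large_order[OF assms] by (auto simp: N_def)
  have "weighted_moment \<alpha> q (bessel_J \<nu>) \<le> ennreal (max K1 K2)" if "\<nu> \<ge> \<nu>0" for \<nu>
  proof (cases "\<nu> \<le> N")
    case True
    show ?thesis by (rule order_trans[OF K1(2)]) (use that True in \<open>auto intro: ennreal_leI\<close>)
  next
    case False
    show ?thesis by (rule order_trans[OF K2(2)]) (use False in \<open>auto intro: ennreal_leI\<close>)
  qed
  then show ?thesis using K1(1) by (intro exI[of _ "max K1 K2"]) auto
qed

section \<open>Continuously differentiable functions and the divergence theorem\<close>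

definition C1_on :: "'a::euclidean_space set \<Rightarrow> ('a \<Rightarrow> 'b::real_normed_vector) \<Rightarrow> bool" where
  "C1_on S f \<longleftrightarrow> (\<forall>x\<in>S. f differentiable (at x)) \<and> (\<forall>b. continuous_on S (\<lambda>x. frechet_derivative f (at x) b))"

lemma C1_onI:
  assumes "\<And>x. x \<in> S \<Longrightarrow> (f has_derivative f' x) (at x)" "\<And>b. continuous_on S (\<lambda>x. f' x b)"
  shows "C1_on S f"
proof -
  have e: "frechet_derivative f (at x) = f' x" if "x \<in> S" for x
    by (rule frechet_derivative_at[OF assms(1)[OF that], symmetric])
  have "continuous_on S (\<lambda>x. frechet_derivative f (at x) b)" for b
    using assms(2)[of b] by (rule continuous_on_eq) (simp add: e)
  moreover have "f differentiable (at x)" if "x \<in> S" for x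
    using assms(1)[OF that] by (rule differentiableI)
  ultimately show ?thesis unfolding C1_on_def by blast
qed

lemma C1_on_deriv: "C1_on S f \<Longrightarrow> x \<in> S \<Longrightarrow> (f has_derivative frechet_derivative f (at x)) (at x)"
  unfolding C1_on_def frechet_derivative_works[symmetric] by blast

lemma C1_on_cont_deriv: "C1_on S f \<Longrightarrow> continuous_on S (\<lambda>x. frechet_derivative f (at x) b)"
  by (auto simp: C1_on_def)

lemma C1_on_cont: "C1_on S f \<Longrightarrow> continuous_on S f"
  unfolding C1_on_def by (meson continuous_at_imp_continuous_on differentiable_imp_continuous_within)

lemma C1_on_Un: "C1_on S f \<Longrightarrow> C1_on T f \<Longrightarrow> open S \<Longrightarrow> open T \<Longrightarrow> C1_on (S \<union> T) f"
  by (auto simp: C1_on_def intro: continuous_on_open_Un)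

lemma C1_on_transform:
  assumes "C1_on S f" "open S" "\<And>x. x \<in> S \<Longrightarrow> f x = g x"
  shows "C1_on S g"
  by (rule C1_onI[OF has_derivative_transform_within_open[OF C1_on_deriv[OF assms(1)] assms(2)]])
     (use assms in \<open>auto intro: C1_on_cont_deriv\<close>)

lemma C1_on_const [simp]: "C1_on S (\<lambda>x. c)"
  by (rule C1_onI[where f'="\<lambda>_ _. 0"]) auto

lemma C1_on_add: "C1_on S f \<Longrightarrow> C1_on S g \<Longrightarrow> C1_on S (\<lambda>x. f x + g x)"
  by (rule C1_onI[OF has_derivative_add[OF C1_on_deriv C1_on_deriv]])
     (assumption | rule continuous_on_add continuous_on_diff C1_on_cont_deriv)+

lemma C1_on_diff: "C1_on S f \<Longrightarrow> C1_on S g \<Longrightarrow> C1_on S (\<lambda>x. f x - g x)"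
  by (rule C1_onI[OF has_derivative_diff[OF C1_on_deriv C1_on_deriv]])
     (assumption | rule continuous_on_add continuous_on_diff C1_on_cont_deriv)+

lemma C1_on_sum: "(\<And>i. i \<in> I \<Longrightarrow> C1_on S (f i)) \<Longrightarrow> C1_on S (\<lambda>x. \<Sum>i\<in>I. f i x)"
  by (induction I rule: infinite_finite_induct) (auto intro: C1_on_add)

lemma C1_on_linear: "bounded_linear L \<Longrightarrow> C1_on S f \<Longrightarrow> C1_on S (\<lambda>x. L (f x))"
  by (rule C1_onI[OF bounded_linear.has_derivative[OF _ C1_on_deriv]])
     (assumption | rule bounded_linear.continuous_on C1_on_cont_deriv)+

lemma C1_on_bilinear:
  assumes "bounded_bilinear B" "C1_on S f" "C1_on S g" shows "C1_on S (\<lambda>x. B (f x) (g x))"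
proof -
  interpret bounded_bilinear B by fact
  show ?thesis
    by (rule C1_onI[OF FDERIV[OF C1_on_deriv[OF assms(2)] C1_on_deriv[OF assms(3)]]])
       (intro continuous_on_add continuous_on C1_on_cont_deriv C1_on_cont[OF assms(2)] C1_on_cont[OF assms(3)] assms | assumption)+
qed

lemmas C1_on_mult = C1_on_bilinear[OF bounded_bilinear_mult]
lemmas C1_on_scaleR = C1_on_bilinear[OF bounded_bilinear_scaleR]
lemmas C1_on_inner = C1_on_bilinear[OF bounded_bilinear_inner]

lemma C1_on_prod: "finite I \<Longrightarrow> (\<And>i. i \<in> I \<Longrightarrow> C1_on S (f i :: _ \<Rightarrow> real)) \<Longrightarrow> C1_on S (\<lambda>x. \<Prod>i\<in>I. f i x)"
  by (induction I rule: finite_induct) (auto intro: C1_on_mult)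

lemma C1_on_real_compose:
  fixes f :: "_ \<Rightarrow> real" and g :: "real \<Rightarrow> real"
  assumes "C1_on S f" "\<And>x. x \<in> S \<Longrightarrow> f x \<in> T" "\<And>y. y \<in> T \<Longrightarrow> (g has_real_derivative g' y) (at y)" "continuous_on T g'"
  shows "C1_on S (\<lambda>x. g (f x))"
proof (rule C1_onI)
  show "((\<lambda>x. g (f x)) has_derivative (\<lambda>h. frechet_derivative f (at x) h * g' (f x))) (at x)" if "x \<in> S" for x
    using has_derivative_compose[OF C1_on_deriv[OF assms(1) that] assms(3)[OF assms(2)[OF that], unfolded has_field_derivative_def]]
    by (simp add: mult.commute)
  show "continuous_on S (\<lambda>x. frechet_derivative f (at x) b * g' (f x))" for b
    by (intro continuous_intros C1_on_cont_deriv assms(1) continuous_on_compose2[OF assms(4) C1_on_cont[OF assms(1)]])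
       (use assms(2) in auto)
qed

lemma C1_on_inverse: "C1_on S f \<Longrightarrow> (\<And>x. x \<in> S \<Longrightarrow> f x \<noteq> (0::real)) \<Longrightarrow> C1_on S (\<lambda>x. inverse (f x))"
  by (rule C1_on_real_compose[where T="-{0}" and g'="\<lambda>y. - (inverse y * inverse y)"])
     (auto intro!: derivative_eq_intros continuous_intros)

lemma C1_on_sqrt: "C1_on S f \<Longrightarrow> (\<And>x. x \<in> S \<Longrightarrow> f x > (0::real)) \<Longrightarrow> C1_on S (\<lambda>x. sqrt (f x))"
  by (rule C1_on_real_compose[where T="{0<..}" and g'="\<lambda>y. inverse (sqrt y) / 2"])
     (auto intro!: derivative_eq_intros continuous_intros)

lemma DERIV_pos_part_square: "((\<lambda>t::real. (max 0 t)\<^sup>2) has_real_derivative 2 * max 0 y) (at y)"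
proof (cases "y = 0")
  case True
  have "((\<lambda>h. (max 0 h)\<^sup>2 / h) \<longlongrightarrow> 0) (at (0::real))"
  proof (rule Lim_null_comparison)
    show "\<forall>\<^sub>F h in at 0. norm ((max 0 h)\<^sup>2 / h) \<le> \<bar>h\<bar>"
      by (intro always_eventually) (auto simp: max_def power2_eq_square)
    show "((\<lambda>h. \<bar>h\<bar>) \<longlongrightarrow> 0) (at (0::real))" by (rule tendsto_eq_intros | simp)+
  qed
  then show ?thesis using True by (simp add: DERIV_def)
next
  case False
  show ?thesis
  proof (cases "y > 0")
    case True
    have "((\<lambda>t::real. t\<^sup>2) has_real_derivative 2 * max 0 y) (at y)" using True by (auto intro!: derivative_eq_intros)
    then show ?thesis by (rule has_field_derivative_transform_within_open[of _ _ _ "{0<..}"]) (use True in auto)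
  next
    case F: False
    have "((\<lambda>t::real. 0) has_real_derivative 2 * max 0 y) (at y)" using F False by (auto intro!: derivative_eq_intros)
    then show ?thesis by (rule has_field_derivative_transform_within_open[of _ _ _ "{..<0}"]) (use F False in auto)
  qed
qed

lemma C1_on_pos_part_square: "C1_on S f \<Longrightarrow> C1_on S (\<lambda>x. (max 0 (f x :: real))\<^sup>2)"
  by (rule C1_on_real_compose[where T=UNIV and g'="\<lambda>y. 2 * max 0 y" and g="\<lambda>t. (max 0 t)\<^sup>2"])
     (auto intro!: DERIV_pos_part_square continuous_intros)

lemma Ck_on_1_imp_C1_on: assumes "Ck_on (Suc 0) S f" "open S" shows "C1_on S f"
proof (rule C1_onI)
  show d: "(f has_derivative frechet_derivative f (at x)) (at x)" if "x \<in> S" for x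
  proof -
    have "f differentiable (at x within S)" using assms(1) that by (simp add: differentiable_on_def)
    then have "f differentiable (at x)" by (simp only: at_within_open[OF that assms(2)])
    then show ?thesis by (simp only: frechet_derivative_works)
  qed
  show "continuous_on S (\<lambda>x. frechet_derivative f (at x) b)" for b
  proof -
    have c: "continuous_on S (\<lambda>x. \<Sum>i\<in>Basis. (b \<bullet> i) *\<^sub>R frechet_derivative f (at x) i)"
      using assms(1) by (intro continuous_intros) auto
    have "(\<Sum>i\<in>Basis. (b \<bullet> i) *\<^sub>R frechet_derivative f (at x) i) = frechet_derivative f (at x) b" if "x \<in> S" for x
    proof -
      have l: "linear (frechet_derivative f (at x))"
        using has_derivative_bounded_linear[OF d[OF that]] by (rule bounded_linear.linear)
      have "frechet_derivative f (at x) b = frechet_derivative f (at x) (\<Sum>i\<in>Basis. (b \<bullet> i) *\<^sub>R i)"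
        by (simp only: euclidean_representation)
      also have "\<dots> = (\<Sum>i\<in>Basis. (b \<bullet> i) *\<^sub>R frechet_derivative f (at x) i)"
        by (simp only: linear_sum[OF l] linear_scale[OF l])
      finally show ?thesis by (rule sym)
    qed
    then show ?thesis using c by (simp cong: continuous_on_cong)
  qed
qed

lemma smooth_on_imp_C1: "smooth_on S f \<Longrightarrow> open S \<Longrightarrow> C1_on S f"
  by (intro Ck_on_1_imp_C1_on) (auto simp: smooth_on_def)

lemma smooth_on_imp_C1_partial: "smooth_on S f \<Longrightarrow> open S \<Longrightarrow> C1_on S (partial_deriv i f)"
proof -
  assume a: "smooth_on S f" "open S"
  have "Ck_on (Suc (Suc 0)) S f" using a unfolding smooth_on_def by blast
  moreover have "axis i (1::real) \<in> Basis" by (simp add: axis_in_Basis_iff)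
  ultimately have "Ck_on (Suc 0) S (\<lambda>x. frechet_derivative f (at x) (axis i 1))"
    unfolding Ck_on.simps(2)[of "Suc 0"] by blast
  then show ?thesis using a by (intro Ck_on_1_imp_C1_on) (simp_all add: partial_deriv_def[abs_def])
qed

lemma integral_translate:
  fixes F :: "'a::euclidean_space \<Rightarrow> 'b::{banach, second_countable_topology}"
  assumes [measurable]: "F \<in> borel_measurable borel"
  shows "(\<integral>x. F (c + x) \<partial>lborel) = (\<integral>x. F x \<partial>lborel)"
  using integral_distr[of "(+) c" lborel borel F] by (simp add: lborel_distr_plus)

lemma integrable_translate:
  fixes F :: "'a::euclidean_space \<Rightarrow> 'b::{banach, second_countable_topology}"
  assumes [measurable]: "F \<in> borel_measurable borel" and "integrable lborel F"
  shows "integrable lborel (\<lambda>x. F (c + x))"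
  using integrable_distr_eq[of "(+) c" lborel borel F] assms by (simp add: lborel_distr_plus)

lemma integrable_compact_support:
  fixes F :: "'a::euclidean_space \<Rightarrow> 'b::{banach, second_countable_topology}"
  assumes "continuous_on UNIV F" "compact K" "\<And>x. x \<notin> K \<Longrightarrow> F x = 0"
  shows "integrable lborel F"
proof -
  have "integrable lborel (\<lambda>x. indicator K x *\<^sub>R F x)"
    using borel_integrable_compact[OF assms(2) continuous_on_subset[OF assms(1)]] by (simp add: set_integrable_def)
  moreover have "indicator K x *\<^sub>R F x = F x" for x using assms(3) by (auto simp: indicator_def)
  ultimately show ?thesis by simp
qed

text \<open>
  By translation invariance the integral of \<open>(F(x + h e_i) - F(x)) / h\<close> is 0 for every \<open>h\<close>, and dominated
  convergence lets \<open>h\<close> tend to 0.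
\<close>

lemma integral_partial_zero:
  fixes F :: "real^'m \<Rightarrow> complex"
  assumes C1: "C1_on UNIV F" and K: "compact K" "\<And>x. x \<notin> K \<Longrightarrow> F x = 0"
  shows "integrable lborel (partial_deriv i F)" "(\<integral>x. partial_deriv i F x \<partial>lborel) = 0"
proof -
  define e :: "real^'m" where "e = axis i 1"
  define D where "D = (\<lambda>x. frechet_derivative F (at x) e)"
  have De: "partial_deriv i F = D" by (simp add: D_def e_def partial_deriv_def[abs_def])
  have e1: "norm e = 1" by (simp add: e_def)
  have Fc: "continuous_on UNIV F" by (rule C1_on_cont[OF C1])
  have Dc: "continuous_on UNIV D" unfolding D_def by (rule C1_on_cont_deriv[OF C1])
  have D0: "D x = 0" if "x \<notin> K" for x
  proof -
    have "((\<lambda>x. 0) has_derivative (\<lambda>_. 0)) (at x)" by simp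
    then have "(F has_derivative (\<lambda>_. 0)) (at x)"
      by (rule has_derivative_transform_within_open[of _ _ _ _ "-K"]) (use that K in \<open>auto simp: compact_imp_closed\<close>)
    then have "(\<lambda>_. 0) = frechet_derivative F (at x)" by (rule frechet_derivative_at)
    then show ?thesis unfolding D_def by metis
  qed
  have Dint: "integrable lborel D" by (rule integrable_compact_support[OF Dc K(1) D0])
  have Fint: "integrable lborel F" by (rule integrable_compact_support[OF Fc K])
  obtain B where B: "\<And>x. norm (D x) \<le> B" "B \<ge> 0"
  proof -
    have "bounded (D ` K)" by (intro compact_imp_bounded compact_continuous_image K continuous_on_subset[OF Dc]) auto
    then obtain b where "\<And>x. x \<in> K \<Longrightarrow> norm (D x) \<le> b" by (auto simp: bounded_iff)
    then have "norm (D x) \<le> max b 0" for x using D0 by (cases "x \<in> K") (auto simp: le_max_iff_disj)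
    then show ?thesis using that[of "max b 0"] by auto
  qed
  obtain R where R: "K \<subseteq> cball 0 R" using compact_imp_bounded[OF K(1)]
    by (auto simp: bounded_iff subset_iff)
  define s where "s = (\<lambda>n x. real (Suc n) *\<^sub>R (F ((1 / real (Suc n)) *\<^sub>R e + x) - F x))"
  have [measurable]: "F \<in> borel_measurable borel" "D \<in> borel_measurable borel"
    by (auto intro: borel_measurable_continuous_onI Fc Dc)
  have bound: "norm (F (h *\<^sub>R e + x) - F x) \<le> B * h" if "h \<ge> 0" for h x
  proof -
    have "norm ((\<lambda>t. F (t *\<^sub>R e + x)) h - (\<lambda>t. F (t *\<^sub>R e + x)) 0) \<le> B * norm (h - 0)"
    proof (rule differentiable_bound[of "{0..h}" _ "\<lambda>t s. s *\<^sub>R D (t *\<^sub>R e + x)"])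
      fix t assume "t \<in> {0..h}"
      have "((\<lambda>t. F (t *\<^sub>R e + x)) has_derivative (\<lambda>s. frechet_derivative F (at (t *\<^sub>R e + x)) (s *\<^sub>R e))) (at t within {0..h})"
        by (rule has_derivative_compose[of "\<lambda>t. t *\<^sub>R e + x", OF _ C1_on_deriv[OF C1]]) (auto intro!: derivative_eq_intros)
      moreover have "frechet_derivative F (at (t *\<^sub>R e + x)) (s *\<^sub>R e) = s *\<^sub>R D (t *\<^sub>R e + x)" for s
        using linear_frechet_derivative[of F "at (t *\<^sub>R e + x)"] C1 by (simp add: D_def C1_on_def linear_scale)
      ultimately show "((\<lambda>t. F (t *\<^sub>R e + x)) has_derivative (\<lambda>s. s *\<^sub>R D (t *\<^sub>R e + x))) (at t within {0..h})" by simp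
      show "onorm (\<lambda>s. s *\<^sub>R D (t *\<^sub>R e + x)) \<le> B"
        by (rule onorm_le) (use B in \<open>auto simp: mult.commute[of B] intro: mult_left_mono\<close>)
    qed (use that in auto)
    then show ?thesis using that by simp
  qed
  have s0: "(\<integral>x. s n x \<partial>lborel) = 0" for n
    unfolding s_def using integrable_translate[of F "(1 / real (Suc n)) *\<^sub>R e"] Fint
      integral_translate[of F "(1 / real (Suc n)) *\<^sub>R e"]
    by (simp del: of_nat_Suc)
  have "(\<lambda>n. \<integral>x. s n x \<partial>lborel) \<longlonglongrightarrow> (\<integral>x. D x \<partial>lborel)"
  proof (rule integral_dominated_convergence[where w="\<lambda>x. B * indicator (cball 0 (R + 1)) x"])
    show "integrable lborel (\<lambda>x. B * indicator (cball 0 (R + 1)) (x::real^'m))"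
      by (intro integrable_mult_right integrable_real_indicator emeasure_lborel_cball_finite) simp
    show "AE x in lborel. (\<lambda>n. s n x) \<longlonglongrightarrow> D x"
    proof (rule AE_I2)
      fix x
      have "((\<lambda>t. F (t *\<^sub>R e + x)) has_derivative (\<lambda>s. frechet_derivative F (at (0 *\<^sub>R e + x)) (s *\<^sub>R e))) (at 0)"
        by (rule has_derivative_compose[of "\<lambda>t. t *\<^sub>R e + x", OF _ C1_on_deriv[OF C1]]) (auto intro!: derivative_eq_intros)
      moreover have "frechet_derivative F (at x) (s *\<^sub>R e) = s *\<^sub>R D x" for s
        using linear_frechet_derivative[of F "at x"] C1 by (simp add: D_def C1_on_def linear_scale)
      ultimately have "((\<lambda>t. F (t *\<^sub>R e + x)) has_vector_derivative D x) (at 0)"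
        by (simp add: has_vector_derivative_def)
      then have lim: "((\<lambda>t. (F (t *\<^sub>R e + x) - F x - t *\<^sub>R D x) /\<^sub>R \<bar>t\<bar>) \<longlongrightarrow> 0) (at 0)"
        by (simp add: has_vector_derivative_def has_derivative_at_within)
      have "filterlim (\<lambda>n. 1 / real (Suc n)) (at 0) sequentially"
        using LIMSEQ_inverse_real_of_nat by (auto simp: filterlim_at divide_inverse)
      from filterlim_compose[OF lim this]
      have "(\<lambda>n. (F ((1 / real (Suc n)) *\<^sub>R e + x) - F x - (1 / real (Suc n)) *\<^sub>R D x) /\<^sub>R \<bar>1 / real (Suc n)\<bar>) \<longlonglongrightarrow> 0" .
      moreover have "(F ((1 / real (Suc n)) *\<^sub>R e + x) - F x - (1 / real (Suc n)) *\<^sub>R D x) /\<^sub>R \<bar>1 / real (Suc n)\<bar> = s n x - D x" for n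
        unfolding s_def by (simp add: scaleR_diff_right del: of_nat_Suc)
      ultimately have "(\<lambda>n. s n x - D x) \<longlonglongrightarrow> 0" by (simp only:)
      then show "(\<lambda>n. s n x) \<longlonglongrightarrow> D x" by (simp add: LIM_zero_iff)
    qed
    show "AE x in lborel. norm (s n x) \<le> B * indicator (cball 0 (R + 1)) x" for n
    proof (rule AE_I2)
      fix x :: "real^'m"
      define h where "h = 1 / real (Suc n)"
      have h: "0 < h" "h \<le> 1" "real (Suc n) = 1 / h" by (auto simp: h_def)
      have sn: "s n x = (1/h) *\<^sub>R (F (h *\<^sub>R e + x) - F x)" by (simp only: s_def h(3)) simp
      show "norm (s n x) \<le> B * indicator (cball 0 (R + 1)) x"
      proof (cases "x \<in> cball 0 (R + 1)")
        case True
        have "norm (s n x) \<le> (1/h) * (B * h)"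
        proof -
          have "norm (s n x) = (1/h) * norm (F (h *\<^sub>R e + x) - F x)" unfolding sn norm_scaleR using h by simp
          also have "\<dots> \<le> (1/h) * (B * h)" by (rule mult_left_mono[OF bound]) (use h in auto)
          finally show ?thesis .
        qed
        then show ?thesis using True h by simp
      next
        case False
        then have "x \<notin> K" using R by (auto simp: mem_cball dist_norm)
        moreover have "norm x \<le> norm (h *\<^sub>R e + x) + h" using norm_triangle_ineq4[of "h *\<^sub>R e + x" "h *\<^sub>R e"] e1 h by simp
        then have "h *\<^sub>R e + x \<notin> K" using R False h by auto
        ultimately show ?thesis using K(2) False sn by simp
      qed
    qed
  qed (auto simp: s_def)
  then have "(\<integral>x. D x \<partial>lborel) = 0" using s0 by (simp add: LIMSEQ_const_iff)
  then show "integrable lborel (partial_deriv i F)" "(\<integral>x. partial_deriv i F x \<partial>lborel) = 0" using Dint by (auto simp: De)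
qed

section \<open>Metrics, gradients and partial derivatives\<close>

text \<open>
  All matrices on the segment from the identity to \<open>A\<close> are positive definite, so the determinant has no zero on
  the segment and keeps the sign that it has at the identity.
\<close>

lemma posdef_det_pos:
  fixes A :: "real^'n^'n"
  assumes pos: "\<And>v. v \<noteq> 0 \<Longrightarrow> v \<bullet> (A *v v) > 0"
  shows "det A > 0"
proof -
  define f where "f = (\<lambda>t::real. det (\<chi> i j. (1 - t) * (if i = j then 1 else 0) + t * A $ i $ j))"
  have ft: "f t = det ((1 - t) *\<^sub>R mat 1 + t *\<^sub>R A)" for t
    unfolding f_def by (rule arg_cong[where f=det]) (simp add: vec_eq_iff mat_def)
  have nz: "f t \<noteq> 0" if "t \<in> {0..1}" for t
  proof
    assume "f t = 0"
    then have "\<not> invertible ((1 - t) *\<^sub>R mat 1 + t *\<^sub>R A)" unfolding ft invertible_det_nz by simp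
    then obtain v where v: "v \<noteq> 0" "((1 - t) *\<^sub>R mat 1 + t *\<^sub>R A) *v v = 0"
      unfolding invertible_left_inverse matrix_left_invertible_ker by auto
    then have "0 = v \<bullet> (((1 - t) *\<^sub>R mat 1 + t *\<^sub>R A) *v v)" by simp
    also have "\<dots> = (1 - t) * (v \<bullet> v) + t * (v \<bullet> (A *v v))"
      by (simp add: matrix_vector_mult_add_rdistrib scaleR_matrix_vector_assoc[symmetric] inner_add_right)
    also have "\<dots> > 0"
    proof (cases "t = 0")
      case True then show ?thesis using v by simp
    next
      case False
      then show ?thesis using that pos[OF v(1)] by (intro add_nonneg_pos mult_pos_pos) auto
    qed
    finally show False by simp
  qed
  have "continuous_on {0..1} f" unfolding f_def det_def by (intro continuous_intros)
  moreover have "f 0 = 1" by (simp add: ft det_I)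
  ultimately have "f 1 > 0"
  proof -
    assume c: "continuous_on {0..1} f" and f0: "f 0 = 1"
    show ?thesis
    proof (rule ccontr)
      assume "\<not> f 1 > 0"
      then have "\<exists>x\<ge>0. x \<le> 1 \<and> f x = 0" using f0 c by (intro IVT2') auto
      then show False using nz by auto
    qed
  qed
  then show ?thesis by (simp add: ft)
qed

lemma matrix_inv_right: fixes A :: "real^'n^'n" assumes "invertible A" shows "A ** matrix_inv A = mat 1"
  using assms someI_ex[of "\<lambda>A'. A ** A' = mat 1 \<and> A' ** A = mat 1"] by (simp add: invertible_def matrix_inv_def)

lemma matrix_inv_unique: fixes A B :: "real^'n^'n" assumes "A ** B = mat 1" shows "matrix_inv B = A"
proof -
  have BA: "B ** A = mat 1" using assms matrix_left_right_inverse by blast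
  have i: "invertible B" using assms BA unfolding invertible_def by blast
  then have "matrix_inv B = (A ** B) ** matrix_inv B" by (simp add: assms)
  also have "\<dots> = A" using matrix_inv_right[OF i] by (simp add: matrix_mul_assoc[symmetric])
  finally show ?thesis .
qed

text \<open>Cramer's rule, used to see that the inverse of a \<open>C^1\<close> matrix function is \<open>C^1\<close>.\<close>

lemma matrix_inv_cramer:
  fixes A :: "real^'n^'n" assumes "det A \<noteq> 0"
  shows "matrix_inv A $ i $ j = det (\<chi> a b. if b = i then axis j 1 $ a else A $ a $ b) / det A"
proof -
  have inv: "invertible A" using assms by (simp add: invertible_det_nz)
  have "A *v (matrix_inv A *v axis j 1) = axis j 1"
    using matrix_inv_right[OF inv] by (simp add: matrix_vector_mul_assoc)
  then have "matrix_inv A *v axis j 1 = (\<chi> k. det (\<chi> a b. if b = k then axis j 1 $ a else A $ a $ b) / det A)"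
    by (simp only: cramer[OF assms])
  moreover have "matrix_inv A $ i $ j = (matrix_inv A *v axis j 1) $ i"
    by (simp add: matrix_vector_mult_basis column_def)
  ultimately show ?thesis by simp
qed

lemma C1_on_det:
  fixes A :: "'a::euclidean_space \<Rightarrow> real^'n^'n"
  assumes "\<And>i j. C1_on S (\<lambda>x. A x $ i $ j)"
  shows "C1_on S (\<lambda>x. det (A x))"
  unfolding det_def by (intro C1_on_sum C1_on_mult C1_on_const C1_on_prod assms) auto

lemma C1_on_matrix_inv:
  fixes A :: "'a::euclidean_space \<Rightarrow> real^'n^'n"
  assumes S: "open S" and A: "\<And>i j. C1_on S (\<lambda>x. A x $ i $ j)" and nz: "\<And>x. x \<in> S \<Longrightarrow> det (A x) \<noteq> 0"
  shows "C1_on S (\<lambda>x. matrix_inv (A x) $ i $ j)"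
proof (rule C1_on_transform[OF _ S])
  show "C1_on S (\<lambda>x. det (\<chi> a b. if b = i then axis j 1 $ a else A x $ a $ b) * inverse (det (A x)))"
  proof (intro C1_on_mult C1_on_inverse C1_on_det A nz)
    show "C1_on S (\<lambda>x. (\<chi> a b. if b = i then axis j 1 $ a else A x $ a $ b) $ k $ l)" for k l
      by (cases "l = i") (simp_all add: A)
  qed
qed (simp add: matrix_inv_cramer nz divide_inverse)

lemma matrix_inv_symmetric: fixes A :: "real^'n^'n" assumes "transpose A = A" "det A \<noteq> 0"
  shows "matrix_inv A $ i $ j = matrix_inv A $ j $ i"
proof -
  have inv: "invertible A" using assms(2) by (simp add: invertible_det_nz)
  have "transpose (matrix_inv A) ** A = transpose (A ** matrix_inv A)"
    by (simp add: matrix_transpose_mul assms(1))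
  also have "\<dots> = mat 1" using matrix_inv_right[OF inv] by (simp add: transpose_mat)
  finally have "matrix_inv A = transpose (matrix_inv A)" by (rule matrix_inv_unique)
  then have "matrix_inv A $ i $ j = transpose (matrix_inv A) $ i $ j" by (rule arg_cong[where f="\<lambda>B. B $ i $ j"])
  also have "\<dots> = matrix_inv A $ j $ i" by (simp only: transpose_def vec_lambda_beta)
  finally show ?thesis .
qed

text \<open>The transformation law of the inverse metric under a change of coordinates with Jacobian matrix \<open>J\<close>.\<close>

lemma matrix_inv_congruence:
  fixes G G' J :: "real^'n^'n"
  assumes "G = transpose J ** G' ** J" "det G \<noteq> 0"
  shows "J ** matrix_inv G ** transpose J = matrix_inv G'"
proof -
  have inv: "invertible G" using assms(2) by (simp add: invertible_det_nz)
  have "(transpose J ** G') ** (J ** matrix_inv G) = mat 1"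
    using matrix_inv_right[OF inv] by (subst (asm) assms(1)) (simp add: matrix_mul_assoc)
  then have "(J ** matrix_inv G) ** (transpose J ** G') = mat 1" using matrix_left_right_inverse by blast
  then have "(J ** matrix_inv G ** transpose J) ** G' = mat 1" by (simp add: matrix_mul_assoc)
  then show ?thesis by (rule matrix_inv_unique[symmetric])
qed

text \<open>
  With \<open>H\<close> the inverse Gram matrix, this is the inner product of the differentials with coordinates \<open>a\<close> and \<open>b\<close>,
  extended to complex values bilinearly, not sesquilinearly.
\<close>

definition grad_form :: "real^'m^'m \<Rightarrow> ('m \<Rightarrow> complex) \<Rightarrow> ('m \<Rightarrow> complex) \<Rightarrow> complex" where
  "grad_form H a b = (\<Sum>i\<in>UNIV. \<Sum>j\<in>UNIV. H $ i $ j *\<^sub>R (a i * b j))"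

lemma grad_form_congruence:
  fixes H J :: "real^'m^'m"
  shows "grad_form H (\<lambda>i. \<Sum>k\<in>UNIV. J $ k $ i *\<^sub>R a k) (\<lambda>j. \<Sum>l\<in>UNIV. J $ l $ j *\<^sub>R b l)
    = grad_form (J ** H ** transpose J) a b"
proof -
  have "grad_form H (\<lambda>i. \<Sum>k\<in>UNIV. J $ k $ i *\<^sub>R a k) (\<lambda>j. \<Sum>l\<in>UNIV. J $ l $ j *\<^sub>R b l)
    = (\<Sum>i\<in>UNIV. \<Sum>j\<in>UNIV. \<Sum>k\<in>UNIV. \<Sum>l\<in>UNIV. (J $ k $ i * H $ i $ j * J $ l $ j) *\<^sub>R (a k * b l))"
    by (simp add: grad_form_def sum_product scaleR_sum_right mult_ac)
  also have "\<dots> = (\<Sum>k\<in>UNIV. \<Sum>l\<in>UNIV. \<Sum>i\<in>UNIV. \<Sum>j\<in>UNIV. (J $ k $ i * H $ i $ j * J $ l $ j) *\<^sub>R (a k * b l))"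
  proof -
    have "(\<Sum>i\<in>UNIV. \<Sum>j\<in>UNIV. \<Sum>k\<in>UNIV. \<Sum>l\<in>UNIV. f i j k l) = (\<Sum>k\<in>UNIV. \<Sum>l\<in>UNIV. \<Sum>i\<in>UNIV. \<Sum>j\<in>UNIV. f i j k l)"
      for f :: "'m \<Rightarrow> 'm \<Rightarrow> 'm \<Rightarrow> 'm \<Rightarrow> complex"
    proof -
      have "(\<Sum>i\<in>UNIV. \<Sum>j\<in>UNIV. \<Sum>k\<in>UNIV. \<Sum>l\<in>UNIV. f i j k l) = (\<Sum>(i,j)\<in>UNIV\<times>UNIV. \<Sum>(k,l)\<in>UNIV\<times>UNIV. f i j k l)"
        by (simp only: sum.cartesian_product[of _ UNIV UNIV, symmetric])
      also have "\<dots> = (\<Sum>(k,l)\<in>UNIV\<times>UNIV. \<Sum>(i,j)\<in>UNIV\<times>UNIV. f i j k l)"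
        unfolding case_prod_unfold by (rule sum.swap)
      also have "\<dots> = (\<Sum>k\<in>UNIV. \<Sum>l\<in>UNIV. \<Sum>i\<in>UNIV. \<Sum>j\<in>UNIV. f i j k l)"
        by (simp only: sum.cartesian_product[of _ UNIV UNIV, symmetric])
      finally show ?thesis .
    qed
    then show ?thesis .
  qed
  also have "\<dots> = grad_form (J ** H ** transpose J) a b"
  proof -
    have "(J ** H ** transpose J) $ k $ l = (\<Sum>i\<in>UNIV. \<Sum>j\<in>UNIV. J $ k $ i * H $ i $ j * J $ l $ j)" for k l
      by (subst sum.swap) (simp add: matrix_matrix_mult_def transpose_def sum_distrib_right)
    then show ?thesis by (simp add: grad_form_def scaleR_sum_left)
  qed
  finally show ?thesis .
qed

lemma grad_form_sym:
  assumes "\<And>i j. H $ i $ j = H $ j $ i"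
  shows "grad_form H a b = grad_form H b a"
proof -
  have "(\<Sum>i\<in>UNIV. \<Sum>j\<in>UNIV. H $ i $ j *\<^sub>R (a i * b j)) = (\<Sum>j\<in>UNIV. \<Sum>i\<in>UNIV. H $ i $ j *\<^sub>R (a i * b j))"
    by (rule sum.swap)
  also have "\<dots> = (\<Sum>j\<in>UNIV. \<Sum>i\<in>UNIV. H $ j $ i *\<^sub>R (b j * a i))"
    by (intro sum.cong refl) (metis assms mult.commute)
  finally show ?thesis by (simp only: grad_form_def)
qed

lemma grad_form_cnj: "cnj (grad_form H a b) = grad_form H (\<lambda>i. cnj (a i)) (\<lambda>i. cnj (b i))"
  by (simp add: grad_form_def)

lemma partial_deriv_bounded_linear:
  assumes "bounded_linear L" "f differentiable (at x)"
  shows "partial_deriv i (\<lambda>x. L (f x)) x = L (partial_deriv i f x)"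
proof -
  have "(f has_derivative frechet_derivative f (at x)) (at x)" using assms(2) by (simp only: frechet_derivative_works)
  from frechet_derivative_at[OF bounded_linear.has_derivative[OF assms(1) this]]
  show ?thesis unfolding partial_deriv_def by metis
qed

lemma partial_deriv_mult:
  fixes f g :: "real^'m \<Rightarrow> complex"
  assumes "f differentiable (at x)" "g differentiable (at x)"
  shows "partial_deriv i (\<lambda>x. f x * g x) x = f x * partial_deriv i g x + partial_deriv i f x * g x"
proof -
  have "(f has_derivative frechet_derivative f (at x)) (at x)" "(g has_derivative frechet_derivative g (at x)) (at x)"
    using assms by (simp_all only: frechet_derivative_works)
  from frechet_derivative_at[OF has_derivative_mult[OF this]]
  show ?thesis unfolding partial_deriv_def by metis
qed

lemma partial_deriv_diff:
  fixes f g :: "real^'m \<Rightarrow> complex"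
  assumes "f differentiable (at x)" "g differentiable (at x)"
  shows "partial_deriv i (\<lambda>x. f x - g x) x = partial_deriv i f x - partial_deriv i g x"
proof -
  have "(f has_derivative frechet_derivative f (at x)) (at x)" "(g has_derivative frechet_derivative g (at x)) (at x)"
    using assms by (simp_all only: frechet_derivative_works)
  from frechet_derivative_at[OF has_derivative_diff[OF this]]
  show ?thesis unfolding partial_deriv_def by metis
qed

lemma partial_deriv_sum:
  fixes f :: "'i \<Rightarrow> real^'m \<Rightarrow> complex"
  assumes "\<And>k. k \<in> I \<Longrightarrow> f k differentiable (at x)"
  shows "partial_deriv i (\<lambda>x. \<Sum>k\<in>I. f k x) x = (\<Sum>k\<in>I. partial_deriv i (f k) x)"
proof -
  have "\<And>k. k \<in> I \<Longrightarrow> (f k has_derivative frechet_derivative (f k) (at x)) (at x)"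
    using assms by (simp only: frechet_derivative_works)
  from frechet_derivative_at[OF has_derivative_sum[of I f, OF this]]
  show ?thesis unfolding partial_deriv_def by metis
qed

lemma partial_deriv_cong_open:
  assumes "open S" "x \<in> S" "\<And>y. y \<in> S \<Longrightarrow> f y = g y" "f differentiable (at x)"
  shows "partial_deriv i f x = partial_deriv i g x"
  unfolding partial_deriv_def using frechet_derivative_transform_within_open[OF assms(4,1,2,3)] by simp

lemma partial_deriv_const: "partial_deriv i (\<lambda>x. c) x = 0"
  by (simp add: partial_deriv_def)

lemma C1_on_differentiable: "C1_on S f \<Longrightarrow> x \<in> S \<Longrightarrow> f differentiable (at x)"
  by (simp add: C1_on_def)

lemma C1_on_partial_cont: "C1_on S f \<Longrightarrow> continuous_on S (partial_deriv i f)"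
  unfolding partial_deriv_def[abs_def] by (rule C1_on_cont_deriv)

lemma C1_on_partial_compose:
  fixes \<tau> :: "real^'m \<Rightarrow> real^'m" and F :: "real^'m \<Rightarrow> complex"
  assumes "\<tau> differentiable (at x)" "F differentiable (at (\<tau> x))"
  shows "partial_deriv i (\<lambda>x. F (\<tau> x)) x = (\<Sum>k\<in>UNIV. matrix (frechet_derivative \<tau> (at x)) $ k $ i *\<^sub>R partial_deriv k F (\<tau> x))"
proof -
  define D where "D = frechet_derivative F (at (\<tau> x))"
  define t where "t = frechet_derivative \<tau> (at x)"
  have d: "(\<tau> has_derivative t) (at x)" "(F has_derivative D) (at (\<tau> x))"
    using assms by (simp_all only: frechet_derivative_works D_def t_def)
  from frechet_derivative_at[OF has_derivative_compose[OF d]]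
  have "partial_deriv i (\<lambda>x. F (\<tau> x)) x = D (t (axis i 1))" unfolding partial_deriv_def by metis
  also have "t (axis i 1) = (\<Sum>k\<in>UNIV. (matrix t $ k $ i) *\<^sub>R axis k 1)"
    using basis_expansion[of "t (axis i 1)"] by (simp add: matrix_def scalar_mult_eq_scaleR)
  also have "D \<dots> = (\<Sum>k\<in>UNIV. matrix t $ k $ i *\<^sub>R D (axis k 1))"
    using d(2) by (simp add: linear_sum linear_scale has_derivative_linear)
  finally show ?thesis by (simp add: D_def t_def partial_deriv_def)
qed

section \<open>Green's formula on a closed Riemannian manifold\<close>

locale closed_manifold =
  fixes Y :: "('y::{t2_space, second_countable_topology}, 'm::finite) riem_manifold"
  assumes closed: "closed_riemannian_manifold Y"
begin

lemma compact_space: "compact (UNIV :: 'y set)"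
  and atlas: "smooth_atlas (charts Y)"
  and metric: "riemannian_metric (charts Y) (gram Y)"
  and volume: "riemannian_volume (charts Y) (gram Y) (vol Y)"
  using closed by (auto simp: closed_riemannian_manifold_def)

lemma sets_vol [measurable_cong, simp]: "sets (vol Y) = sets borel"
  using volume by (simp add: riemannian_volume_def)

lemma space_vol [simp]: "space (vol Y) = UNIV"
  using sets_eq_imp_space_eq[OF sets_vol] by simp

lemma charts_cover: "\<exists>c\<in>charts Y. y \<in> fst c"
proof -
  have "(\<Union>c\<in>charts Y. fst c) = UNIV" using atlas unfolding smooth_atlas_def by blast
  then have "y \<in> (\<Union>c\<in>charts Y. fst c)" by simp
  then show ?thesis by blast
qed

lemma
  assumes "c \<in> charts Y"
  shows chart_open: "open (fst c)" "open (coord_image c)"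
    and chart_homeo: "homeomorphism (fst c) (coord_image c) (snd c) (coord_inv c)"
  using atlas assms unfolding smooth_atlas_def by blast+

lemma
  assumes "c \<in> charts Y"
  shows chart_inv: "\<And>y. y \<in> fst c \<Longrightarrow> coord_inv c (snd c y) = y" "\<And>x. x \<in> coord_image c \<Longrightarrow> snd c (coord_inv c x) = x"
    and chart_mem: "\<And>y. y \<in> fst c \<Longrightarrow> snd c y \<in> coord_image c" "\<And>x. x \<in> coord_image c \<Longrightarrow> coord_inv c x \<in> fst c"
    and chart_cont: "continuous_on (fst c) (snd c)" "continuous_on (coord_image c) (coord_inv c)"
  using chart_homeo[OF assms] by (auto simp: homeomorphism_def)

definition wt where "wt c x = sqrt (det (gram Y c (coord_inv c x)))"
definition Hinv where "Hinv c x = matrix_inv (gram Y c (coord_inv c x))"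
text \<open>  The components \<open>sqrt |h| h^ij \<partial>_j f\<close>: the coordinate divergence of this field is \<open>- sqrt |h|\<close> times the Laplacian.\<close>

definition flux where "flux c f i x = wt c x *\<^sub>R (\<Sum>j\<in>UNIV. Hinv c x $ i $ j *\<^sub>R partial_deriv j (f \<circ> coord_inv c) x)"

lemma laplacian_flux:
  "laplacian_in_chart Y c f y = - ((\<Sum>i\<in>UNIV. partial_deriv i (flux c f i) (snd c y)) /\<^sub>R wt c (snd c y))"
  by (simp add: laplacian_in_chart_def flux_def[abs_def] wt_def[abs_def] Hinv_def Let_def)

lemma
  assumes c: "c \<in> charts Y" and x: "x \<in> coord_image c"
  shows det_gram_pos: "det (gram Y c (coord_inv c x)) > 0" and gram_sym: "transpose (gram Y c (coord_inv c x)) = gram Y c (coord_inv c x)"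
proof -
  have "coord_inv c x \<in> fst c" by (rule chart_mem(2)[OF c x])
  then have "transpose (gram Y c (coord_inv c x)) = gram Y c (coord_inv c x) \<and> (\<forall>v. v \<noteq> 0 \<longrightarrow> v \<bullet> (gram Y c (coord_inv c x) *v v) > 0)"
    using metric c unfolding riemannian_metric_def by blast
  then show "det (gram Y c (coord_inv c x)) > 0" "transpose (gram Y c (coord_inv c x)) = gram Y c (coord_inv c x)"
    by (blast intro: posdef_det_pos)+
qed

lemma wt_pos: "c \<in> charts Y \<Longrightarrow> x \<in> coord_image c \<Longrightarrow> wt c x > 0"
  by (simp add: wt_def det_gram_pos)

lemma Hinv_sym: "c \<in> charts Y \<Longrightarrow> x \<in> coord_image c \<Longrightarrow> Hinv c x $ i $ j = Hinv c x $ j $ i"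
  unfolding Hinv_def using det_gram_pos[of c x] by (intro matrix_inv_symmetric gram_sym) auto

lemma C1_gram: assumes c: "c \<in> charts Y" shows "C1_on (coord_image c) (\<lambda>x. gram Y c (coord_inv c x) $ i $ j)"
proof -
  have "smooth_on (coord_image c) (\<lambda>x. gram Y c (coord_inv c x))"
    using metric c unfolding riemannian_metric_def by blast
  then have "C1_on (coord_image c) (\<lambda>x. gram Y c (coord_inv c x))" by (rule smooth_on_imp_C1[OF _ chart_open(2)[OF c]])
  then have "C1_on (coord_image c) (\<lambda>x. gram Y c (coord_inv c x) $ i)" by (rule C1_on_linear[OF bounded_linear_vec_nth])
  then show ?thesis by (rule C1_on_linear[OF bounded_linear_vec_nth])
qed

lemma C1_wt: assumes c: "c \<in> charts Y" shows "C1_on (coord_image c) (wt c)"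
  unfolding wt_def[abs_def] by (intro C1_on_sqrt C1_on_det C1_gram det_gram_pos c)

lemma C1_Hinv: assumes c: "c \<in> charts Y" shows "C1_on (coord_image c) (\<lambda>x. Hinv c x $ i $ j)"
  unfolding Hinv_def[abs_def]
proof (intro C1_on_matrix_inv C1_gram c chart_open(2))
  show "det (gram Y c (coord_inv c x)) \<noteq> 0" if "x \<in> coord_image c" for x using det_gram_pos[OF c that] by simp
qed

lemma
  assumes f: "smooth_map Y (f :: 'y \<Rightarrow> complex)" and c: "c \<in> charts Y"
  shows C1_smooth_map: "C1_on (coord_image c) (f \<circ> coord_inv c)"
    and C1_smooth_map_partial: "C1_on (coord_image c) (partial_deriv j (f \<circ> coord_inv c))"
    and C1_flux: "C1_on (coord_image c) (flux c f i)"
proof -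
  have s: "smooth_on (coord_image c) (f \<circ> coord_inv c)" using f c by (auto simp: smooth_map_def)
  note o = chart_open(2)[OF c]
  show "C1_on (coord_image c) (f \<circ> coord_inv c)" by (rule smooth_on_imp_C1[OF s o])
  show p: "C1_on (coord_image c) (partial_deriv j (f \<circ> coord_inv c))" for j by (rule smooth_on_imp_C1_partial[OF s o])
  show "C1_on (coord_image c) (flux c f i)"
    unfolding flux_def[abs_def] by (intro C1_on_scaleR C1_on_sum C1_wt C1_Hinv c p)
qed

lemma transition_open: assumes c: "c \<in> charts Y" and U: "open U"
  shows "open (snd c ` (fst c \<inter> U))"
proof -
  have "snd c ` (fst c \<inter> U) = coord_image c \<inter> coord_inv c -` U"
    using chart_inv[OF c] chart_mem[OF c] by (force simp: image_iff)
  moreover have "open (coord_image c \<inter> coord_inv c -` U)"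
    by (rule continuous_open_preimage[OF chart_cont(2)[OF c] chart_open(2)[OF c] U])
  ultimately show ?thesis by simp
qed

lemma transition_C1: assumes "c \<in> charts Y" "c' \<in> charts Y"
  shows "C1_on (snd c ` (fst c \<inter> fst c')) (snd c' \<circ> coord_inv c)"
proof -
  have "smooth_on (snd c ` (fst c \<inter> fst c')) (snd c' \<circ> coord_inv c)"
    using atlas assms unfolding smooth_atlas_def by blast
  then show ?thesis by (rule smooth_on_imp_C1[OF _ transition_open[OF assms(1) chart_open(1)[OF assms(2)]]])
qed

definition grad_in_chart where
  "grad_in_chart c f g y = grad_form (Hinv c (snd c y)) (\<lambda>i. partial_deriv i (f \<circ> coord_inv c) (snd c y))
     (\<lambda>i. partial_deriv i (g \<circ> coord_inv c) (snd c y))"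

lemma partial_deriv_change_chart:
  fixes f :: "'y \<Rightarrow> complex"
  assumes c: "c \<in> charts Y" "c' \<in> charts Y" and y: "y \<in> fst c" "y \<in> fst c'"
    and f: "(f \<circ> coord_inv c') differentiable (at (snd c' y))"
  defines "J \<equiv> matrix (frechet_derivative (snd c' \<circ> coord_inv c) (at (snd c y)))"
  shows "partial_deriv i (f \<circ> coord_inv c) (snd c y) = (\<Sum>k\<in>UNIV. J $ k $ i *\<^sub>R partial_deriv k (f \<circ> coord_inv c') (snd c' y))"
proof -
  define S where "S = snd c ` (fst c \<inter> fst c')"
  define t where "t = snd c' \<circ> coord_inv c"
  have S: "open S" "snd c y \<in> S" using transition_open[OF c(1) chart_open(1)[OF c(2)]] y by (auto simp: S_def)
  have t: "t (snd c y) = snd c' y" using chart_inv(1)[OF c(1) y(1)] by (simp add: t_def)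
  have dt: "t differentiable (at (snd c y))"
    using C1_on_differentiable[OF transition_C1[OF c]] S by (simp add: S_def t_def)
  have f': "(f \<circ> coord_inv c') differentiable (at (t (snd c y)))" using f t by simp
  have e: "(f \<circ> coord_inv c') (t x) = (f \<circ> coord_inv c) x" if "x \<in> S" for x
    using that chart_inv[OF c(1)] chart_inv[OF c(2)] by (auto simp: S_def t_def)
  have d: "(\<lambda>x. (f \<circ> coord_inv c') (t x)) differentiable (at (snd c y))"
    using differentiable_chain_at[OF dt f'] by (simp add: o_def)
  have "partial_deriv i (f \<circ> coord_inv c) (snd c y) = partial_deriv i (\<lambda>x. (f \<circ> coord_inv c') (t x)) (snd c y)"
    by (rule partial_deriv_cong_open[OF S e d, symmetric])
  also have "\<dots> = (\<Sum>k\<in>UNIV. matrix (frechet_derivative t (at (snd c y))) $ k $ i *\<^sub>R partial_deriv k (f \<circ> coord_inv c') (t (snd c y)))"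
    by (rule C1_on_partial_compose[OF dt f'])
  finally show ?thesis unfolding t by (simp add: t_def J_def)
qed

text \<open>
  Differentials transform by the transposed Jacobian and the inverse metric by \<open>matrix_inv_congruence\<close>; the two
  changes cancel.
\<close>

lemma grad_change_chart:
  fixes f g :: "'y \<Rightarrow> complex"
  assumes c: "c \<in> charts Y" "c' \<in> charts Y" and y: "y \<in> fst c" "y \<in> fst c'"
    and f: "(f \<circ> coord_inv c') differentiable (at (snd c' y))" and g: "(g \<circ> coord_inv c') differentiable (at (snd c' y))"
  shows "grad_in_chart c f g y = grad_in_chart c' f g y"
proof -
  define J where "J = matrix (frechet_derivative (snd c' \<circ> coord_inv c) (at (snd c y)))"
  have "\<forall>c\<in>charts Y. \<forall>c'\<in>charts Y. \<forall>y\<in>fst c \<inter> fst c'.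
        let J = matrix (frechet_derivative (snd c' \<circ> coord_inv c) (at (snd c y)))
        in gram Y c y = transpose J ** gram Y c' y ** J"
    using metric unfolding riemannian_metric_def by blast
  then have G: "gram Y c y = transpose J ** gram Y c' y ** J"
    using c y unfolding J_def Let_def by blast
  have nz: "det (gram Y c y) \<noteq> 0"
    using det_gram_pos[OF c(1) chart_mem(1)[OF c(1) y(1)]] chart_inv(1)[OF c(1) y(1)] by simp
  have H: "J ** Hinv c (snd c y) ** transpose J = Hinv c' (snd c' y)"
    using matrix_inv_congruence[OF G nz] chart_inv(1)[OF c(1) y(1)] chart_inv(1)[OF c(2) y(2)] by (simp add: Hinv_def)
  show ?thesis
    unfolding grad_in_chart_def partial_deriv_change_chart[OF c y f] partial_deriv_change_chart[OF c y g] J_def[symmetric]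
      grad_form_congruence H by (rule refl)
qed

text \<open>A total extension of the inverse coordinate map, so that it can push measures forward.\<close>

definition cinv where "cinv c x = (if x \<in> coord_image c then coord_inv c x else undefined)"

lemma measurable_cinv [measurable]: assumes c: "c \<in> charts Y" shows "cinv c \<in> borel_measurable borel"
  unfolding cinv_def[abs_def]
  using borel_measurable_continuous_on_if[OF borel_open[OF chart_open(2)[OF c]] chart_cont(2)[OF c], of "\<lambda>_. undefined"]
  by simp

lemma measurable_wt [measurable]: assumes c: "c \<in> charts Y" shows "(\<lambda>x. indicator (coord_image c) x * wt c x) \<in> borel_measurable borel"
  using borel_measurable_continuous_on_indicator[OF borel_open[OF chart_open(2)[OF c]] C1_on_cont[OF C1_wt[OF c]]]
  by simp

lemma vol_chart: assumes c: "c \<in> charts Y"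
  shows "density (vol Y) (indicator (fst c)) =
    distr (density lborel (\<lambda>x. ennreal (indicator (coord_image c) x * wt c x))) (vol Y) (cinv c)"
proof (rule measure_eqI)
  note [measurable] = measurable_cinv[OF c] measurable_wt[OF c] borel_open[OF chart_open(1)[OF c]] borel_open[OF chart_open(2)[OF c]]
  show "sets (density (vol Y) (indicator (fst c))) = sets (distr (density lborel (\<lambda>x. ennreal (indicator (coord_image c) x * wt c x))) (vol Y) (cinv c))"
    by simp
  fix A assume "A \<in> sets (density (vol Y) (indicator (fst c)))"
  then have A[measurable]: "A \<in> sets borel" by simp
  have "emeasure (density (vol Y) (indicator (fst c))) A = emeasure (vol Y) (fst c \<inter> A)"
    by (simp add: emeasure_density indicator_inter_arith[symmetric])
  also have "\<dots> = (\<integral>\<^sup>+x\<in>snd c ` (fst c \<inter> A). ennreal (sqrt (det (gram Y c (coord_inv c x)))) \<partial>lborel)"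
  proof -
    have "\<forall>B\<in>sets borel. B \<subseteq> fst c \<longrightarrow> emeasure (vol Y) B = (\<integral>\<^sup>+x\<in>snd c ` B. ennreal (sqrt (det (gram Y c (coord_inv c x)))) \<partial>lborel)"
      using conjunct2[OF volume[unfolded riemannian_volume_def]] c by (rule bspec)
    then show ?thesis by (elim ballE[of _ _ "fst c \<inter> A"] impE) simp_all
  qed
  also have "\<dots> = (\<integral>\<^sup>+x. ennreal (indicator (coord_image c) x * wt c x) * indicator (cinv c -` A) x \<partial>lborel)"
  proof (intro nn_integral_cong)
    fix x
    have "x \<in> snd c ` (fst c \<inter> A) \<longleftrightarrow> x \<in> coord_image c \<and> cinv c x \<in> A"
    proof
      assume "x \<in> snd c ` (fst c \<inter> A)"
      then obtain y where y: "y \<in> fst c" "y \<in> A" "x = snd c y" by blast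
      then show "x \<in> coord_image c \<and> cinv c x \<in> A"
        using chart_mem(1)[OF c y(1)] chart_inv(1)[OF c y(1)] by (simp add: cinv_def)
    next
      assume x: "x \<in> coord_image c \<and> cinv c x \<in> A"
      then have "coord_inv c x \<in> fst c \<inter> A" "x = snd c (coord_inv c x)"
        using chart_mem(2)[OF c, of x] chart_inv(2)[OF c, of x] by (auto simp: cinv_def)
      then show "x \<in> snd c ` (fst c \<inter> A)" by blast
    qed
    then show "ennreal (sqrt (det (gram Y c (coord_inv c x)))) * indicator (snd c ` (fst c \<inter> A)) x =
         ennreal (indicator (coord_image c) x * wt c x) * indicator (cinv c -` A) x"
      by (auto simp: indicator_def wt_def)
  qed
  also have "\<dots> = emeasure (density lborel (\<lambda>x. ennreal (indicator (coord_image c) x * wt c x))) (cinv c -` A)"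
    using measurable_sets_borel[OF measurable_cinv[OF c] A] by (subst emeasure_density) simp_all
  also have "\<dots> = emeasure (distr (density lborel (\<lambda>x. ennreal (indicator (coord_image c) x * wt c x))) (vol Y) (cinv c)) A"
    by (subst emeasure_distr) simp_all
  finally show "emeasure (density (vol Y) (indicator (fst c))) A =
     emeasure (distr (density lborel (\<lambda>x. ennreal (indicator (coord_image c) x * wt c x))) (vol Y) (cinv c)) A" .
qed

lemma wt_nonneg: "c \<in> charts Y \<Longrightarrow> indicator (coord_image c) x * wt c x \<ge> 0"
  using wt_pos[of c x] by (auto simp: indicator_def)

text \<open>
  The Riemannian volume is prescribed on subsets of a chart domain only, so integrals are computed in coordinates for
  functions that vanish outside the domain.
\<close>

lemma chart_integral:
  fixes g :: "'y \<Rightarrow> complex"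
  assumes c: "c \<in> charts Y" and g[measurable]: "g \<in> borel_measurable borel" and g0: "\<And>y. y \<notin> fst c \<Longrightarrow> g y = 0"
  shows "integrable (vol Y) g \<longleftrightarrow> integrable lborel (\<lambda>x. (indicator (coord_image c) x * wt c x) *\<^sub>R g (coord_inv c x))" (is ?A)
    and "(\<integral>y. g y \<partial>vol Y) = (\<integral>x. (indicator (coord_image c) x * wt c x) *\<^sub>R g (coord_inv c x) \<partial>lborel)" (is ?B)
proof -
  note [measurable] = measurable_cinv[OF c] measurable_wt[OF c] borel_open[OF chart_open(1)[OF c]] borel_open[OF chart_open(2)[OF c]]
  have 1: "indicator (fst c) y *\<^sub>R g y = g y" for y using g0 by (auto simp: indicator_def)
  have 2: "(indicator (coord_image c) x * wt c x) *\<^sub>R g (cinv c x) = (indicator (coord_image c) x * wt c x) *\<^sub>R g (coord_inv c x)" for x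
    by (auto simp: indicator_def cinv_def)
  have ind: "(indicator (fst c) :: 'y \<Rightarrow> ennreal) = (\<lambda>y. ennreal (indicator (fst c) y))"
    by (auto simp: indicator_def fun_eq_iff)
  have d1: "integrable (density (vol Y) (indicator (fst c))) g \<longleftrightarrow> integrable (vol Y) g"
    unfolding ind by (subst integrable_density) (auto simp: 1)
  have d2: "integral\<^sup>L (density (vol Y) (indicator (fst c))) g = integral\<^sup>L (vol Y) g"
    unfolding ind by (subst integral_density) (auto simp: 1)
  have e1: "integrable (distr (density lborel (\<lambda>x. ennreal (indicator (coord_image c) x * wt c x))) (vol Y) (cinv c)) g
     \<longleftrightarrow> integrable lborel (\<lambda>x. (indicator (coord_image c) x * wt c x) *\<^sub>R g (coord_inv c x))"
    by (subst integrable_distr_eq) (auto simp: integrable_density wt_nonneg[OF c] 2)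
  have e2: "integral\<^sup>L (distr (density lborel (\<lambda>x. ennreal (indicator (coord_image c) x * wt c x))) (vol Y) (cinv c)) g
     = (\<integral>x. (indicator (coord_image c) x * wt c x) *\<^sub>R g (coord_inv c x) \<partial>lborel)"
    by (subst integral_distr) (auto simp: integral_density wt_nonneg[OF c] 2)
  show ?A using d1 e1 unfolding vol_chart[OF c] by simp
  show ?B using d2 e2 unfolding vol_chart[OF c] by simp
qed

end

context closed_manifold begin

definition C1_map :: "('y \<Rightarrow> complex) \<Rightarrow> bool" where
  "C1_map f \<longleftrightarrow> (\<forall>c\<in>charts Y. C1_on (coord_image c) (f \<circ> coord_inv c))"

lemma smooth_imp_C1_map: "smooth_map Y f \<Longrightarrow> C1_map f"
  unfolding C1_map_def by (blast intro: C1_smooth_map)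

lemma C1_map_D: "C1_map f \<Longrightarrow> c \<in> charts Y \<Longrightarrow> C1_on (coord_image c) (f \<circ> coord_inv c)"
  unfolding C1_map_def by blast

lemma C1_map_continuous: assumes "C1_map f" shows "continuous_on UNIV f"
proof (rule continuous_at_imp_continuous_on, rule ballI)
  fix y
  obtain c where c: "c \<in> charts Y" "y \<in> fst c" using charts_cover by blast
  have "continuous_on (fst c) (\<lambda>y. (f \<circ> coord_inv c) (snd c y))"
    by (rule continuous_on_compose2[OF C1_on_cont[OF C1_map_D[OF assms c(1)]] chart_cont(1)[OF c(1)]])
       (use chart_mem(1)[OF c(1)] in blast)
  then have "continuous_on (fst c) f"
    by (rule continuous_on_eq) (simp add: chart_inv(1)[OF c(1)])
  then show "isCont f y" using c(2) chart_open(1)[OF c(1)] by (simp add: continuous_on_eq_continuous_at)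
qed

lemma sum_flux: "(\<Sum>i\<in>UNIV. a i * flux c f i x) = wt c x *\<^sub>R grad_form (Hinv c x) a (\<lambda>j. partial_deriv j (f \<circ> coord_inv c) x)"
  by (simp add: flux_def grad_form_def scaleR_sum_right sum_distrib_left mult.left_commute)

text \<open>
  The field \<open>Z = cnj v grad u - u grad (cnj v)\<close>, multiplied by the volume density, has divergence
  \<open>- (cnj v Lu - u cnj Lv)\<close> times the density: the terms with first derivatives of both functions cancel by
  the symmetry of the metric. Multiplication by the real function \<open>\<rho>\<close> adds the inner product of its gradient with
  the field.
\<close>

lemma divergence_identity:
  fixes u v \<rho> :: "'y \<Rightarrow> complex"
  assumes c: "c \<in> charts Y" and y: "y \<in> fst c"
    and u: "smooth_map Y u" "is_laplacian Y u Lu" and v: "smooth_map Y v" "is_laplacian Y v Lv"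
    and \<rho>: "C1_map \<rho>" "\<And>y. cnj (\<rho> y) = \<rho> y"
  defines "Z \<equiv> (\<lambda>i x. cnj ((v \<circ> coord_inv c) x) * flux c u i x - (u \<circ> coord_inv c) x * cnj (flux c v i x))"
  shows "(\<Sum>i\<in>UNIV. partial_deriv i (\<lambda>x. (\<rho> \<circ> coord_inv c) x * Z i x) (snd c y)) = wt c (snd c y) *\<^sub>R
     (cnj (v y) * grad_in_chart c \<rho> u y - u y * cnj (grad_in_chart c \<rho> v y) - \<rho> y * (cnj (v y) * Lu y - u y * cnj (Lv y)))"
proof -
  define x where "x = snd c y"
  have x: "x \<in> coord_image c" and iy: "coord_inv c x = y" using chart_mem(1)[OF c y] chart_inv(1)[OF c y] by (auto simp: x_def)
  define U where "U = u \<circ> coord_inv c"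
  define V where "V = v \<circ> coord_inv c"
  define R where "R = \<rho> \<circ> coord_inv c"
  define w where "w = wt c x"
  note dd = C1_on_differentiable[OF _ x]
  have dU: "U differentiable (at x)" unfolding U_def by (rule dd[OF C1_smooth_map[OF u(1) c]])
  have dV: "V differentiable (at x)" unfolding V_def by (rule dd[OF C1_smooth_map[OF v(1) c]])
  have dR: "R differentiable (at x)" unfolding R_def by (rule dd[OF C1_map_D[OF \<rho>(1) c]])
  have dXu: "flux c u i differentiable (at x)" for i by (rule dd[OF C1_flux[OF u(1) c]])
  have dXv: "flux c v i differentiable (at x)" for i by (rule dd[OF C1_flux[OF v(1) c]])
  have dcV: "(\<lambda>x. cnj (V x)) differentiable (at x)"
    unfolding V_def by (rule dd[OF C1_on_linear[OF bounded_linear_cnj C1_smooth_map[OF v(1) c]]])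
  have dcX: "(\<lambda>x. cnj (flux c v i x)) differentiable (at x)" for i
    by (rule dd[OF C1_on_linear[OF bounded_linear_cnj C1_flux[OF v(1) c]]])
  have dp1: "(\<lambda>x. cnj (V x) * flux c u i x) differentiable (at x)" for i by (intro differentiable_mult dcV dXu)
  have dp2: "(\<lambda>x. U x * cnj (flux c v i x)) differentiable (at x)" for i by (intro differentiable_mult dU dcX)
  have Z: "Z i = (\<lambda>x. cnj (V x) * flux c u i x - U x * cnj (flux c v i x))" for i by (simp add: Z_def U_def V_def)
  have dZ: "Z i differentiable (at x)" for i unfolding Z by (intro differentiable_diff dp1 dp2)
  define pu where "pu = (\<lambda>i. partial_deriv i U x)"
  define pv where "pv = (\<lambda>i. partial_deriv i V x)"
  define pr where "pr = (\<lambda>i. partial_deriv i R x)"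
  have pr: "cnj (pr i) = pr i" for i
  proof -
    have "cnj (pr i) = partial_deriv i (\<lambda>x. cnj (R x)) x"
      unfolding pr_def by (rule partial_deriv_bounded_linear[OF bounded_linear_cnj dR, symmetric])
    also have "(\<lambda>x. cnj (R x)) = R" by (simp add: R_def \<rho>(2) fun_eq_iff)
    finally show ?thesis by (simp add: pr_def)
  qed
  have pZ: "partial_deriv i (Z i) x = cnj (V x) * partial_deriv i (flux c u i) x + cnj (pv i) * flux c u i x
      - (U x * cnj (partial_deriv i (flux c v i) x) + pu i * cnj (flux c v i x))" for i
    unfolding Z partial_deriv_diff[OF dp1 dp2] partial_deriv_mult[OF dcV dXu] partial_deriv_mult[OF dU dcX]
      partial_deriv_bounded_linear[OF bounded_linear_cnj dV] partial_deriv_bounded_linear[OF bounded_linear_cnj dXv] pu_def pv_def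
    by (rule refl)
  have w0: "w > 0" unfolding w_def by (rule wt_pos[OF c x])
  have Lu: "(\<Sum>i\<in>UNIV. partial_deriv i (flux c u i) x) = - (w *\<^sub>R Lu y)"
  proof -
    have "Lu y = laplacian_in_chart Y c u y" using u(2) c y by (simp add: is_laplacian_def)
    then show ?thesis using w0 unfolding laplacian_flux x_def[symmetric] w_def[symmetric] by simp
  qed
  have Lv: "(\<Sum>i\<in>UNIV. partial_deriv i (flux c v i) x) = - (w *\<^sub>R Lv y)"
  proof -
    have "Lv y = laplacian_in_chart Y c v y" using v(2) c y by (simp add: is_laplacian_def)
    then show ?thesis using w0 unfolding laplacian_flux x_def[symmetric] w_def[symmetric] by simp
  qed
  have fu: "(\<Sum>i\<in>UNIV. a i * flux c u i x) = w *\<^sub>R grad_form (Hinv c x) a pu" for a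
    unfolding sum_flux pu_def U_def w_def by (rule refl)
  have fv: "(\<Sum>i\<in>UNIV. a i * cnj (flux c v i x)) = w *\<^sub>R grad_form (Hinv c x) a (\<lambda>i. cnj (pv i))" for a
  proof -
    have "(\<Sum>i\<in>UNIV. a i * cnj (flux c v i x)) = cnj (\<Sum>i\<in>UNIV. cnj (a i) * flux c v i x)" by simp
    also have "\<dots> = cnj (w *\<^sub>R grad_form (Hinv c x) (\<lambda>i. cnj (a i)) pv)"
      unfolding sum_flux pv_def V_def w_def by (rule refl)
    also have "\<dots> = w *\<^sub>R grad_form (Hinv c x) a (\<lambda>i. cnj (pv i))"
      by (simp add: grad_form_cnj)
    finally show ?thesis .
  qed
  have sym: "grad_form (Hinv c x) (\<lambda>i. cnj (pv i)) pu = grad_form (Hinv c x) pu (\<lambda>i. cnj (pv i))"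
    by (rule grad_form_sym) (rule Hinv_sym[OF c x])
  have sZ: "(\<Sum>i\<in>UNIV. partial_deriv i (Z i) x) = - (w *\<^sub>R (cnj (V x) * Lu y - U x * cnj (Lv y)))"
  proof -
    have "(\<Sum>i\<in>UNIV. partial_deriv i (Z i) x) = cnj (V x) * (\<Sum>i\<in>UNIV. partial_deriv i (flux c u i) x)
       + (\<Sum>i\<in>UNIV. cnj (pv i) * flux c u i x) - U x * cnj (\<Sum>i\<in>UNIV. partial_deriv i (flux c v i) x)
       - (\<Sum>i\<in>UNIV. pu i * cnj (flux c v i x))"
      unfolding pZ by (simp add: sum.distrib sum_subtractf sum_distrib_left)
    also have "\<dots> = - (w *\<^sub>R (cnj (V x) * Lu y - U x * cnj (Lv y)))"
      unfolding Lu Lv fu fv sym by (simp add: scaleR_conv_of_real algebra_simps)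
    finally show ?thesis .
  qed
  have "(\<Sum>i\<in>UNIV. partial_deriv i (\<lambda>x. R x * Z i x) x) = R x * (\<Sum>i\<in>UNIV. partial_deriv i (Z i) x) + (\<Sum>i\<in>UNIV. pr i * Z i x)"
    unfolding partial_deriv_mult[OF dR dZ] pr_def by (simp add: sum.distrib sum_distrib_left)
  also have "(\<Sum>i\<in>UNIV. pr i * Z i x) = cnj (V x) * (\<Sum>i\<in>UNIV. pr i * flux c u i x) - U x * (\<Sum>i\<in>UNIV. pr i * cnj (flux c v i x))"
    unfolding Z by (simp add: algebra_simps sum_subtractf sum_distrib_left)
  also have "\<dots> = w *\<^sub>R (cnj (V x) * grad_form (Hinv c x) pr pu - U x * cnj (grad_form (Hinv c x) pr pv))"
    unfolding fu fv grad_form_cnj pr by (simp add: scaleR_conv_of_real algebra_simps)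
  finally have "(\<Sum>i\<in>UNIV. partial_deriv i (\<lambda>x. R x * Z i x) x) = w *\<^sub>R (cnj (V x) * grad_form (Hinv c x) pr pu - U x * cnj (grad_form (Hinv c x) pr pv)
     - R x * (cnj (V x) * Lu y - U x * cnj (Lv y)))"
    unfolding sZ by (simp add: scaleR_conv_of_real algebra_simps)
  moreover have "V x = v y" "U x = u y" "R x = \<rho> y" by (simp_all add: V_def U_def R_def iy)
  moreover have "grad_form (Hinv c x) pr pu = grad_in_chart c \<rho> u y" "grad_form (Hinv c x) pr pv = grad_in_chart c \<rho> v y"
    by (simp_all only: grad_in_chart_def pr_def pu_def pv_def R_def U_def V_def x_def)
  ultimately show ?thesis unfolding R_def w_def x_def by simp
qed

text \<open>
  If \<open>\<rho>\<close> has compact support in a chart domain, the field \<open>\<rho> Z\<close> of \<open>divergence_identity\<close> extends by 0 to a \<open>C^1\<close>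
  field on the whole coordinate space, and its divergence integrates to 0.
\<close>

lemma green_local:
  fixes u v \<rho> :: "'y \<Rightarrow> complex"
  assumes c: "c \<in> charts Y"
    and u: "smooth_map Y u" "is_laplacian Y u Lu" and v: "smooth_map Y v" "is_laplacian Y v Lv"
    and \<rho>: "C1_map \<rho>" "\<And>y. cnj (\<rho> y) = \<rho> y"
    and K: "compact K" "K \<subseteq> fst c" "\<And>y. y \<notin> K \<Longrightarrow> \<rho> y = 0"
  defines "H \<equiv> (\<lambda>y. if y \<in> fst c then cnj (v y) * grad_in_chart c \<rho> u y - u y * cnj (grad_in_chart c \<rho> v y) - \<rho> y * (cnj (v y) * Lu y - u y * cnj (Lv y)) else 0)"
  shows "integrable (vol Y) H" "(\<integral>y. H y \<partial>vol Y) = 0"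
proof -
  define O' where "O' = coord_image c"
  define \<psi> where "\<psi> = coord_inv c"
  define Z where "Z = (\<lambda>i x. cnj ((v \<circ> \<psi>) x) * flux c u i x - (u \<circ> \<psi>) x * cnj (flux c v i x))"
  define P where "P = (\<lambda>i x. (\<rho> \<circ> \<psi>) x * Z i x)"
  define F where "F = (\<lambda>i x. if x \<in> O' then P i x else 0)"
  define K' where "K' = snd c ` K"
  have oO: "open O'" unfolding O'_def by (rule chart_open(2)[OF c])
  have cK': "compact K'" unfolding K'_def by (intro compact_continuous_image continuous_on_subset[OF chart_cont(1)[OF c]] K)
  have K'O: "K' \<subseteq> O'" using K(2) chart_mem(1)[OF c] by (auto simp: K'_def O'_def)
  have oK': "open (- K')" using cK' by (simp add: compact_imp_closed open_Compl)
  have cP: "C1_on O' (P i)" for i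
    unfolding P_def Z_def O'_def \<psi>_def
    by (intro C1_on_mult C1_on_diff C1_map_D[OF \<rho>(1) c] C1_on_linear[OF bounded_linear_cnj] C1_smooth_map[OF v(1) c] C1_smooth_map[OF u(1) c]
        C1_flux[OF u(1) c] C1_flux[OF v(1) c])
  have F0: "F i x = 0" if "x \<notin> K'" for i x
  proof (cases "x \<in> O'")
    case True
    have "\<psi> x \<notin> K" using that chart_inv(2)[OF c, of x] True by (auto simp: K'_def O'_def \<psi>_def image_iff)
    then show ?thesis by (simp add: F_def P_def K(3))
  qed (simp add: F_def)
  have cF: "C1_on UNIV (F i)" for i
  proof -
    have "C1_on O' (F i)" by (rule C1_on_transform[OF cP[of i] oO]) (simp add: F_def)
    moreover have "C1_on (-K') (F i)" by (rule C1_on_transform[OF C1_on_const[where c=0] oK']) (simp add: F0)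
    moreover have "O' \<union> - K' = UNIV" using K'O by blast
    ultimately show ?thesis using C1_on_Un[OF _ _ oO oK'] by metis
  qed
  have i0: "integrable lborel (partial_deriv i (F i))" "(\<integral>x. partial_deriv i (F i) x \<partial>lborel) = 0" for i
    by (rule integral_partial_zero[OF cF cK' F0]; assumption)+
  have pw: "(indicator O' x * wt c x) *\<^sub>R H (\<psi> x) = (\<Sum>i\<in>UNIV. partial_deriv i (F i) x)" for x
  proof (cases "x \<in> O'")
    case True
    have y: "\<psi> x \<in> fst c" "snd c (\<psi> x) = x" using chart_mem(2)[OF c, of x] chart_inv(2)[OF c, of x] True by (auto simp: O'_def \<psi>_def)
    have "partial_deriv i (F i) x = partial_deriv i (P i) x" for i
      by (rule partial_deriv_cong_open[OF oO True _ C1_on_differentiable[OF cF], symmetric, THEN sym]) (auto simp: F_def)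
    then have "(\<Sum>i\<in>UNIV. partial_deriv i (F i) x) = (\<Sum>i\<in>UNIV. partial_deriv i (P i) (snd c (\<psi> x)))" by (simp add: y)
    also have "\<dots> = wt c x *\<^sub>R H (\<psi> x)"
      unfolding P_def Z_def \<psi>_def
      by (subst divergence_identity[OF c y(1)[unfolded \<psi>_def] u v \<rho>]) (use y in \<open>simp add: H_def \<psi>_def\<close>)
    finally show ?thesis using True by simp
  next
    case False
    then have xK: "x \<in> - K'" using K'O by blast
    have "partial_deriv i (F i) x = partial_deriv i (\<lambda>x. 0) x" for i
      by (rule partial_deriv_cong_open[OF oK' xK _ C1_on_differentiable[OF cF]]) (auto simp: F0)
    then show ?thesis using False by (simp add: partial_deriv_const)
  qed
  have Hm: "H \<in> borel_measurable borel"
  proof -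
    have "continuous_on (fst c) (\<lambda>y. (\<Sum>i\<in>UNIV. partial_deriv i (F i) (snd c y)) /\<^sub>R wt c (snd c y))"
    proof (intro continuous_intros)
      show "continuous_on (fst c) (\<lambda>y. partial_deriv i (F i) (snd c y))" for i
        by (rule continuous_on_compose2[OF C1_on_partial_cont[OF cF] chart_cont(1)[OF c]]) auto
      show "continuous_on (fst c) (\<lambda>y. wt c (snd c y))"
        by (rule continuous_on_compose2[OF C1_on_cont[OF C1_wt[OF c]] chart_cont(1)[OF c]]) (use chart_mem(1)[OF c] in blast)
      show "\<forall>y\<in>fst c. wt c (snd c y) \<noteq> 0" using wt_pos[OF c] chart_mem(1)[OF c] by (metis less_irrefl)
    qed
    then have "(\<lambda>y. if y \<in> fst c then (\<Sum>i\<in>UNIV. partial_deriv i (F i) (snd c y)) /\<^sub>R wt c (snd c y) else 0) \<in> borel_measurable borel"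
      by (intro borel_measurable_continuous_on_if) (auto intro: borel_open chart_open(1)[OF c])
    also have "(\<lambda>y. if y \<in> fst c then (\<Sum>i\<in>UNIV. partial_deriv i (F i) (snd c y)) /\<^sub>R wt c (snd c y) else 0) = H"
    proof (rule ext)
      fix y
      show "(if y \<in> fst c then (\<Sum>i\<in>UNIV. partial_deriv i (F i) (snd c y)) /\<^sub>R wt c (snd c y) else 0) = H y"
      proof (cases "y \<in> fst c")
        case True
        have "\<psi> (snd c y) = y" "snd c y \<in> O'" using chart_inv(1)[OF c True] chart_mem(1)[OF c True] by (auto simp: \<psi>_def O'_def)
        moreover have "wt c (snd c y) > 0" using wt_pos[OF c chart_mem(1)[OF c True]] .
        ultimately show ?thesis using True pw[of "snd c y", symmetric] by simp
      qed (simp add: H_def)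
    qed
    finally show ?thesis .
  qed
  have H0: "H y = 0" if "y \<notin> fst c" for y using that by (simp add: H_def)
  have pw': "(\<lambda>x. (indicator (coord_image c) x * wt c x) *\<^sub>R H (coord_inv c x)) = (\<lambda>x. \<Sum>i\<in>UNIV. partial_deriv i (F i) x)"
    using pw by (simp add: O'_def \<psi>_def fun_eq_iff)
  show "integrable (vol Y) H"
  proof (rule chart_integral(1)[OF c Hm H0, THEN iffD2])
    show "integrable lborel (\<lambda>x. (indicator (coord_image c) x * wt c x) *\<^sub>R H (coord_inv c x))"
      unfolding pw' by (intro Bochner_Integration.integrable_sum i0)
  qed
  show "(\<integral>y. H y \<partial>vol Y) = 0"
  proof (rule trans[OF chart_integral(2)[OF c Hm H0]])
    show "(\<integral>x. (indicator (coord_image c) x * wt c x) *\<^sub>R H (coord_inv c x) \<partial>lborel) = 0"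
      unfolding pw' by (subst Bochner_Integration.integral_sum) (simp_all add: i0)
  qed
qed

end

context closed_manifold begin

text \<open>
  A bump of radius \<open>R\<close> around \<open>p\<close> in coordinates. The squared positive part of a polynomial is \<open>C^1\<close>, which is the
  regularity that one integration by parts asks of a partition of unity.
\<close>

definition cutoff :: "('y, 'm) chart \<Rightarrow> 'y \<Rightarrow> real \<Rightarrow> 'y \<Rightarrow> complex" where
  "cutoff c p R y = (if y \<in> fst c then of_real ((max 0 (R\<^sup>2 - (snd c y - snd c p) \<bullet> (snd c y - snd c p)))\<^sup>2) else 0)"

definition cutoff_data :: "'y \<Rightarrow> ('y, 'm) chart \<Rightarrow> real \<Rightarrow> 'y set \<Rightarrow> bool" where
  "cutoff_data p c R K \<longleftrightarrow> c \<in> charts Y \<and> R > 0 \<and> compact K \<and> K \<subseteq> fst c \<and> (\<forall>y. y \<notin> K \<longrightarrow> cutoff c p R y = 0)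
     \<and> C1_map (cutoff c p R) \<and> open {y \<in> fst c. snd c y \<in> ball (snd c p) R} \<and> p \<in> fst c
     \<and> emeasure (vol Y) K < \<infinity>"

lemma cutoff_exists: "\<exists>c R K. cutoff_data p c R K"
proof -
  obtain c where c: "c \<in> charts Y" "p \<in> fst c" using charts_cover by blast
  define a where "a = snd c p"
  obtain R where R: "R > 0" "cball a R \<subseteq> coord_image c"
    using chart_open(2)[OF c(1)] chart_mem(1)[OF c] by (metis a_def open_contains_cball_eq)
  define K where "K = coord_inv c ` cball a R"
  have cK: "compact K" unfolding K_def by (intro compact_continuous_image continuous_on_subset[OF chart_cont(2)[OF c(1)]] R compact_cball)
  have Kc: "K \<subseteq> fst c" unfolding K_def using R chart_mem(2)[OF c(1)] by blast
  have z: "cutoff c p R y = 0" if "y \<notin> K" for y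
  proof (cases "y \<in> fst c")
    case True
    have "snd c y \<notin> cball a R" using that chart_inv(1)[OF c(1) True] by (metis K_def imageI)
    then have "R < norm (snd c y - a)" by (simp add: dist_norm norm_minus_commute)
    then have "R\<^sup>2 < (norm (snd c y - a))\<^sup>2" using R by (intro power_strict_mono) auto
    then show ?thesis by (simp add: cutoff_def a_def power2_norm_eq_inner max_def)
  qed (simp add: cutoff_def)
  have clK: "closed K" using cK by (rule compact_imp_closed)
  have C1: "C1_map (cutoff c p R)"
    unfolding C1_map_def
  proof
    fix c' assume c': "c' \<in> charts Y"
    define S1 where "S1 = snd c' ` (fst c' \<inter> fst c)"
    define S2 where "S2 = snd c' ` (fst c' \<inter> - K)"
    define t where "t = snd c \<circ> coord_inv c'"
    have o: "open S1" "open S2" unfolding S1_def S2_def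
      by (rule transition_open[OF c' chart_open(1)[OF c(1)]], rule transition_open[OF c'], use clK in auto)
    have t: "C1_on S1 t" unfolding S1_def t_def by (rule transition_C1[OF c' c(1)])
    have "C1_on S1 (\<lambda>x. of_real ((max 0 (R\<^sup>2 - (t x - a) \<bullet> (t x - a)))\<^sup>2) :: complex)"
      by (intro C1_on_linear[OF bounded_linear_of_real] C1_on_pos_part_square C1_on_diff C1_on_inner C1_on_const t)
    then have 1: "C1_on S1 (cutoff c p R \<circ> coord_inv c')"
      by (rule C1_on_transform[OF _ o(1)]) (auto simp: S1_def cutoff_def t_def a_def chart_inv[OF c'])
    have 2: "C1_on S2 (cutoff c p R \<circ> coord_inv c')"
      by (rule C1_on_transform[OF C1_on_const[where c=0] o(2)]) (auto simp: S2_def z chart_inv[OF c'])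
    have "coord_image c' = S1 \<union> S2"
      using Kc by (auto simp: S1_def S2_def coord_image_def)
    then show "C1_on (coord_image c') (cutoff c p R \<circ> coord_inv c')" using C1_on_Un[OF 1 2 o] by simp
  qed
  have op: "open {y \<in> fst c. snd c y \<in> ball (snd c p) R}"
    using continuous_open_preimage[OF chart_cont(1)[OF c(1)] chart_open(1)[OF c(1)] open_ball] by (simp add: vimage_def Int_def)
  have fin: "emeasure (vol Y) K < \<infinity>"
  proof -
    have Kb: "K \<in> sets borel" using clK by (rule borel_closed)
    have im: "snd c ` K = cball a R"
    proof -
      have "snd c ` K = (\<lambda>x. snd c (coord_inv c x)) ` cball a R" by (simp add: K_def image_image)
      also have "\<dots> = (\<lambda>x. x) ` cball a R" using R chart_inv(2)[OF c(1)] by (intro image_cong) auto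
      finally show ?thesis by simp
    qed
    have cw: "continuous_on (cball a R) (wt c)" by (rule continuous_on_subset[OF C1_on_cont[OF C1_wt[OF c(1)]] R(2)])
    have "bounded (wt c ` cball a R)" by (rule compact_imp_bounded[OF compact_continuous_image[OF cw compact_cball]])
    then obtain B where "\<forall>x\<in>wt c ` cball a R. norm x \<le> B" unfolding bounded_iff by blast
    then have B: "\<And>x. x \<in> cball a R \<Longrightarrow> norm (wt c x) \<le> B" by blast
    have "\<forall>B\<in>sets borel. B \<subseteq> fst c \<longrightarrow> emeasure (vol Y) B = (\<integral>\<^sup>+x\<in>snd c ` B. ennreal (sqrt (det (gram Y c (coord_inv c x)))) \<partial>lborel)"
      using conjunct2[OF volume[unfolded riemannian_volume_def]] c(1) by (rule bspec)
    then have "emeasure (vol Y) K = (\<integral>\<^sup>+x\<in>snd c ` K. ennreal (sqrt (det (gram Y c (coord_inv c x)))) \<partial>lborel)"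
      using Kb Kc by blast
    also have "\<dots> \<le> (\<integral>\<^sup>+x. ennreal B * indicator (cball a R) x \<partial>lborel)"
      unfolding im
    proof (intro nn_integral_mono)
      fix x
      show "ennreal (sqrt (det (gram Y c (coord_inv c x)))) * indicator (cball a R) x \<le> ennreal B * indicator (cball a R) x"
      proof (cases "x \<in> cball a R")
        case True
        have "sqrt (det (gram Y c (coord_inv c x))) \<le> B" using B[OF True] by (simp only: wt_def real_norm_def abs_le_iff)
        then show ?thesis using True by (simp add: ennreal_leI)
      qed simp
    qed
    also have "\<dots> = ennreal B * emeasure lborel (cball a R)"
      by (subst nn_integral_cmult) (auto intro!: borel_measurable_indicator borel_closed)
    also have "\<dots> < \<infinity>" using emeasure_lborel_cball_finite[of a R] by (simp add: ennreal_mult_less_top)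
    finally show ?thesis .
  qed
  have "cutoff_data p c R K" unfolding cutoff_data_def using c R(1) cK Kc z C1 op fin by blast
  then show ?thesis by blast
qed

lemma cutoff_pos: "y \<in> fst c \<Longrightarrow> snd c y \<in> ball (snd c p) R \<Longrightarrow> R > 0 \<Longrightarrow> \<exists>r>0. cutoff c p R y = of_real r"
proof -
  assume y: "y \<in> fst c" "snd c y \<in> ball (snd c p) R" "R > 0"
  have "(norm (snd c y - snd c p))\<^sup>2 < R\<^sup>2" using y by (intro power_strict_mono) (auto simp: dist_norm norm_minus_commute)
  then have "R\<^sup>2 - (snd c y - snd c p) \<bullet> (snd c y - snd c p) > 0" by (simp add: power2_norm_eq_inner)
  then show ?thesis using y(1) by (intro exI[of _ "(max 0 (R\<^sup>2 - (snd c y - snd c p) \<bullet> (snd c y - snd c p)))\<^sup>2"]) (auto simp: cutoff_def)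
qed

lemma cutoff_nonneg: "\<exists>r\<ge>0. cutoff c p R y = of_real r"
  by (cases "y \<in> fst c") (auto simp: cutoff_def intro!: exI[of _ "(max 0 (R\<^sup>2 - (snd c y - snd c p) \<bullet> (snd c y - snd c p)))\<^sup>2"] exI[of _ "0::real"] simp del: of_real_power)

lemma C1_map_mult: "C1_map f \<Longrightarrow> C1_map g \<Longrightarrow> C1_map (\<lambda>y. f y * g y)"
  unfolding C1_map_def o_def by (intro ballI C1_on_mult) blast+

definition unity_partition :: "'y set \<Rightarrow> ('y \<Rightarrow> ('y, 'm) chart) \<Rightarrow> ('y \<Rightarrow> 'y set) \<Rightarrow> ('y \<Rightarrow> 'y \<Rightarrow> complex) \<Rightarrow> bool" where
  "unity_partition D c K \<rho> \<longleftrightarrow> finite D \<and> (\<forall>p\<in>D. c p \<in> charts Y \<and> compact (K p) \<and> K p \<subseteq> fst (c p) \<and>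
      (\<forall>y. y \<notin> K p \<longrightarrow> \<rho> p y = 0) \<and> C1_map (\<rho> p) \<and> (\<forall>y. cnj (\<rho> p y) = \<rho> p y)
      \<and> emeasure (vol Y) (K p) < \<infinity>) \<and> (\<forall>y. (\<Sum>p\<in>D. \<rho> p y) = 1)"

lemma unity_partition_D:
  assumes "unity_partition D c K \<rho>"
  shows "finite D" "\<And>p. p \<in> D \<Longrightarrow> c p \<in> charts Y" "\<And>p. p \<in> D \<Longrightarrow> compact (K p)"
    "\<And>p. p \<in> D \<Longrightarrow> K p \<subseteq> fst (c p)"  "\<And>p y. p \<in> D \<Longrightarrow> y \<notin> K p \<Longrightarrow> \<rho> p y = 0"
    "\<And>p. p \<in> D \<Longrightarrow> C1_map (\<rho> p)" "\<And>p y. p \<in> D \<Longrightarrow> cnj (\<rho> p y) = \<rho> p y" "\<And>y. (\<Sum>p\<in>D. \<rho> p y) = 1"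
    "\<And>p. p \<in> D \<Longrightarrow> emeasure (vol Y) (K p) < \<infinity>"
  using assms by (simp_all add: unity_partition_def)

text \<open>Finitely many bumps are positive somewhere at every point; they are divided by their sum.\<close>

lemma partition_of_unity: "\<exists>D c K \<rho>. unity_partition D c K \<rho>"
proof -
  have "\<forall>p. \<exists>c R K. cutoff_data p c R K" using cutoff_exists by blast
  then obtain c R K where "\<And>p. cutoff_data p (c p) (R p) (K p)" by metis
  then have *: "c p \<in> charts Y" "R p > 0" "compact (K p)" "K p \<subseteq> fst (c p)" "\<And>y. y \<notin> K p \<Longrightarrow> cutoff (c p) p (R p) y = 0"
     "C1_map (cutoff (c p) p (R p))" "open {y \<in> fst (c p). snd (c p) y \<in> ball (snd (c p) p) (R p)}" "p \<in> fst (c p)"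
     "emeasure (vol Y) (K p) < \<infinity>" for p
    unfolding cutoff_data_def by blast+
  define V where "V = (\<lambda>p. {y \<in> fst (c p). snd (c p) y \<in> ball (snd (c p) p) (R p)})"
  have oV: "open (V p)" for p using *(7) by (simp add: V_def)
  have pV: "p \<in> V p" for p using *(2)[of p] *(8)[of p] by (simp add: V_def)
  have cov: "UNIV \<subseteq> (\<Union>p\<in>UNIV. V p)" using pV by blast
  obtain D where D: "finite D" "UNIV \<subseteq> (\<Union>p\<in>D. V p)"
    by (rule compactE_image[OF compact_space oV cov])
  define \<eta> where "\<eta> = (\<lambda>p. cutoff (c p) p (R p))"
  define s where "s = (\<lambda>y. \<Sum>p\<in>D. Re (\<eta> p y))"
  have \<eta>r: "\<eta> p y = of_real (Re (\<eta> p y))" "Re (\<eta> p y) \<ge> 0" for p y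
    using cutoff_nonneg[of "c p" p "R p" y] by (auto simp: \<eta>_def)
  have s0: "s y > 0" for y
  proof -
    obtain p where p: "p \<in> D" "y \<in> V p" using D by blast
    have "\<exists>r>0. \<eta> p y = of_real r" unfolding \<eta>_def by (rule cutoff_pos) (use p *(2)[of p] in \<open>simp_all add: V_def\<close>)
    then have "Re (\<eta> p y) > 0" by auto
    also have "Re (\<eta> p y) \<le> s y" unfolding s_def using p D \<eta>r by (intro member_le_sum) auto
    finally show ?thesis .
  qed
  have C1s: "C1_map (\<lambda>y. complex_of_real (inverse (s y)))"
    unfolding C1_map_def o_def
  proof
    fix c' assume c': "c' \<in> charts Y"
    have e: "C1_on (coord_image c') (\<lambda>x. \<eta> p (coord_inv c' x))" for p
      using C1_map_D[OF *(6)[of p] c'] by (simp add: \<eta>_def o_def)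
    have "C1_on (coord_image c') (\<lambda>x. s (coord_inv c' x))"
      unfolding s_def by (intro C1_on_sum C1_on_linear[OF bounded_linear_Re] e)
    then show "C1_on (coord_image c') (\<lambda>x. complex_of_real (inverse (s (coord_inv c' x))))"
      by (intro C1_on_linear[OF bounded_linear_of_real] C1_on_inverse less_imp_neq[THEN not_sym] s0)
  qed
  define \<rho> where "\<rho> = (\<lambda>p y. \<eta> p y * complex_of_real (inverse (s y)))"
  have "C1_map (\<rho> p)" for p unfolding \<rho>_def \<eta>_def by (intro C1_map_mult C1s *(6))
  moreover have \<rho>r: "\<rho> p y = complex_of_real (Re (\<eta> p y) * inverse (s y))" for p y
    unfolding \<rho>_def using \<eta>r(1)[of p y] by (metis of_real_mult)
  moreover have "cnj (\<rho> p y) = \<rho> p y" for p y by (simp add: \<rho>r)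
  moreover have "(\<Sum>p\<in>D. \<rho> p y) = 1" for y
  proof -
    have "(\<Sum>p\<in>D. \<rho> p y) = complex_of_real (s y * inverse (s y))"
      unfolding \<rho>r s_def sum_distrib_right by simp
    also have "s y * inverse (s y) = 1" using s0[of y] by simp
    finally show ?thesis by simp
  qed
  moreover have "\<rho> p y = 0" if "y \<notin> K p" for p y using *(5)[OF that] by (simp add: \<rho>_def \<eta>_def)
  ultimately have "unity_partition D c K \<rho>" unfolding unity_partition_def using *(1,3,4,9) D(1) by simp
  then show ?thesis by blast
qed

lemma finite_measure_vol: "finite_measure (vol Y)"
proof
  obtain D c K \<rho> where P: "unity_partition D c K \<rho>" using partition_of_unity by blast
  note D = unity_partition_D[OF P]
  have "UNIV = (\<Union>p\<in>D. K p)"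
  proof (rule ccontr)
    assume "UNIV \<noteq> (\<Union>p\<in>D. K p)"
    then obtain y where "\<And>p. p \<in> D \<Longrightarrow> y \<notin> K p" by blast
    then have "(\<Sum>p\<in>D. \<rho> p y) = 0" using D(5) by (intro sum.neutral) auto
    then show False using D(8)[of y] by simp
  qed
  then have U: "space (vol Y) = (\<Union>p\<in>D. K p)" by simp
  have "K ` D \<subseteq> sets (vol Y)" using D(3) by (auto intro: borel_closed compact_imp_closed)
  then have "emeasure (vol Y) (space (vol Y)) \<le> (\<Sum>p\<in>D. emeasure (vol Y) (K p))"
    unfolding U by (rule emeasure_subadditive_finite[OF D(1)])
  also have "\<dots> < \<infinity>" using D(1,9) by (simp add: ennreal_sum_less_top)
  finally show "emeasure (vol Y) (space (vol Y)) \<noteq> \<infinity>" by simp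
qed

lemma continuous_integrable:
  fixes f :: "'y \<Rightarrow> complex"
  assumes "continuous_on UNIV f" shows "integrable (vol Y) f"
proof -
  interpret finite_measure "vol Y" by (rule finite_measure_vol)
  obtain B where "\<And>y. norm (f y) \<le> B"
    using compact_imp_bounded[OF compact_continuous_image[OF assms compact_space]] by (auto simp: bounded_iff)
  moreover have "f \<in> borel_measurable (vol Y)" using borel_measurable_continuous_onI[OF assms] by simp
  ultimately show ?thesis by (intro integrable_const_bound[of _ B]) auto
qed

text \<open>
  Sum \<open>green_local\<close> over a partition of unity. The gradient terms do not depend on the chart
  (\<open>grad_change_chart\<close>), so they can be added at each point in one chart, where the gradients of the partition
  functions add up to the gradient of the constant 1.
\<close>

theorem green:
  assumes u: "smooth_map Y u" "is_laplacian Y u Lu" and v: "smooth_map Y v" "is_laplacian Y v Lv"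
  shows "(\<integral>y. cnj (v y) * Lu y - u y * cnj (Lv y) \<partial>vol Y) = 0"
proof -
  obtain D c K \<rho> where P: "unity_partition D c K \<rho>" using partition_of_unity by blast
  note D = unity_partition_D[OF P]
  define H where "H = (\<lambda>p y. if y \<in> fst (c p) then cnj (v y) * grad_in_chart (c p) (\<rho> p) u y - u y * cnj (grad_in_chart (c p) (\<rho> p) v y) - \<rho> p y * (cnj (v y) * Lu y - u y * cnj (Lv y)) else 0)"
  have H: "integrable (vol Y) (H p)" "(\<integral>y. H p y \<partial>vol Y) = 0" if "p \<in> D" for p
    using green_local[OF D(2)[OF that] u v D(6)[OF that] D(7)[OF that] D(3)[OF that] D(4)[OF that] D(5)[OF that]]
    by (simp_all add: H_def)
  have "(\<Sum>p\<in>D. H p y) = - (cnj (v y) * Lu y - u y * cnj (Lv y))" for y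
  proof -
    obtain b where b: "b \<in> charts Y" "y \<in> fst b" using charts_cover by blast
    note x = chart_mem(1)[OF b]
    have dr: "(\<rho> p \<circ> coord_inv b) differentiable (at (snd b y))" if "p \<in> D" for p
      by (rule C1_on_differentiable[OF C1_map_D[OF D(6)[OF that] b(1)] x])
    have dF: "(f \<circ> coord_inv b) differentiable (at (snd b y))" if "smooth_map Y f" for f :: "'y \<Rightarrow> complex"
      by (rule C1_on_differentiable[OF C1_smooth_map[OF that b(1)] x])
    have Hb: "H p y = cnj (v y) * grad_in_chart b (\<rho> p) u y - u y * cnj (grad_in_chart b (\<rho> p) v y) - \<rho> p y * (cnj (v y) * Lu y - u y * cnj (Lv y))"
      if p: "p \<in> D" for p
    proof (cases "y \<in> fst (c p)")
      case True
      have "grad_in_chart (c p) (\<rho> p) f y = grad_in_chart b (\<rho> p) f y" if "smooth_map Y f" for f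
        by (rule grad_change_chart[OF D(2)[OF p] b(1) True b(2) dr[OF p] dF[OF that]])
      then show ?thesis using True u v by (simp add: H_def)
    next
      case False
      then have yK: "y \<notin> K p" using D(4)[OF p] by blast
      define S where "S = snd b ` (fst b \<inter> - K p)"
      have S: "open S" "snd b y \<in> S"
        unfolding S_def using transition_open[OF b(1) open_Compl[OF compact_imp_closed[OF D(3)[OF p]]]] b(2) yK by auto
      have "partial_deriv i (\<rho> p \<circ> coord_inv b) (snd b y) = partial_deriv i (\<lambda>_. 0) (snd b y)" for i
        by (rule partial_deriv_cong_open[OF S _ dr[OF p]]) (auto simp: S_def chart_inv[OF b(1)] D(5)[OF p])
      then have "grad_in_chart b (\<rho> p) f y = 0" for f by (simp add: grad_in_chart_def grad_form_def partial_deriv_const)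
      then show ?thesis using False D(5)[OF p yK] by (simp add: H_def)
    qed
    have g0: "(\<Sum>p\<in>D. grad_in_chart b (\<rho> p) f y) = 0" for f
    proof -
      have "(\<Sum>p\<in>D. grad_in_chart b (\<rho> p) f y) = grad_form (Hinv b (snd b y)) (\<lambda>i. \<Sum>p\<in>D. partial_deriv i (\<rho> p \<circ> coord_inv b) (snd b y))
          (\<lambda>i. partial_deriv i (f \<circ> coord_inv b) (snd b y))"
        unfolding grad_in_chart_def grad_form_def sum_distrib_right scaleR_sum_right
        by (subst sum.swap, intro sum.cong refl, subst sum.swap, rule refl)
      also have "(\<lambda>i. \<Sum>p\<in>D. partial_deriv i (\<rho> p \<circ> coord_inv b) (snd b y)) = (\<lambda>i. 0)"
      proof
        fix i
        have "(\<Sum>p\<in>D. partial_deriv i (\<rho> p \<circ> coord_inv b) (snd b y)) = partial_deriv i (\<lambda>x. \<Sum>p\<in>D. (\<rho> p \<circ> coord_inv b) x) (snd b y)"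
          by (rule partial_deriv_sum[OF dr, symmetric])
        also have "\<dots> = 0" by (simp add: D(8) partial_deriv_const)
        finally show "(\<Sum>p\<in>D. partial_deriv i (\<rho> p \<circ> coord_inv b) (snd b y)) = 0" .
      qed
      finally show ?thesis by (simp add: grad_form_def)
    qed
    have "(\<Sum>p\<in>D. H p y) = cnj (v y) * (\<Sum>p\<in>D. grad_in_chart b (\<rho> p) u y) - u y * cnj (\<Sum>p\<in>D. grad_in_chart b (\<rho> p) v y)
        - (\<Sum>p\<in>D. \<rho> p y) * (cnj (v y) * Lu y - u y * cnj (Lv y))"
      by (simp add: Hb sum_subtractf sum_distrib_left sum_distrib_right)
    then show ?thesis by (simp add: g0 D(8))
  qed
  then have "(\<integral>y. - (cnj (v y) * Lu y - u y * cnj (Lv y)) \<partial>vol Y) = (\<integral>y. (\<Sum>p\<in>D. H p y) \<partial>vol Y)" by simp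
  also have "\<dots> = (\<Sum>p\<in>D. \<integral>y. H p y \<partial>vol Y)" by (rule Bochner_Integration.integral_sum) (rule H(1))
  also have "\<dots> = 0" by (simp add: H(2))
  finally show ?thesis by (simp only: Bochner_Integration.integral_minus neg_equal_0_iff_equal)
qed

theorem eigenfunctions_orthogonal:
  assumes "u \<in> eigenspace Y V0 n a" "v \<in> eigenspace Y V0 n b" "a \<noteq> b"
  shows "L2_inner (vol Y) u v = 0"
proof -
  define k where "k = (real n - 2)\<^sup>2 / 4"
  obtain Lu where u: "smooth_map Y u" "is_laplacian Y u Lu" "\<And>y. of_real a * u y = Lu y + of_real (V0 y) * u y + of_real k * u y"
    using assms(1) by (auto simp: eigenspace_def link_op_def k_def)
  obtain Lv where v: "smooth_map Y v" "is_laplacian Y v Lv" "\<And>y. of_real b * v y = Lv y + of_real (V0 y) * v y + of_real k * v y"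
    using assms(2) by (auto simp: eigenspace_def link_op_def k_def)
  have "cnj (v y) * Lu y - u y * cnj (Lv y) = of_real (a - b) * (u y * cnj (v y))" for y
  proof -
    have l1: "Lu y = of_real a * u y - of_real (V0 y) * u y - of_real k * u y" using u(3)[of y] by simp
    have l2: "Lv y = of_real b * v y - of_real (V0 y) * v y - of_real k * v y" using v(3)[of y] by simp
    show ?thesis unfolding l1 l2 by (simp add: algebra_simps)
  qed
  then have "(\<integral>y. of_real (a - b) * (u y * cnj (v y)) \<partial>vol Y) = 0"
    using green[OF u(1,2) v(1,2)] by simp
  then have "of_real (a - b) * L2_inner (vol Y) u v = 0" by (simp only: integral_mult_right_zero L2_inner_def)
  then show ?thesis using assms(3) by simp
qed

lemma eigenspace_continuous: "u \<in> eigenspace Y V0 n a \<Longrightarrow> continuous_on UNIV u"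
  by (intro C1_map_continuous smooth_imp_C1_map) (auto simp: eigenspace_def link_op_def)

end

section \<open>Powers of extended nonnegative reals and Jensen's inequality\<close>

lemma ennreal_powr_ennreal: "x \<ge> 0 \<Longrightarrow> ennreal_powr (ennreal x) p = ennreal (x powr p)"
  by (simp add: ennreal_powr_def)

lemma ennreal_powr_top [simp]: "ennreal_powr \<top> p = \<top>"
  by (simp add: ennreal_powr_def)

lemma ennreal_powr_0 [simp]: "ennreal_powr 0 p = 0"
  by (simp add: ennreal_powr_def)

lemma ennreal_powr_mono: assumes "x \<le> y" "p \<ge> 0" shows "ennreal_powr x p \<le> ennreal_powr y p"
proof (cases y)
  case (real r)
  then obtain s where s: "x = ennreal s" "s \<ge> 0" using assms by (cases x) (auto simp: top_unique)
  show ?thesis using real s assms by (auto simp: ennreal_powr_ennreal intro!: ennreal_leI powr_mono2)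
qed simp

lemma ennreal_powr_mult: "ennreal_powr (x * y) p = ennreal_powr x p * ennreal_powr y p"
proof (cases x; cases y)
  fix r s assume "x = ennreal r" "r \<ge> 0" "y = ennreal s" "s \<ge> 0"
  then show ?thesis by (simp add: ennreal_mult[symmetric] ennreal_powr_ennreal powr_mult)
next
  fix r assume a: "x = ennreal r" "r \<ge> 0" "y = \<top>"
  show ?thesis
  proof (cases "r = 0")
    case False
    then have "ennreal (r powr p) \<noteq> 0" using a by (simp add: ennreal_eq_0_iff not_le)
    then show ?thesis using a False ennreal_powr_top[of p] by (simp add: ennreal_powr_ennreal ennreal_mult_top)
  qed (use a in simp)
next
  fix r assume a: "x = \<top>" "y = ennreal r" "r \<ge> 0"
  show ?thesis
  proof (cases "r = 0")
    case False
    then have "ennreal (r powr p) \<noteq> 0" using a by (simp add: ennreal_eq_0_iff not_le)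
    then show ?thesis using a False ennreal_powr_top[of p] by (simp add: ennreal_powr_ennreal ennreal_top_mult)
  qed (use a in simp)
next
  assume "x = \<top>" "y = \<top>"
  then show ?thesis using ennreal_powr_top[of p] by simp
qed

lemma ennreal_powr_powr: "ennreal_powr (ennreal_powr x p) r = ennreal_powr x (p * r)"
  using ennreal_powr_top[of r] ennreal_powr_top[of p] ennreal_powr_top[of "p * r"]
  by (cases x) (simp_all add: ennreal_powr_ennreal powr_powr)

lemma ennreal_powr_add: "ennreal_powr x (p + r) = ennreal_powr x p * ennreal_powr x r"
  using ennreal_powr_top[of r] ennreal_powr_top[of p] ennreal_powr_top[of "p + r"]
  by (cases x) (simp_all add: ennreal_powr_ennreal powr_add ennreal_mult)

lemma ennreal_powr_1 [simp]: "ennreal_powr x 1 = x"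
  using ennreal_powr_top[of 1] by (cases x) (simp_all add: ennreal_powr_ennreal)

lemma measurable_ennreal_powr [measurable]:
  assumes [measurable]: "f \<in> borel_measurable M"
  shows "(\<lambda>x. ennreal_powr (f x) p) \<in> borel_measurable M"
  unfolding ennreal_powr_def by measurable

text \<open>The graph of \<open>x^p\<close> lies above its tangent at \<open>a\<close>; this is Young's inequality.\<close>

lemma powr_tangent:
  fixes x a p :: real
  assumes "x \<ge> 0" "a > 0" "p > 1"
  shows "p * a powr (p - 1) * x \<le> x powr p + (p - 1) * a powr p"
proof -
  define q where "q = p / (p - 1)"
  have q: "q > 1" "1/p + 1/q = 1" "p / q = p - 1" "(p - 1) * q = p" using assms by (auto simp: q_def field_simps)
  have "x * a powr (p - 1) \<le> x powr p / p + (a powr (p - 1)) powr q / q"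
    by (rule Youngs_inequality) (use q assms in auto)
  then have "p * (x * a powr (p - 1)) \<le> p * (x powr p / p + a powr p / q)"
    unfolding powr_powr q(4) using assms by (intro mult_left_mono) auto
  also have "\<dots> = x powr p + (p / q) * a powr p" using assms by (simp add: field_simps)
  finally show ?thesis unfolding q(3) by (simp add: mult_ac)
qed

text \<open>Integrate the tangent inequality at \<open>a\<close> and choose for \<open>a\<close> the mean value of \<open>k\<close>.\<close>

lemma nn_integral_jensen:
  assumes k[measurable]: "k \<in> borel_measurable N" and B: "emeasure N (space N) = ennreal B" "B > 0" and p: "p > 1"
  shows "ennreal_powr (\<integral>\<^sup>+x. k x \<partial>N) p \<le> ennreal (B powr (p - 1)) * (\<integral>\<^sup>+x. ennreal_powr (k x) p \<partial>N)"
proof -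
  define S where "S = (\<integral>\<^sup>+x. k x \<partial>N)"
  define T where "T = (\<integral>\<^sup>+x. ennreal_powr (k x) p \<partial>N)"
  have pt: "ennreal (p * a powr (p - 1)) * k x \<le> ennreal_powr (k x) p + ennreal ((p - 1) * a powr p)" if "a > 0" for a x
  proof (cases "k x")
    case (real r)
    then show ?thesis using powr_tangent[of r a p] that p
      by (simp add: ennreal_powr_ennreal ennreal_mult[symmetric] ennreal_plus[symmetric] ennreal_leI del: ennreal_plus)
  next
    case top
    then show ?thesis using ennreal_powr_top[of p] by simp
  qed
  have main: "ennreal (p * a powr (p - 1)) * S \<le> T + ennreal ((p - 1) * a powr p * B)" if "a > 0" for a
  proof -
    have "ennreal (p * a powr (p - 1)) * S = (\<integral>\<^sup>+x. ennreal (p * a powr (p - 1)) * k x \<partial>N)"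
      unfolding S_def by (rule nn_integral_cmult[symmetric]) simp
    also have "\<dots> \<le> (\<integral>\<^sup>+x. ennreal_powr (k x) p + ennreal ((p - 1) * a powr p) \<partial>N)"
      by (intro nn_integral_mono pt that)
    also have "\<dots> = T + ennreal ((p - 1) * a powr p) * emeasure N (space N)"
      unfolding T_def by (subst nn_integral_add) auto
    also have "\<dots> = T + ennreal ((p - 1) * a powr p * B)"
      using B p by (simp add: ennreal_mult[symmetric])
    finally show ?thesis .
  qed
  have "ennreal_powr S p \<le> ennreal (B powr (p - 1)) * T"
  proof (cases T)
    case top
    have "ennreal (B powr (p - 1)) \<noteq> 0" using B by (simp add: ennreal_eq_0_iff not_le)
    then show ?thesis using top by (simp add: ennreal_mult_top)
  next
    case (real t)
    have "ennreal p * S \<le> ennreal (t + (p - 1) * B)"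
      using main[of 1] real B p by (simp add: ennreal_plus[symmetric] del: ennreal_plus)
    moreover have "ennreal p * \<top> = \<top>" using p by (simp add: ennreal_mult_top)
    ultimately have "S \<noteq> \<top>" by (metis ennreal_neq_top top_unique)
    then obtain s where s: "S = ennreal s" "s \<ge> 0" by (cases S) auto
    show ?thesis
    proof (cases "s = 0")
      case False
      define a where "a = s / B"
      have a: "a > 0" "a * B = s" using s False B by (auto simp: a_def)
      have "p * a powr (p - 1) * s \<le> t + (p - 1) * a powr p * B"
        using main[OF a(1)] s real p B
        by (simp add: ennreal_mult[symmetric] ennreal_plus[symmetric] ennreal_le_iff del: ennreal_plus)
      moreover have "a powr p * B = a powr (p - 1) * s" using a by (simp add: powr_diff field_simps)
      ultimately have "p * (a powr (p - 1) * s) \<le> t + (p - 1) * (a powr (p - 1) * s)" by (simp only: mult.assoc)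
      then have "a powr (p - 1) * s \<le> t" by (simp add: left_diff_distrib)
      then have "B powr (p - 1) * (a powr (p - 1) * s) \<le> B powr (p - 1) * t" by (intro mult_left_mono) auto
      also have "B powr (p - 1) * (a powr (p - 1) * s) = (a * B) powr (p - 1) * s" by (simp add: powr_mult)
      also have "\<dots> = s powr p" using a(2) s False by (simp add: powr_diff)
      finally show ?thesis using s real by (simp add: ennreal_powr_ennreal ennreal_mult[symmetric] ennreal_leI)
    qed (use s in simp)
  qed
  then show ?thesis by (simp add: S_def T_def)
qed

lemma nn_integral_gaussian: "s > 0 \<Longrightarrow> (\<integral>\<^sup>+x. ennreal (s * exp (- (s * x)\<^sup>2 / 2)) \<partial>lborel) = ennreal (sqrt (2 * pi))"
proof -
  assume s: "s > 0"
  have "prob_space (density lborel std_normal_density)" by (rule prob_space_normal_density) simp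
  then have 1: "(\<integral>\<^sup>+x. ennreal (std_normal_density x) \<partial>lborel) = 1"
    using prob_space.emeasure_space_1[of "density lborel std_normal_density"] by (simp add: emeasure_density)
  have "(\<integral>\<^sup>+x. ennreal (std_normal_density x) \<partial>lborel) = ennreal \<bar>s\<bar> * (\<integral>\<^sup>+x. ennreal (std_normal_density (0 + s * x)) \<partial>lborel)"
    by (rule nn_integral_real_affine) (use s in auto)
  then have 2: "1 = (\<integral>\<^sup>+x. ennreal (s * std_normal_density (s * x)) \<partial>lborel)"
    using s 1 by (simp add: nn_integral_cmult[symmetric] ennreal_mult[symmetric])
  have "(\<integral>\<^sup>+x. ennreal (s * exp (- (s * x)\<^sup>2 / 2)) \<partial>lborel) = (\<integral>\<^sup>+x. ennreal (sqrt (2 * pi)) * ennreal (s * std_normal_density (s * x)) \<partial>lborel)"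
    using s by (intro nn_integral_cong) (simp add: ennreal_mult[symmetric] std_normal_density_def)
  also have "\<dots> = ennreal (sqrt (2 * pi)) * (\<integral>\<^sup>+x. ennreal (s * std_normal_density (s * x)) \<partial>lborel)"
    by (rule nn_integral_cmult) measurable
  finally show ?thesis using 2 by simp
qed

lemma integral_gaussian_iexp:
  assumes s: "s > 0"
  shows "(CLBINT t. complex_of_real (std_normal_density (t / s)) * iexp (t * x)) = complex_of_real (s * exp (- (s * x)\<^sup>2 / 2))"
proof -
  have "(CLBINT t. complex_of_real (std_normal_density (t / s)) * iexp (t * x)) =
     \<bar>s\<bar> *\<^sub>R (CLBINT t. complex_of_real (std_normal_density ((0 + s * t) / s)) * iexp ((0 + s * t) * x))"
    by (rule lborel_integral_real_affine) (use s in simp)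
  also have "(CLBINT t. complex_of_real (std_normal_density ((0 + s * t) / s)) * iexp ((0 + s * t) * x))
     = (CLBINT t. std_normal_density t *\<^sub>R iexp ((s * x) * t))"
    using s by (intro Bochner_Integration.integral_cong refl) (simp add: scaleR_conv_of_real mult_ac)
  also have "\<dots> = char std_normal_distribution (s * x)"
    unfolding char_def by (subst integral_density) auto
  also have "\<dots> = complex_of_real (exp (- (s * x)\<^sup>2 / 2))" by (simp add: char_std_normal_distribution)
  finally show ?thesis using s by (simp add: scaleR_conv_of_real)
qed

lemma borel_measurable_cnj [measurable]:
  assumes "f \<in> borel_measurable M" shows "(\<lambda>x. cnj (f x)) \<in> borel_measurable M"
  using borel_measurable_continuous_on[OF linear_continuous_on[OF bounded_linear_cnj] assms] by simp

section \<open>The sine transform of functions with bounded support\<close>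

abbreviation L2_square :: "'a measure \<Rightarrow> ('a \<Rightarrow> complex) \<Rightarrow> ennreal" where
  "L2_square M g \<equiv> \<integral>\<^sup>+x. ennreal ((cmod (g x))\<^sup>2) \<partial>M"

lemma L2_compact_support:
  fixes g :: "real \<Rightarrow> complex"
  assumes g[measurable]: "g \<in> borel_measurable borel" and supp: "\<And>x. x \<notin> {a..b} \<Longrightarrow> g x = 0" and ab: "a < b"
  shows "(\<integral>\<^sup>+x. ennreal (cmod (g x)) \<partial>lborel)\<^sup>2 \<le> ennreal (b - a) * L2_square lborel g"
    and "L2_square lborel g < \<infinity> \<Longrightarrow> integrable lborel g"
proof -
  have "(\<integral>\<^sup>+x. ennreal (cmod (g x)) \<partial>lborel) = (\<integral>\<^sup>+x. ennreal (cmod (g x)) * indicator {a..b} x \<partial>lborel)"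
    using supp by (intro nn_integral_cong) (auto simp: indicator_def)
  also have "\<dots>\<^sup>2 \<le> (\<integral>\<^sup>+x. ennreal (cmod (g x)) ^ 2 \<partial>lborel) * (\<integral>\<^sup>+x. (indicator {a..b} x)^2 \<partial>lborel)"
    by (rule Cauchy_Schwarz_nn_integral) auto
  also have "(\<lambda>x. (indicator {a..b} x :: ennreal)^2) = indicator {a..b}"
    by (auto simp: indicator_def)
  also have "(\<integral>\<^sup>+x. indicator {a..b} x \<partial>lborel) = ennreal (b - a)" using ab by simp
  finally show 1: "(\<integral>\<^sup>+x. ennreal (cmod (g x)) \<partial>lborel)\<^sup>2 \<le> ennreal (b - a) * L2_square lborel g"
    by (simp add: ennreal_power mult.commute)
  show "integrable lborel g" if fin: "L2_square lborel g < \<infinity>"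
  proof (rule integrableI_bounded)
    have "ennreal (b - a) * L2_square lborel g < \<infinity>"
      using fin by (simp add: ennreal_mult_less_top)
    then have "(\<integral>\<^sup>+x. ennreal (cmod (g x)) \<partial>lborel)\<^sup>2 < \<infinity>" using 1 by (rule order_le_less_trans[rotated])
    then show "(\<integral>\<^sup>+x. ennreal (norm (g x)) \<partial>lborel) < \<infinity>"
      by (auto simp: power2_eq_square ennreal_mult_less_top)
  qed simp
qed

definition ftrans :: "(real \<Rightarrow> complex) \<Rightarrow> real \<Rightarrow> complex" where
  "ftrans g t = (CLBINT x. iexp (t * x) * g x)"

lemma measurable_ftrans [measurable]:
  assumes [measurable]: "g \<in> borel_measurable borel"
  shows "ftrans g \<in> borel_measurable borel"
  unfolding ftrans_def[abs_def] by measurable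

text \<open>
  Write \<open>|ftrans g t|^2\<close> as a double integral and integrate against the Gaussian in \<open>t\<close> first. This leaves a
  Gaussian kernel in \<open>x - y\<close> whose integral in either variable is \<open>sqrt (2 pi)\<close>, whatever the width \<open>s\<close>; bounding
  \<open>|g x| |g y|\<close> by \<open>(|g x|^2 + |g y|^2) / 2\<close> finishes the estimate (Schur's test).
\<close>

lemma ftrans_gaussian_bound:
  fixes g :: "real \<Rightarrow> complex"
  assumes g: "integrable lborel g" and s: "s > 0"
  shows "(\<integral>\<^sup>+t. ennreal (std_normal_density (t / s) * (cmod (ftrans g t))\<^sup>2) \<partial>lborel)
     \<le> ennreal (sqrt (2 * pi)) * L2_square lborel g"
proof -
  interpret P: pair_sigma_finite "lborel :: real measure" "lborel \<Otimes>\<^sub>M lborel :: (real \<times> real) measure" ..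
  have [measurable]: "g \<in> borel_measurable borel" using g by (auto dest: borel_measurable_integrable)
  let ?LL = "lborel \<Otimes>\<^sub>M lborel :: (real \<times> real) measure"
  define d where "d t = std_normal_density (t / s)" for t
  have d0: "d t \<ge> 0" for t by (simp add: d_def)
  have [measurable]: "d \<in> borel_measurable borel" unfolding d_def[abs_def] by measurable
  have dint: "integrable lborel d"
    unfolding d_def[abs_def] using lborel_integrable_real_affine[of std_normal_density "1/s" 0] s by simp
  define G where "G z = g (fst z) * cnj (g (snd z))" for z :: "real \<times> real"
  have [measurable]: "G \<in> borel_measurable borel" unfolding G_def[abs_def] borel_prod[symmetric] by measurable
  have Gint: "integrable ?LL G"
  proof (rule lborel_pair.Fubini_integrable)
    show "G \<in> borel_measurable ?LL" unfolding G_def[abs_def] by measurable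
    show "integrable lborel (\<lambda>x. \<integral>y. norm (G (x, y)) \<partial>lborel)"
      using g by (simp add: G_def norm_mult)
    show "AE x in lborel. integrable lborel (\<lambda>y. G (x, y))" using g by (simp add: G_def)
  qed
  define F where "F t z = complex_of_real (d t) * iexp (t * (fst z - snd z)) * G z" for t and z :: "real \<times> real"
  have Fm: "case_prod F \<in> borel_measurable (lborel \<Otimes>\<^sub>M ?LL)"
    unfolding F_def[abs_def] G_def by measurable
  have nF: "norm (F t z) = d t * norm (G z)" for t z by (simp add: F_def norm_mult d0)
  have Fint: "integrable (lborel \<Otimes>\<^sub>M ?LL) (case_prod F)"
  proof (rule P.Fubini_integrable)
    show "case_prod F \<in> borel_measurable (lborel \<Otimes>\<^sub>M ?LL)" by (rule Fm)
    show "integrable lborel (\<lambda>x. \<integral>y. norm (case_prod F (x, y)) \<partial>?LL)"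
      using dint by (simp add: nF)
    have "integrable ?LL (F t)" for t
    proof (rule Bochner_Integration.integrable_bound[of _ "\<lambda>z. d t * norm (G z)"])
      show "integrable ?LL (\<lambda>z. d t * norm (G z))" using Gint by simp
      show "F t \<in> borel_measurable ?LL" unfolding F_def[abs_def] G_def by measurable
    qed (simp add: nF d0)
    then show "AE x in lborel. integrable ?LL (\<lambda>y. case_prod F (x, y))" by simp
  qed
  have eq1: "complex_of_real (d t * (cmod (ftrans g t))\<^sup>2) = (\<integral>z. F t z \<partial>?LL)" for t
  proof -
    have "integrable ?LL (\<lambda>z. iexp (t * (fst z - snd z)) * G z)"
    proof (rule Bochner_Integration.integrable_bound[OF Gint])
      show "(\<lambda>z. iexp (t * (fst z - snd z)) * G z) \<in> borel_measurable ?LL" unfolding G_def by measurable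
    qed (simp add: norm_mult)
    then have "(\<integral>z. iexp (t * (fst z - snd z)) * G z \<partial>?LL)
       = (\<integral>x. (\<integral>y. iexp (t * (x - y)) * (g x * cnj (g y)) \<partial>lborel) \<partial>lborel)"
      by (subst lborel_pair.integral_fst'[symmetric]) (simp_all add: G_def)
    also have "\<dots> = (\<integral>x. (\<integral>y. (iexp (t * x) * g x) * cnj (iexp (t * y) * g y) \<partial>lborel) \<partial>lborel)"
      by (intro Bochner_Integration.integral_cong refl) (simp add: exp_cnj exp_diff right_diff_distrib exp_minus field_simps)
    also have "\<dots> = ftrans g t * cnj (ftrans g t)"
      unfolding ftrans_def by (simp only: integral_mult_right_zero integral_mult_left_zero Bochner_Integration.integral_cnj)
    also have "\<dots> = complex_of_real ((cmod (ftrans g t))\<^sup>2)" by (simp add: complex_mult_cnj cmod_power2)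
    finally have e: "(\<integral>z. iexp (t * (fst z - snd z)) * G z \<partial>?LL) = complex_of_real ((cmod (ftrans g t))\<^sup>2)" .
    have "(\<integral>z. F t z \<partial>?LL) = complex_of_real (d t) * (\<integral>z. iexp (t * (fst z - snd z)) * G z \<partial>?LL)"
      unfolding F_def mult.assoc by (rule integral_mult_right_zero)
    then show ?thesis unfolding e by simp
  qed
  have int1: "integrable lborel (\<lambda>t. complex_of_real (d t * (cmod (ftrans g t))\<^sup>2))"
    unfolding eq1 using P.integrable_fst'[OF Fint] by simp
  have "(CLBINT t. complex_of_real (d t * (cmod (ftrans g t))\<^sup>2)) = (\<integral>z. (\<integral>t. F t z \<partial>lborel) \<partial>?LL)"
    unfolding eq1 using P.Fubini_integral[OF Fint] by simp
  also have "\<dots> = (\<integral>z. complex_of_real (s * exp (- (s * (fst z - snd z))\<^sup>2 / 2)) * G z \<partial>?LL)"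
  proof (intro Bochner_Integration.integral_cong refl)
    fix z :: "real \<times> real"
    show "(\<integral>t. F t z \<partial>lborel) = complex_of_real (s * exp (- (s * (fst z - snd z))\<^sup>2 / 2)) * G z"
      unfolding F_def integral_mult_left_zero d_def integral_gaussian_iexp[OF s] by (rule refl)
  qed
  finally have eq2: "(CLBINT t. complex_of_real (d t * (cmod (ftrans g t))\<^sup>2)) = (\<integral>z. complex_of_real (s * exp (- (s * (fst z - snd z))\<^sup>2 / 2)) * G z \<partial>?LL)" .
  define k where "k x = s * exp (- (s * x)\<^sup>2 / 2)" for x
  have k0: "k x \<ge> 0" for x using s by (simp add: k_def)
  have kb: "k x \<le> s" for x using s by (simp add: k_def)
  have [measurable]: "k \<in> borel_measurable borel" unfolding k_def[abs_def] by measurable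
  have kint: "(\<integral>\<^sup>+x. ennreal (k x) \<partial>lborel) = ennreal (sqrt (2 * pi))"
    unfolding k_def by (rule nn_integral_gaussian[OF s])
  have kint1: "(\<integral>\<^sup>+y. ennreal (k (x - y)) \<partial>lborel) = ennreal (sqrt (2 * pi))" for x
    using nn_integral_real_affine[of "\<lambda>y. ennreal (k y)" "-1" x] kint by simp
  have kint2: "(\<integral>\<^sup>+x. ennreal (k (x - y)) \<partial>lborel) = ennreal (sqrt (2 * pi))" for y
    using nn_integral_real_affine[of "\<lambda>y. ennreal (k y)" "1" "-y"] kint by simp
  have int3: "integrable ?LL (\<lambda>z. complex_of_real (k (fst z - snd z)) * G z)"
  proof (rule Bochner_Integration.integrable_bound[of _ "\<lambda>z. s * norm (G z)"])
    show "integrable ?LL (\<lambda>z. s * norm (G z))" using Gint by simp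
    show "(\<lambda>z. complex_of_real (k (fst z - snd z)) * G z) \<in> borel_measurable ?LL" unfolding G_def by measurable
  qed (use kb k0 s in \<open>auto simp: norm_mult intro!: mult_right_mono\<close>)
  have "(\<integral>\<^sup>+t. ennreal (d t * (cmod (ftrans g t))\<^sup>2) \<partial>lborel) = ennreal (LBINT t. d t * (cmod (ftrans g t))\<^sup>2)"
  proof (rule nn_integral_eq_integral)
    show "integrable lborel (\<lambda>t. d t * (cmod (ftrans g t))\<^sup>2)"
      using int1 by (simp only: complex_of_real_integrable_eq)
  qed (simp add: d0)
  also have "(LBINT t. d t * (cmod (ftrans g t))\<^sup>2) \<le> cmod (CLBINT t. complex_of_real (d t * (cmod (ftrans g t))\<^sup>2))"
    by (simp only: integral_complex_of_real norm_of_real abs_ge_self)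
  then have "ennreal (LBINT t. d t * (cmod (ftrans g t))\<^sup>2) \<le> ennreal (cmod (\<integral>z. complex_of_real (k (fst z - snd z)) * G z \<partial>?LL))"
    unfolding eq2 k_def by (rule ennreal_leI)
  also have "\<dots> \<le> (\<integral>\<^sup>+z. ennreal (norm (complex_of_real (k (fst z - snd z)) * G z)) \<partial>?LL)"
    by (rule integral_norm_bound_ennreal[OF int3])
  also have "\<dots> \<le> (\<integral>\<^sup>+z. ennreal (1/2) * (ennreal (k (fst z - snd z)) * ennreal ((cmod (g (fst z)))\<^sup>2) + ennreal (k (fst z - snd z)) * ennreal ((cmod (g (snd z)))\<^sup>2)) \<partial>?LL)"
  proof (intro nn_integral_mono)
    fix z :: "real \<times> real"
    have "cmod (g (fst z)) * cmod (g (snd z)) \<le> 1/2 * ((cmod (g (fst z)))\<^sup>2 + (cmod (g (snd z)))\<^sup>2)"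
      using zero_le_power2[of "cmod (g (fst z)) - cmod (g (snd z))"] by (simp add: power2_diff)
    then have "k (fst z - snd z) * (cmod (g (fst z)) * cmod (g (snd z))) \<le> k (fst z - snd z) * (1/2 * ((cmod (g (fst z)))\<^sup>2 + (cmod (g (snd z)))\<^sup>2))"
      by (intro mult_left_mono k0)
    also have "\<dots> = 1/2 * (k (fst z - snd z) * (cmod (g (fst z)))\<^sup>2 + k (fst z - snd z) * (cmod (g (snd z)))\<^sup>2)"
      by (simp add: algebra_simps)
    finally have le: "k (fst z - snd z) * (cmod (g (fst z)) * cmod (g (snd z))) \<le> 1/2 * (k (fst z - snd z) * (cmod (g (fst z)))\<^sup>2 + k (fst z - snd z) * (cmod (g (snd z)))\<^sup>2)" .
    have e: "ennreal (1/2 * (a * b + a * c)) = ennreal (1/2) * (ennreal a * ennreal b + ennreal a * ennreal c)"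
      if "a \<ge> 0" "b \<ge> 0" "c \<ge> 0" for a b c :: real
    proof -
      have "ennreal (1/2 * (a * b + a * c)) = ennreal (1/2) * ennreal (a * b + a * c)" using that by (intro ennreal_mult) auto
      also have "ennreal (a * b + a * c) = ennreal (a * b) + ennreal (a * c)" using that by (intro ennreal_plus) auto
      also have "ennreal (a * b) = ennreal a * ennreal b" using that by (intro ennreal_mult) auto
      also have "ennreal (a * c) = ennreal a * ennreal c" using that by (intro ennreal_mult) auto
      finally show ?thesis .
    qed
    have "norm (complex_of_real (k (fst z - snd z)) * G z) = k (fst z - snd z) * (cmod (g (fst z)) * cmod (g (snd z)))"
      using k0 by (simp add: G_def norm_mult)
    then show "ennreal (norm (complex_of_real (k (fst z - snd z)) * G z)) \<le> ennreal (1/2) * (ennreal (k (fst z - snd z)) * ennreal ((cmod (g (fst z)))\<^sup>2) + ennreal (k (fst z - snd z)) * ennreal ((cmod (g (snd z)))\<^sup>2))"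
      unfolding e[OF k0 zero_le_power2 zero_le_power2, symmetric] using le by (simp only: ennreal_leI)
  qed
  also have "\<dots> = ennreal (1/2) * ((\<integral>\<^sup>+z. ennreal (k (fst z - snd z)) * ennreal ((cmod (g (fst z)))\<^sup>2) \<partial>?LL)
       + (\<integral>\<^sup>+z. ennreal (k (fst z - snd z)) * ennreal ((cmod (g (snd z)))\<^sup>2) \<partial>?LL))"
    by (subst nn_integral_cmult, measurable) (subst nn_integral_add, auto)
  also have "(\<integral>\<^sup>+z. ennreal (k (fst z - snd z)) * ennreal ((cmod (g (fst z)))\<^sup>2) \<partial>?LL)
     = (\<integral>\<^sup>+x. (\<integral>\<^sup>+y. ennreal (k (x - y)) * ennreal ((cmod (g x))\<^sup>2) \<partial>lborel) \<partial>lborel)"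
    by (subst lborel.nn_integral_fst[symmetric]) auto
  also have "\<dots> = (\<integral>\<^sup>+x. ennreal (sqrt (2 * pi)) * ennreal ((cmod (g x))\<^sup>2) \<partial>lborel)"
    by (subst nn_integral_multc) (simp_all add: kint1)
  also have "\<dots> = ennreal (sqrt (2 * pi)) * L2_square lborel g"
    by (rule nn_integral_cmult) simp
  also have "(\<integral>\<^sup>+z. ennreal (k (fst z - snd z)) * ennreal ((cmod (g (snd z)))\<^sup>2) \<partial>?LL)
     = (\<integral>\<^sup>+y. (\<integral>\<^sup>+x. ennreal (k (x - y)) * ennreal ((cmod (g y))\<^sup>2) \<partial>lborel) \<partial>lborel)"
    by (subst lborel_pair.nn_integral_snd[symmetric]) auto
  also have "\<dots> = (\<integral>\<^sup>+x. ennreal (sqrt (2 * pi)) * ennreal ((cmod (g x))\<^sup>2) \<partial>lborel)"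
    by (subst nn_integral_multc) (simp_all add: kint2)
  also have "\<dots> = ennreal (sqrt (2 * pi)) * L2_square lborel g"
    by (rule nn_integral_cmult) simp
  also have "ennreal (1/2) * (ennreal (sqrt (2 * pi)) * L2_square lborel g + ennreal (sqrt (2 * pi)) * (L2_square lborel g))
    = ennreal (sqrt (2 * pi)) * L2_square lborel g"
  proof -
    have "ennreal (1/2) * (X + X) = X" for X :: ennreal
    proof -
      have "ennreal (1/2) * (X + X) = (ennreal (1/2) + ennreal (1/2)) * X" by (simp add: distrib_left distrib_right)
      also have "ennreal (1/2) + ennreal (1/2) = 1" by (subst ennreal_plus[symmetric]) auto
      finally show ?thesis by simp
    qed
    then show ?thesis .
  qed
  finally show ?thesis by (simp add: d_def)
qed

lemma measurable_nn_integral_count_space: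
  assumes "countable I" "\<And>i. i \<in> I \<Longrightarrow> f i \<in> borel_measurable N"
  shows "(\<lambda>x. \<integral>\<^sup>+i. (f i x :: ennreal) \<partial>count_space I) \<in> borel_measurable N"
proof -
  interpret sigma_finite_measure "count_space I" by (rule sigma_finite_measure_count_space_countable[OF assms(1)])
  have "(\<lambda>z. f (fst z) (snd z)) \<in> borel_measurable (count_space I \<Otimes>\<^sub>M N)"
    by (rule measurable_pair_measure_countable1[OF assms(1)]) (simp add: assms(2))
  from measurable_pair_swap[OF this] show ?thesis
    by (intro borel_measurable_nn_integral) (simp add: case_prod_beta')
qed

text \<open>Let the width of the Gaussian weight tend to infinity, with Fatou's lemma.\<close>

lemma ftrans_L2:
  fixes g :: "real \<Rightarrow> complex"
  assumes g: "integrable lborel g"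
  shows "L2_square lborel (ftrans g) \<le> ennreal (2 * pi) * L2_square lborel g"
proof -
  have [measurable]: "g \<in> borel_measurable borel" using g by (auto dest: borel_measurable_integrable)
  define X where "X = L2_square lborel g"
  define f where "f n t = ennreal (sqrt (2 * pi) * (std_normal_density (t / real (Suc n)) * (cmod (ftrans g t))\<^sup>2))" for n t
  have fb: "(\<integral>\<^sup>+t. f n t \<partial>lborel) \<le> ennreal (2 * pi) * X" for n
  proof -
    have "(\<integral>\<^sup>+t. f n t \<partial>lborel) = ennreal (sqrt (2 * pi)) * (\<integral>\<^sup>+t. ennreal (std_normal_density (t / real (Suc n)) * (cmod (ftrans g t))\<^sup>2) \<partial>lborel)"
      unfolding f_def by (subst nn_integral_cmult[symmetric]) (simp_all add: ennreal_mult)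
    also have "\<dots> \<le> ennreal (sqrt (2 * pi)) * (ennreal (sqrt (2 * pi)) * X)"
      unfolding X_def by (intro mult_left_mono ftrans_gaussian_bound[OF g]) auto
    also have "\<dots> = ennreal (2 * pi) * X" by (simp add: mult.assoc[symmetric] ennreal_mult[symmetric])
    finally show ?thesis .
  qed
  have lim: "(\<lambda>n. f n t) \<longlonglongrightarrow> ennreal ((cmod (ftrans g t))\<^sup>2)" for t
  proof -
    have t0: "(\<lambda>n. t / real (Suc n)) \<longlonglongrightarrow> 0"
      using tendsto_mult[OF tendsto_const[of t] LIMSEQ_inverse_real_of_nat] by (simp add: divide_inverse)
    have "(\<lambda>n. sqrt (2 * pi) * (std_normal_density (t / real (Suc n)) * (cmod (ftrans g t))\<^sup>2))
       \<longlonglongrightarrow> sqrt (2 * pi) * ((1 / sqrt (2 * pi) * exp (- (0\<^sup>2) / 2)) * (cmod (ftrans g t))\<^sup>2)"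
      unfolding std_normal_density_def by (intro tendsto_intros t0) auto
    then show ?thesis unfolding f_def by (intro tendsto_ennrealI) simp
  qed
  have "L2_square lborel (ftrans g) = (\<integral>\<^sup>+t. liminf (\<lambda>n. f n t) \<partial>lborel)"
    using lim_imp_Liminf[OF sequentially_bot lim] by simp
  also have "\<dots> \<le> liminf (\<lambda>n. \<integral>\<^sup>+t. f n t \<partial>lborel)"
    by (rule nn_integral_liminf) (simp add: f_def)
  also have "\<dots> \<le> ennreal (2 * pi) * X"
    by (rule Liminf_le) (auto simp: fb)
  finally show ?thesis by (simp add: X_def)
qed

definition strans :: "(real \<Rightarrow> complex) \<Rightarrow> real \<Rightarrow> complex" where
  "strans g t = (CLBINT x. of_real (sin (t * x)) * g x)"

lemma measurable_strans [measurable]: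
  assumes [measurable]: "g \<in> borel_measurable borel"
  shows "strans g \<in> borel_measurable borel"
  unfolding strans_def[abs_def] by measurable

lemma strans_sup:
  fixes g :: "real \<Rightarrow> complex"
  assumes g[measurable]: "g \<in> borel_measurable borel" and supp: "\<And>x. x \<notin> {a..b} \<Longrightarrow> g x = 0" and ab: "a < b"
  shows "ennreal ((cmod (strans g t))\<^sup>2) \<le> ennreal (b - a) * L2_square lborel g"
proof -
  have "ennreal (cmod (strans g t)) \<le> (\<integral>\<^sup>+x. ennreal (cmod (g x)) \<partial>lborel)"
  proof (cases "integrable lborel (\<lambda>x. complex_of_real (sin (t * x)) * g x)")
    case True
    have "ennreal (cmod (strans g t)) \<le> (\<integral>\<^sup>+x. ennreal (norm (complex_of_real (sin (t * x)) * g x)) \<partial>lborel)"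
      unfolding strans_def by (rule integral_norm_bound_ennreal[OF True])
    also have "\<dots> \<le> (\<integral>\<^sup>+x. ennreal (cmod (g x)) \<partial>lborel)"
      by (intro nn_integral_mono ennreal_leI) (auto simp: norm_mult intro!: mult_left_le_one_le)
    finally show ?thesis .
  next
    case False
    then show ?thesis by (simp add: strans_def not_integrable_integral_eq)
  qed
  then have "ennreal (cmod (strans g t)) ^ 2 \<le> (\<integral>\<^sup>+x. ennreal (cmod (g x)) \<partial>lborel)\<^sup>2"
    by (intro power_mono) auto
  also have "\<dots> \<le> ennreal (b - a) * L2_square lborel g"
    by (rule L2_compact_support(1)[OF g supp ab])
  finally show ?thesis by (simp add: ennreal_power)
qed

lemma strans_L2:
  fixes g :: "real \<Rightarrow> complex"
  assumes g[measurable]: "g \<in> borel_measurable borel" and supp: "\<And>x. x \<notin> {a..b} \<Longrightarrow> g x = 0" and ab: "a < b"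
  shows "L2_square lborel (strans g) \<le> ennreal (2 * pi) * L2_square lborel g"
proof (cases "L2_square lborel g < \<infinity>")
  case False
  then have "L2_square lborel g = \<top>" by (simp add: not_less top_unique)
  moreover have "ennreal (2 * pi) * \<top> = \<top>" by (simp add: ennreal_mult_top ennreal_eq_0_iff not_le)
  ultimately show ?thesis by simp
next
  case True
  define E where "E = L2_square lborel (ftrans g)"
  have gi: "integrable lborel g" by (rule L2_compact_support(2)[OF g supp ab True])
  have gi': "integrable lborel (\<lambda>x. iexp (t * x) * g x)" for t
    by (rule Bochner_Integration.integrable_bound[OF gi]) (auto simp: norm_mult)
  have s: "strans g t = (ftrans g t - ftrans g (- t)) / (2 * \<i>)" for t
  proof -
    have "ftrans g t - ftrans g (- t) = (CLBINT x. iexp (t * x) * g x - iexp (- t * x) * g x)"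
      unfolding ftrans_def by (rule Bochner_Integration.integral_diff[OF gi' gi', symmetric])
    also have "\<dots> = (CLBINT x. (2 * \<i>) * (of_real (sin (t * x)) * g x))"
    proof (intro Bochner_Integration.integral_cong refl)
      fix x
      have "complex_of_real (sin (t * x)) = (iexp (t * x) - iexp (- t * x)) / (2 * \<i>)"
        using sin_exp_eq[of "complex_of_real (t * x)"] by (simp add: sin_of_real[symmetric] del: sin_of_real)
      then show "iexp (t * x) * g x - iexp (- t * x) * g x = (2 * \<i>) * (of_real (sin (t * x)) * g x)"
        by (simp add: left_diff_distrib)
    qed
    also have "\<dots> = (2 * \<i>) * strans g t" unfolding strans_def by (rule integral_mult_right_zero)
    finally show ?thesis by simp
  qed
  have "ennreal ((cmod (strans g t))\<^sup>2) \<le> ennreal (1/2) * (ennreal ((cmod (ftrans g t))\<^sup>2) + ennreal ((cmod (ftrans g (- t)))\<^sup>2))" for t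
  proof -
    define u where "u = cmod (ftrans g t)"
    define v where "v = cmod (ftrans g (- t))"
    have "cmod (strans g t) \<le> (u + v) / 2"
      using norm_triangle_ineq4[of "ftrans g t" "ftrans g (- t)"] by (simp add: s norm_divide norm_mult u_def v_def)
    then have "(cmod (strans g t))\<^sup>2 \<le> ((u + v) / 2)\<^sup>2" by (intro power_mono) auto
    also have "\<dots> \<le> 1/2 * (u\<^sup>2 + v\<^sup>2)" using zero_le_power2[of "u - v"] by (simp add: power2_eq_square field_simps)
    finally have "ennreal ((cmod (strans g t))\<^sup>2) \<le> ennreal (1/2 * (u\<^sup>2 + v\<^sup>2))" by (rule ennreal_leI)
    also have "\<dots> = ennreal (1/2) * (ennreal (u\<^sup>2) + ennreal (v\<^sup>2))" by (subst ennreal_mult) (auto simp: ennreal_plus)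
    finally show ?thesis by (simp only: u_def v_def)
  qed
  then have "L2_square lborel (strans g) \<le> (\<integral>\<^sup>+t. ennreal (1/2) * (ennreal ((cmod (ftrans g t))\<^sup>2) + ennreal ((cmod (ftrans g (- t)))\<^sup>2)) \<partial>lborel)"
    by (intro nn_integral_mono)
  also have "\<dots> = ennreal (1/2) * (E + (\<integral>\<^sup>+t. ennreal ((cmod (ftrans g (- t)))\<^sup>2) \<partial>lborel))"
    unfolding E_def by (subst nn_integral_cmult, measurable) (subst nn_integral_add, auto)
  also have "(\<integral>\<^sup>+t. ennreal ((cmod (ftrans g (- t)))\<^sup>2) \<partial>lborel) = E"
    unfolding E_def using nn_integral_real_affine[of "\<lambda>t. ennreal ((cmod (ftrans g t))\<^sup>2)" "-1" 0] by simp
  also have "ennreal (1/2) * (E + E) = E"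
  proof -
    have "ennreal (1/2) * (E + E) = (ennreal (1/2) + ennreal (1/2)) * E" by (simp add: distrib_left distrib_right)
    also have "ennreal (1/2) + ennreal (1/2) = 1" by (subst ennreal_plus[symmetric]) auto
    finally show ?thesis by simp
  qed
  also have "E \<le> ennreal (2 * pi) * L2_square lborel g" unfolding E_def by (rule ftrans_L2[OF gi])
  finally show ?thesis .
qed

text \<open>
  Let \<open>N\<close> be the sum of the squared sine transforms. In \<open>N^p = N^(p-1) N\<close> the first factor is bounded pointwise by
  the Cauchy-Schwarz inequality and the second is integrated with the \<open>L^2\<close> bound; both bounds pass to sums over
  the family.
\<close>

lemma strans_family_Lp:
  fixes g :: "'i \<Rightarrow> real \<Rightarrow> complex"
  assumes I: "countable I" and g: "\<And>i. i \<in> I \<Longrightarrow> g i \<in> borel_measurable borel"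
    and supp: "\<And>i x. i \<in> I \<Longrightarrow> x \<notin> {a..b} \<Longrightarrow> g i x = 0" and ab: "a < b" and p: "p > 1"
  defines "A \<equiv> (\<integral>\<^sup>+i. L2_square lborel (g i) \<partial>count_space I)"
  shows "(\<integral>\<^sup>+t. ennreal_powr (\<integral>\<^sup>+i. ennreal ((cmod (strans (g i) t))\<^sup>2) \<partial>count_space I) p \<partial>lborel)
    \<le> ennreal (2 * pi * (b - a) powr (p - 1)) * ennreal_powr A p"
proof -
  define N where "N t = (\<integral>\<^sup>+i. ennreal ((cmod (strans (g i) t))\<^sup>2) \<partial>count_space I)" for t
  have [measurable]: "N \<in> borel_measurable borel"
    unfolding N_def[abs_def] by (rule measurable_nn_integral_count_space[OF I]) (use g in measurable)
  have sup: "N t \<le> ennreal (b - a) * A" for t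
  proof -
    have "N t \<le> (\<integral>\<^sup>+i. ennreal (b - a) * L2_square lborel (g i) \<partial>count_space I)"
      unfolding N_def by (intro nn_integral_mono strans_sup[OF g supp ab]) auto
    also have "\<dots> = ennreal (b - a) * A" unfolding A_def by (rule nn_integral_cmult) simp
    finally show ?thesis .
  qed
  have L1: "(\<integral>\<^sup>+t. N t \<partial>lborel) \<le> ennreal (2 * pi) * A"
  proof -
    have "(\<integral>\<^sup>+t. N t \<partial>lborel) = (\<integral>\<^sup>+i. L2_square lborel (strans (g i)) \<partial>count_space I)"
      unfolding N_def by (rule nn_integral_count_space_nn_integral[OF I]) (use g in measurable)
    also have "\<dots> \<le> (\<integral>\<^sup>+i. ennreal (2 * pi) * L2_square lborel (g i) \<partial>count_space I)"
      by (intro nn_integral_mono strans_L2[OF g supp ab]) auto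
    also have "\<dots> = ennreal (2 * pi) * A" unfolding A_def by (rule nn_integral_cmult) simp
    finally show ?thesis .
  qed
  have Ap: "ennreal_powr A p = ennreal_powr A (p - 1) * A"
    using ennreal_powr_add[of A "p - 1" 1] by simp
  have "(\<integral>\<^sup>+t. ennreal_powr (N t) p \<partial>lborel) \<le> (\<integral>\<^sup>+t. ennreal_powr (ennreal (b - a) * A) (p - 1) * N t \<partial>lborel)"
  proof (intro nn_integral_mono)
    fix t
    have "ennreal_powr (N t) p = ennreal_powr (N t) (p - 1) * N t" using ennreal_powr_add[of "N t" "p - 1" 1] by simp
    also have "\<dots> \<le> ennreal_powr (ennreal (b - a) * A) (p - 1) * N t"
      by (intro mult_right_mono ennreal_powr_mono sup) (use p in auto)
    finally show "ennreal_powr (N t) p \<le> ennreal_powr (ennreal (b - a) * A) (p - 1) * N t" .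
  qed
  also have "\<dots> = ennreal_powr (ennreal (b - a) * A) (p - 1) * (\<integral>\<^sup>+t. N t \<partial>lborel)" by (rule nn_integral_cmult) simp
  also have "\<dots> \<le> ennreal_powr (ennreal (b - a) * A) (p - 1) * (ennreal (2 * pi) * A)" by (intro mult_left_mono L1) simp
  also have "\<dots> = ennreal (2 * pi * (b - a) powr (p - 1)) * ennreal_powr A p"
    unfolding Ap using ab by (simp add: ennreal_powr_mult ennreal_powr_ennreal ennreal_mult mult_ac)
  finally show ?thesis by (simp add: N_def)
qed

section \<open>The wave propagator on a countable family of modes\<close>

lemma nn_integral_radial:
  assumes [measurable]: "f \<in> borel_measurable borel"
  shows "(\<integral>\<^sup>+r. f r \<partial>radial_measure n) = (\<integral>\<^sup>+r. ennreal (indicator {0<..} r * r ^ (n - 1)) * f r \<partial>lborel)"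
  unfolding radial_measure_def by (rule nn_integral_density) auto

text \<open>
  The function of \<open>\<rho>\<close> whose sine transform is the coefficient of the solution in one mode, for \<open>J\<close> the Bessel function
  of the mode and \<open>b\<close> the Hankel transform of the data.
\<close>

definition wave_density :: "nat \<Rightarrow> (real \<Rightarrow> real) \<Rightarrow> (real \<Rightarrow> complex) \<Rightarrow> real \<Rightarrow> real \<Rightarrow> complex" where
  "wave_density n J b r \<rho> = (if \<rho> > 0 then of_real ((r * \<rho>) powr (- ((real n - 2) / 2)) * J (r * \<rho>)) * b \<rho> * of_real (\<rho> ^ (n - 2)) else 0)"

lemma measurable_wave_density1:
  assumes [measurable]: "J \<in> borel_measurable borel" "b \<in> borel_measurable borel"
  shows "wave_density n J b r \<in> borel_measurable borel"
  unfolding wave_density_def[abs_def] by measurable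

text \<open>
  The powers of \<open>\<rho>\<close> combine so that the first factor on the right, free of \<open>r\<close>, is the density of the squared
  \<open>H^(-1/2)\<close> norm.
\<close>

lemma wave_density_norm:
  assumes n: "n \<ge> 2" and r: "r > 0"
  shows "ennreal ((cmod (wave_density n J b r \<rho>))\<^sup>2) =
    ennreal (indicator {0<..} \<rho> * ((cmod (b \<rho>))\<^sup>2 * \<rho> ^ (n - 2))) * ennreal (r powr (- (real n - 2)) * (J (r * \<rho>))\<^sup>2)"
proof (cases "\<rho> > 0")
  case True
  have e: "((r * \<rho>) powr (- ((real n - 2) / 2)))\<^sup>2 = r powr (- (real n - 2)) * \<rho> powr (- (real n - 2))"
  proof -
    have "((r * \<rho>) powr (- ((real n - 2) / 2)))\<^sup>2 = (r * \<rho>) powr (- ((real n - 2) / 2) + - ((real n - 2) / 2))"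
      unfolding power2_eq_square powr_add by (rule refl)
    also have "- ((real n - 2) / 2) + - ((real n - 2) / 2) = - (real n - 2)" by simp
    finally show ?thesis by (simp only: powr_mult)
  qed
  have p: "\<rho> powr (- (real n - 2)) * (\<rho> ^ (n - 2))\<^sup>2 = \<rho> ^ (n - 2)"
  proof -
    have "\<rho> ^ (n - 2) = \<rho> powr (real n - 2)" using True n by (simp add: powr_realpow[symmetric] of_nat_diff)
    then have "\<rho> powr (- (real n - 2)) * (\<rho> ^ (n - 2))\<^sup>2 = \<rho> powr (- (real n - 2) + ((real n - 2) + (real n - 2)))"
      unfolding power2_eq_square powr_add by simp
    also have "- (real n - 2) + ((real n - 2) + (real n - 2)) = real n - 2" by simp
    finally show ?thesis using \<open>\<rho> ^ (n - 2) = \<rho> powr (real n - 2)\<close> by simp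
  qed
  have "(cmod (wave_density n J b r \<rho>))\<^sup>2 = ((r * \<rho>) powr (- ((real n - 2) / 2)))\<^sup>2 * (J (r * \<rho>))\<^sup>2 * (cmod (b \<rho>))\<^sup>2 * (\<rho> ^ (n - 2))\<^sup>2"
    using True by (simp add: wave_density_def norm_mult power_mult_distrib norm_power)
  also have "\<dots> = (cmod (b \<rho>))\<^sup>2 * (\<rho> powr (- (real n - 2)) * (\<rho> ^ (n - 2))\<^sup>2) * (r powr (- (real n - 2)) * (J (r * \<rho>))\<^sup>2)"
    unfolding e by (simp add: mult_ac)
  also have "\<dots> = (cmod (b \<rho>))\<^sup>2 * \<rho> ^ (n - 2) * (r powr (- (real n - 2)) * (J (r * \<rho>))\<^sup>2)" unfolding p ..
  finally have "(cmod (wave_density n J b r \<rho>))\<^sup>2 = ((cmod (b \<rho>))\<^sup>2 * \<rho> ^ (n - 2)) * (r powr (- (real n - 2)) * (J (r * \<rho>))\<^sup>2)" .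
  moreover have "ennreal (((cmod (b \<rho>))\<^sup>2 * \<rho> ^ (n - 2)) * (r powr (- (real n - 2)) * (J (r * \<rho>))\<^sup>2))
     = ennreal ((cmod (b \<rho>))\<^sup>2 * \<rho> ^ (n - 2)) * ennreal (r powr (- (real n - 2)) * (J (r * \<rho>))\<^sup>2)"
    using True by (intro ennreal_mult) auto
  ultimately show ?thesis using True by simp
qed (simp add: wave_density_def)

text \<open>The substitution \<open>r = x / \<rho>\<close>; \<open>\<alpha>\<close> collects all powers of \<open>r\<close>.\<close>

lemma scaled_bessel_integral:
  fixes J :: "real \<Rightarrow> real"
  assumes [measurable]: "J \<in> borel_measurable borel" and \<rho>: "\<rho> > 0" and n: "n \<ge> 2" and q: "q > 0"
  defines "\<alpha> \<equiv> real n - 1 - q * (real n - 2) / 2"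
  shows "(\<integral>\<^sup>+r. ennreal (indicator {0<..} r * r ^ (n - 1)) * ennreal_powr (ennreal (r powr (- (real n - 2)) * (J (r * \<rho>))\<^sup>2)) (q/2) \<partial>lborel)
    = ennreal (\<rho> powr (-(\<alpha> + 1))) * weighted_moment \<alpha> q J"
proof -
  have 1: "ennreal (indicator {0<..} r * r ^ (n - 1)) * ennreal_powr (ennreal (r powr (- (real n - 2)) * (J (r * \<rho>))\<^sup>2)) (q/2)
     = ennreal (r powr \<alpha> * \<bar>J (r * \<rho>)\<bar> powr q) * indicator {0<..} r" for r
  proof (cases "r > 0")
    case True
    have "((J (r * \<rho>))\<^sup>2) powr (q/2) = \<bar>J (r * \<rho>)\<bar> powr q"
    proof -
      have "(J (r * \<rho>))\<^sup>2 = \<bar>J (r * \<rho>)\<bar> powr 2" by simp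
      then have "((J (r * \<rho>))\<^sup>2) powr (q/2) = \<bar>J (r * \<rho>)\<bar> powr (2 * (q/2))" by (simp only: powr_powr)
      then show ?thesis by simp
    qed
    moreover have "r ^ (n - 1) = r powr (real n - 1)" using True n by (simp add: powr_realpow[symmetric] of_nat_diff)
    moreover have "(r powr (- (real n - 2)) * (J (r * \<rho>))\<^sup>2) powr (q/2) = r powr (- (real n - 2) * (q/2)) * ((J (r * \<rho>))\<^sup>2) powr (q/2)"
      unfolding powr_mult powr_powr ..
    moreover have "r powr (real n - 1) * r powr (- (real n - 2) * (q/2)) = r powr \<alpha>"
      unfolding powr_add[symmetric] \<alpha>_def by (rule arg_cong[where f="\<lambda>x. r powr x"]) (simp add: field_simps)
    ultimately have "r ^ (n - 1) * (r powr (- (real n - 2)) * (J (r * \<rho>))\<^sup>2) powr (q/2) = r powr \<alpha> * \<bar>J (r * \<rho>)\<bar> powr q"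
      by (simp only: mult.assoc[symmetric])
    then show ?thesis using True by (simp add: ennreal_powr_ennreal ennreal_mult[symmetric])
  qed simp
  have "(\<integral>\<^sup>+r. ennreal (r powr \<alpha> * \<bar>J (r * \<rho>)\<bar> powr q) * indicator {0<..} r \<partial>lborel)
     = ennreal \<bar>1/\<rho>\<bar> * (\<integral>\<^sup>+x. ennreal ((0 + 1/\<rho> * x) powr \<alpha> * \<bar>J ((0 + 1/\<rho> * x) * \<rho>)\<bar> powr q) * indicator {0<..} (0 + 1/\<rho> * x) \<partial>lborel)"
    by (rule nn_integral_real_affine) (use \<rho> in auto)
  also have "\<dots> = ennreal (1/\<rho>) * (\<integral>\<^sup>+x. ennreal (\<rho> powr (-\<alpha>)) * (ennreal (x powr \<alpha> * \<bar>J x\<bar> powr q) * indicator {0<..} x) \<partial>lborel)"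
  proof -
    have "ennreal ((0 + 1/\<rho> * x) powr \<alpha> * \<bar>J ((0 + 1/\<rho> * x) * \<rho>)\<bar> powr q) * indicator {0<..} (0 + 1/\<rho> * x)
       = ennreal (\<rho> powr (-\<alpha>)) * (ennreal (x powr \<alpha> * \<bar>J x\<bar> powr q) * indicator {0<..} x)" for x
    proof (cases "x > 0")
      case True
      have "(1/\<rho> * x) powr \<alpha> = \<rho> powr (-\<alpha>) * x powr \<alpha>"
        unfolding powr_mult powr_minus_divide powr_divide by simp
      then show ?thesis using True \<rho> by (simp add: ennreal_mult[symmetric] mult.assoc)
    next
      case False
      then have "\<not> 0 < 1/\<rho> * x" using \<rho> by (simp add: zero_less_divide_iff)
      then show ?thesis using False by simp
    qed
    then show ?thesis using \<rho> by simp
  qed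
  also have "\<dots> = ennreal (1/\<rho>) * (ennreal (\<rho> powr (-\<alpha>)) * (\<integral>\<^sup>+x. ennreal (x powr \<alpha> * \<bar>J x\<bar> powr q) * indicator {0<..} x \<partial>lborel))"
    by (subst nn_integral_cmult) simp_all
  also have "\<dots> = ennreal (1/\<rho> * \<rho> powr (-\<alpha>)) * (\<integral>\<^sup>+x. ennreal (x powr \<alpha> * \<bar>J x\<bar> powr q) * indicator {0<..} x \<partial>lborel)"
    using \<rho> by (subst ennreal_mult) (simp_all add: mult.assoc)
  also have "1/\<rho> * \<rho> powr (-\<alpha>) = \<rho> powr (-(\<alpha> + 1))"
  proof -
    have "-(\<alpha> + 1) = -\<alpha> - 1" by simp
    then show ?thesis using \<rho> by (simp only: powr_diff powr_one) simp
  qed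
  finally show ?thesis unfolding 1 .
qed

text \<open>
  For fixed \<open>r\<close>, \<open>strans_family_Lp\<close> bounds the integral in time by a power of \<open>A r\<close>, the squared \<open>L^2\<close> norm of the
  wave densities. By \<open>wave_density_norm\<close>, \<open>A r\<close> is the integral of the kernel \<open>k i r \<rho> = r^(-(n-2)) J_i(r \<rho>)^2\<close> with
  respect to the measure with density \<open>\<beta>\<close> on pairs \<open>(i, \<rho>)\<close>, whose total mass is \<open>B\<close>. Jensen's inequality for this
  measure and Fubini's theorem reduce the integral in \<open>r\<close> to the moments of the single functions \<open>J i\<close>.
\<close>

lemma wave_family_estimate:
  fixes J :: "'i \<Rightarrow> real \<Rightarrow> real" and b :: "'i \<Rightarrow> real \<Rightarrow> complex"
  assumes n: "n \<ge> 2" and q: "q > 2" and I: "countable I"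
    and J: "\<And>i. i \<in> I \<Longrightarrow> J i \<in> borel_measurable borel" and b: "\<And>i. i \<in> I \<Longrightarrow> b i \<in> borel_measurable borel"
    and ac: "0 < a" "a < c" and supp: "\<And>i \<rho>. i \<in> I \<Longrightarrow> \<rho> > 0 \<Longrightarrow> \<rho> \<notin> {a..c} \<Longrightarrow> b i \<rho> = 0"
  defines "\<alpha> \<equiv> real n - 1 - q * (real n - 2) / 2"
  assumes K: "K > 0" "\<And>i. i \<in> I \<Longrightarrow> weighted_moment \<alpha> q (J i) \<le> ennreal K"
    and D: "D > 0" "\<And>\<rho>. a \<le> \<rho> \<Longrightarrow> \<rho> \<le> c \<Longrightarrow> \<rho> powr (-(\<alpha> + 1)) \<le> D"
  defines "B \<equiv> (\<integral>\<^sup>+i. (\<integral>\<^sup>+\<rho>. ennreal (indicator {0<..} \<rho> * ((cmod (b i \<rho>))\<^sup>2 * \<rho> ^ (n - 2))) \<partial>lborel) \<partial>count_space I)"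
  shows "(\<integral>\<^sup>+t. (\<integral>\<^sup>+r. ennreal_powr (\<integral>\<^sup>+i. ennreal ((cmod (strans (wave_density n (J i) (b i) r) t))\<^sup>2) \<partial>count_space I) (q/2) \<partial>radial_measure n) \<partial>lborel)
    \<le> ennreal (2 * pi * (c - a) powr (q/2 - 1) * (K * D)) * ennreal_powr B (q/2)"
proof -
  define p where "p = q/2"
  have p: "p > 1" using q by (simp add: p_def)
  define \<beta> where "\<beta> i \<rho> = ennreal (indicator {0<..} \<rho> * ((cmod (b i \<rho>))\<^sup>2 * \<rho> ^ (n - 2)))" for i \<rho>
  define k where "k i r \<rho> = ennreal (r powr (- (real n - 2)) * (J i (r * \<rho>))\<^sup>2)" for i r \<rho>
  define w where "w r = ennreal (indicator {0<..} r * r ^ (n - 1))" for r :: real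
  define g where "g i r = wave_density n (J i) (b i) r" for i r
  let ?Phi = "\<lambda>r. \<integral>\<^sup>+i. (\<integral>\<^sup>+\<rho>. \<beta> i \<rho> * ennreal_powr (k i r \<rho>) p \<partial>lborel) \<partial>count_space I"
  let ?F = "\<lambda>i r \<rho>. w r * (\<beta> i \<rho> * ennreal_powr (k i r \<rho>) p)"
  define U where "U t r = (\<integral>\<^sup>+i. ennreal ((cmod (strans (g i r) t))\<^sup>2) \<partial>count_space I)" for t r
  define A where "A r = (\<integral>\<^sup>+i. L2_square lborel (g i r) \<partial>count_space I)" for r
  have \<beta>m [measurable]: "\<beta> i \<in> borel_measurable borel" if "i \<in> I" for i
    unfolding \<beta>_def[abs_def] using b[OF that] by measurable
  have km [measurable]: "(\<lambda>\<rho>. k i r \<rho>) \<in> borel_measurable borel" if "i \<in> I" for i r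
    unfolding k_def using J[OF that] by measurable
  have wm [measurable]: "w \<in> borel_measurable borel" unfolding w_def[abs_def] by measurable
  have gm [measurable]: "g i r \<in> borel_measurable borel" if "i \<in> I" for i r
    unfolding g_def by (rule measurable_wave_density1[OF J[OF that] b[OF that]])
  have gsupp: "g i r \<rho> = 0" if "i \<in> I" "\<rho> \<notin> {a..c}" for i r \<rho>
    using supp[OF that(1) _ that(2)] by (simp add: g_def wave_density_def)
  have Um: "case_prod U \<in> borel_measurable (borel \<Otimes>\<^sub>M borel)"
  proof -
    have "(\<lambda>z. U (fst z) (snd z)) \<in> borel_measurable (borel \<Otimes>\<^sub>M borel)"
      unfolding U_def
    proof (rule measurable_nn_integral_count_space[OF I])
      fix i assume i: "i \<in> I"
      note [measurable] = J[OF i] b[OF i]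
      show "(\<lambda>z. ennreal ((cmod (strans (g i (snd z)) (fst z)))\<^sup>2)) \<in> borel_measurable (borel \<Otimes>\<^sub>M borel)"
        unfolding strans_def g_def wave_density_def by measurable
    qed
    then show ?thesis by (simp add: case_prod_beta')
  qed
  have Um1: "(\<lambda>r. U t r) \<in> borel_measurable borel" for t
    using measurable_Pair2[OF Um, of t] by simp
  have Um2: "(\<lambda>t. U t r) \<in> borel_measurable borel" for r
    using measurable_Pair1[OF Um, of r] by simp
  have step1: "(\<integral>\<^sup>+t. ennreal_powr (U t r) p \<partial>lborel) \<le> ennreal (2 * pi * (c - a) powr (p - 1)) * ennreal_powr (A r) p" for r
    unfolding U_def A_def by (rule strans_family_Lp[OF I gm gsupp ac(2) p])
  have A: "A r = (\<integral>\<^sup>+i. (\<integral>\<^sup>+\<rho>. \<beta> i \<rho> * k i r \<rho> \<partial>lborel) \<partial>count_space I)" if "r > 0" for r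
    unfolding A_def g_def \<beta>_def k_def by (simp only: wave_density_norm[OF n that])
  have Bb: "B = (\<integral>\<^sup>+i. (\<integral>\<^sup>+\<rho>. \<beta> i \<rho> \<partial>lborel) \<partial>count_space I)" by (simp add: B_def \<beta>_def)
  define N0 where "N0 = count_space I \<Otimes>\<^sub>M (lborel :: real measure)"
  define N where "N = density N0 (\<lambda>z. \<beta> (fst z) (snd z))"
  have m0: "(\<lambda>z. f (fst z) (snd z)) \<in> borel_measurable N0" if "\<And>i. i \<in> I \<Longrightarrow> f i \<in> borel_measurable borel" for f :: "'i \<Rightarrow> real \<Rightarrow> ennreal"
    unfolding N0_def by (rule measurable_pair_measure_countable1[OF I]) (simp add: that)
  have iN: "(\<integral>\<^sup>+z. f (fst z) (snd z) \<partial>N) = (\<integral>\<^sup>+i. (\<integral>\<^sup>+\<rho>. \<beta> i \<rho> * f i \<rho> \<partial>lborel) \<partial>count_space I)"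
    if f: "\<And>i. i \<in> I \<Longrightarrow> f i \<in> borel_measurable borel" for f :: "'i \<Rightarrow> real \<Rightarrow> ennreal"
  proof -
    have "(\<integral>\<^sup>+z. f (fst z) (snd z) \<partial>N) = (\<integral>\<^sup>+z. \<beta> (fst z) (snd z) * f (fst z) (snd z) \<partial>N0)"
      unfolding N_def by (rule nn_integral_density[OF m0[OF \<beta>m] m0[OF f]])
    also have "\<dots> = (\<integral>\<^sup>+i. (\<integral>\<^sup>+\<rho>. \<beta> (fst (i, \<rho>)) (snd (i, \<rho>)) * f (fst (i, \<rho>)) (snd (i, \<rho>)) \<partial>lborel) \<partial>count_space I)"
      unfolding N0_def
      by (rule lborel.nn_integral_fst[symmetric])
         (use m0[of \<beta>, OF \<beta>m] m0[of f, OF f] in \<open>simp add: N0_def borel_measurable_times_ennreal\<close>)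
    finally show ?thesis by simp
  qed
  have NB: "emeasure N (space N) = B"
    using iN[of "\<lambda>_ _. 1"] by (simp add: Bb)
  have Ar: "ennreal_powr (A r) p \<le> ennreal_powr B (p - 1) * ?Phi r"
    if r: "r > 0" and Bf: "B < \<infinity>" "B > 0" for r
  proof -
    obtain B' where B': "B = ennreal B'" "B' > 0" using Bf by (cases B) (auto simp: ennreal_less_zero_iff)
    have "ennreal_powr (\<integral>\<^sup>+z. k (fst z) r (snd z) \<partial>N) p \<le> ennreal (B' powr (p - 1)) * (\<integral>\<^sup>+z. ennreal_powr (k (fst z) r (snd z)) p \<partial>N)"
    proof (rule nn_integral_jensen[OF _ _ B'(2) p])
      show "(\<lambda>z. k (fst z) r (snd z)) \<in> borel_measurable N"
        unfolding N_def using m0[of "\<lambda>i. k i r", OF km] by simp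
      show "emeasure N (space N) = ennreal B'" by (simp add: NB B')
    qed
    moreover have "(\<integral>\<^sup>+z. k (fst z) r (snd z) \<partial>N) = A r"
      unfolding A[OF r] by (rule iN[of "\<lambda>i. k i r", OF km])
    moreover have "(\<integral>\<^sup>+z. ennreal_powr (k (fst z) r (snd z)) p \<partial>N) = ?Phi r"
      by (rule iN[of "\<lambda>i \<rho>. ennreal_powr (k i r \<rho>) p"]) (use km in measurable)
    ultimately show ?thesis using B' by (simp add: ennreal_powr_ennreal)
  qed
  have A0: "A r = 0" if r: "r > 0" and B0: "B = 0" for r
  proof -
    have "emeasure N (space N) = 0" using NB B0 by simp
    then have "(\<integral>\<^sup>+z. k (fst z) r (snd z) \<partial>N) = 0"
      by (intro nn_integral_0_iff_AE[THEN iffD2]) (use m0[of "\<lambda>i. k i r", OF km] in \<open>auto simp: N_def intro!: AE_I'[of "space N"] simp: null_sets_def\<close>)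
    then show ?thesis unfolding A[OF r] using iN[of "\<lambda>i. k i r", OF km] by simp
  qed
  have inner: "(\<integral>\<^sup>+r. w r * ?Phi r \<partial>lborel) \<le> ennreal (K * D) * B"
  proof -
    have jm: "(\<lambda>z. k i (fst z) (snd z)) \<in> borel_measurable (borel \<Otimes>\<^sub>M borel)" if "i \<in> I" for i
      unfolding k_def using J[OF that] by measurable
    have "(\<integral>\<^sup>+r. w r * ?Phi r \<partial>lborel)
      = (\<integral>\<^sup>+r. (\<integral>\<^sup>+i. (\<integral>\<^sup>+\<rho>. ?F i r \<rho> \<partial>lborel) \<partial>count_space I) \<partial>lborel)"
    proof (intro nn_integral_cong)
      fix r
      have "w r * ?Phi r
        = (\<integral>\<^sup>+i. w r * (\<integral>\<^sup>+\<rho>. \<beta> i \<rho> * ennreal_powr (k i r \<rho>) p \<partial>lborel) \<partial>count_space I)"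
        by (rule nn_integral_cmult[symmetric]) simp
      also have "\<dots> = (\<integral>\<^sup>+i. (\<integral>\<^sup>+\<rho>. ?F i r \<rho> \<partial>lborel) \<partial>count_space I)"
      proof (intro nn_integral_cong)
        fix i assume "i \<in> space (count_space I)"
        then have i: "i \<in> I" by simp
        note [measurable] = \<beta>m[OF i] km[OF i]
        show "w r * (\<integral>\<^sup>+\<rho>. \<beta> i \<rho> * ennreal_powr (k i r \<rho>) p \<partial>lborel) = (\<integral>\<^sup>+\<rho>. ?F i r \<rho> \<partial>lborel)"
          by (rule nn_integral_cmult[symmetric]) measurable
      qed
      finally show "w r * ?Phi r
        = (\<integral>\<^sup>+i. (\<integral>\<^sup>+\<rho>. ?F i r \<rho> \<partial>lborel) \<partial>count_space I)" .
    qed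
    also have "\<dots> = (\<integral>\<^sup>+i. (\<integral>\<^sup>+r. (\<integral>\<^sup>+\<rho>. ?F i r \<rho> \<partial>lborel) \<partial>lborel) \<partial>count_space I)"
    proof (rule nn_integral_count_space_nn_integral[OF I])
      fix i assume i: "i \<in> I"
      note [measurable] = \<beta>m[OF i] jm[OF i]
      show "(\<lambda>r. \<integral>\<^sup>+\<rho>. ?F i r \<rho> \<partial>lborel) \<in> borel_measurable lborel"
        unfolding k_def using J[OF i] by measurable
    qed
    also have "\<dots> \<le> (\<integral>\<^sup>+i. (\<integral>\<^sup>+\<rho>. ennreal (K * D) * \<beta> i \<rho> \<partial>lborel) \<partial>count_space I)"
    proof (rule nn_integral_mono)
      fix i assume "i \<in> space (count_space I)"
      then have i: "i \<in> I" by simp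
      note [measurable] = \<beta>m[OF i] J[OF i]
      have "(\<integral>\<^sup>+r. (\<integral>\<^sup>+\<rho>. ?F i r \<rho> \<partial>lborel) \<partial>lborel)
        = (\<integral>\<^sup>+\<rho>. (\<integral>\<^sup>+r. ?F i r \<rho> \<partial>lborel) \<partial>lborel)"
        by (rule lborel_pair.Fubini'[symmetric]) (unfold k_def, measurable)
      also have "\<dots> = (\<integral>\<^sup>+\<rho>. \<beta> i \<rho> * (\<integral>\<^sup>+r. w r * ennreal_powr (k i r \<rho>) p \<partial>lborel) \<partial>lborel)"
      proof (intro nn_integral_cong)
        fix \<rho>
        have "(\<integral>\<^sup>+r. ?F i r \<rho> \<partial>lborel) = (\<integral>\<^sup>+r. \<beta> i \<rho> * (w r * ennreal_powr (k i r \<rho>) p) \<partial>lborel)"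
          by (simp only: mult.left_commute)
        also have "\<dots> = \<beta> i \<rho> * (\<integral>\<^sup>+r. w r * ennreal_powr (k i r \<rho>) p \<partial>lborel)"
          by (rule nn_integral_cmult) (unfold k_def, measurable)
        finally show "(\<integral>\<^sup>+r. ?F i r \<rho> \<partial>lborel) = \<beta> i \<rho> * (\<integral>\<^sup>+r. w r * ennreal_powr (k i r \<rho>) p \<partial>lborel)" .
      qed
      also have "\<dots> \<le> (\<integral>\<^sup>+\<rho>. ennreal (K * D) * \<beta> i \<rho> \<partial>lborel)"
      proof (intro nn_integral_mono)
        fix \<rho>
        show "\<beta> i \<rho> * (\<integral>\<^sup>+r. w r * ennreal_powr (k i r \<rho>) p \<partial>lborel) \<le> ennreal (K * D) * \<beta> i \<rho>"
        proof (cases "\<rho> > 0 \<and> \<rho> \<in> {a..c}")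
          case True
          have "(\<integral>\<^sup>+r. w r * ennreal_powr (k i r \<rho>) p \<partial>lborel) = ennreal (\<rho> powr (-(\<alpha> + 1))) * weighted_moment \<alpha> q (J i)"
            unfolding w_def k_def p_def \<alpha>_def by (rule scaled_bessel_integral[OF J[OF i] _ n]) (use True q in auto)
          also have "\<dots> \<le> ennreal D * ennreal K"
            using True by (intro mult_mono K(2)[OF i] ennreal_leI D(2)) auto
          also have "\<dots> = ennreal (K * D)" using K(1) D(1) by (simp add: ennreal_mult[symmetric] mult.commute)
          finally show ?thesis by (metis mult.commute mult_left_mono zero_le)
        next
          case False
          then have "\<beta> i \<rho> = 0" using supp[OF i, of \<rho>] by (cases "\<rho> > 0") (auto simp: \<beta>_def)
          then show ?thesis by simp
        qed
      qed
      finally show "(\<integral>\<^sup>+r. (\<integral>\<^sup>+\<rho>. ?F i r \<rho> \<partial>lborel) \<partial>lborel) \<le> (\<integral>\<^sup>+\<rho>. ennreal (K * D) * \<beta> i \<rho> \<partial>lborel)" .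
    qed
    also have "\<dots> = (\<integral>\<^sup>+i. ennreal (K * D) * (\<integral>\<^sup>+\<rho>. \<beta> i \<rho> \<partial>lborel) \<partial>count_space I)"
      by (intro nn_integral_cong nn_integral_cmult) (use \<beta>m in auto)
    also have "\<dots> = ennreal (K * D) * B" unfolding Bb by (rule nn_integral_cmult) simp
    finally show ?thesis .
  qed
  have wA: "(\<integral>\<^sup>+r. w r * ennreal_powr (A r) p \<partial>lborel) \<le> ennreal (K * D) * ennreal_powr B p"
  proof -
    have w0: "w r = 0" if "\<not> r > 0" for r using that by (simp add: w_def)
    consider "B = \<infinity>" | "B = 0" | "B < \<infinity>" "B > 0" by (metis less_top not_gr_zero infinity_ennreal_def)
    then show ?thesis
    proof cases
      case 1
      then have "ennreal (K * D) * ennreal_powr B p = \<top>"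
        using K(1) D(1) by (simp add: ennreal_mult_top ennreal_eq_0_iff not_le)
      then show ?thesis by simp
    next
      case 2
      have "w r * ennreal_powr (A r) p = 0" for r using w0[of r] A0[OF _ 2, of r] by (cases "r > 0") auto
      then have "(\<integral>\<^sup>+r. w r * ennreal_powr (A r) p \<partial>lborel) = (\<integral>\<^sup>+r. 0 \<partial>(lborel :: real measure))"
        by (intro nn_integral_cong)
      then show ?thesis by simp
    next
      case 3
      have mm: "(\<lambda>r. w r * ?Phi r) \<in> borel_measurable lborel"
      proof -
        have "(\<lambda>r. \<integral>\<^sup>+i. (\<integral>\<^sup>+\<rho>. \<beta> i \<rho> * ennreal_powr (k i r \<rho>) p \<partial>lborel) \<partial>count_space I) \<in> borel_measurable borel"
        proof (rule measurable_nn_integral_count_space[OF I])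
          fix i assume i: "i \<in> I"
          note [measurable] = \<beta>m[OF i] J[OF i]
          show "(\<lambda>r. \<integral>\<^sup>+\<rho>. \<beta> i \<rho> * ennreal_powr (k i r \<rho>) p \<partial>lborel) \<in> borel_measurable borel"
            unfolding k_def by measurable
        qed
        then show ?thesis by simp
      qed
      have "(\<integral>\<^sup>+r. w r * ennreal_powr (A r) p \<partial>lborel) \<le> (\<integral>\<^sup>+r. ennreal_powr B (p - 1) * (w r * ?Phi r) \<partial>lborel)"
      proof (intro nn_integral_mono)
        fix r
        show "w r * ennreal_powr (A r) p \<le> ennreal_powr B (p - 1) * (w r * ?Phi r)"
        proof (cases "r > 0")
          case True
          from mult_left_mono[OF Ar[OF True 3], of "w r"] show ?thesis by (simp add: mult.left_commute)
        qed (simp add: w0)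
      qed
      also have "\<dots> = ennreal_powr B (p - 1) * (\<integral>\<^sup>+r. w r * ?Phi r \<partial>lborel)"
        by (rule nn_integral_cmult[OF mm])
      also have "\<dots> \<le> ennreal_powr B (p - 1) * (ennreal (K * D) * B)" by (intro mult_left_mono inner) simp
      also have "\<dots> = ennreal (K * D) * ennreal_powr B p" using ennreal_powr_add[of B "p - 1" 1] by (simp add: mult_ac)
      finally show ?thesis .
    qed
  qed
  have "(\<integral>\<^sup>+t. (\<integral>\<^sup>+r. ennreal_powr (U t r) p \<partial>radial_measure n) \<partial>lborel) = (\<integral>\<^sup>+t. (\<integral>\<^sup>+r. w r * ennreal_powr (U t r) p \<partial>lborel) \<partial>lborel)"
    unfolding w_def by (intro nn_integral_cong nn_integral_radial measurable_ennreal_powr Um1)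
  also have "\<dots> = (\<integral>\<^sup>+r. (\<integral>\<^sup>+t. w r * ennreal_powr (U t r) p \<partial>lborel) \<partial>lborel)"
    by (rule lborel_pair.Fubini'[symmetric]) (use Um in measurable)
  also have "\<dots> = (\<integral>\<^sup>+r. w r * (\<integral>\<^sup>+t. ennreal_powr (U t r) p \<partial>lborel) \<partial>lborel)"
    by (intro nn_integral_cong nn_integral_cmult) (use Um2 in measurable)
  also have "\<dots> \<le> (\<integral>\<^sup>+r. ennreal (2 * pi * (c - a) powr (p - 1)) * (w r * ennreal_powr (A r) p) \<partial>lborel)"
  proof (intro nn_integral_mono)
    fix r
    from mult_left_mono[OF step1[of r], of "w r"]
    show "w r * (\<integral>\<^sup>+t. ennreal_powr (U t r) p \<partial>lborel) \<le> ennreal (2 * pi * (c - a) powr (p - 1)) * (w r * ennreal_powr (A r) p)"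
      by (simp add: mult.left_commute)
  qed
  also have "\<dots> = ennreal (2 * pi * (c - a) powr (p - 1)) * (\<integral>\<^sup>+r. w r * ennreal_powr (A r) p \<partial>lborel)"
  proof (rule nn_integral_cmult)
    have "A \<in> borel_measurable borel"
      unfolding A_def[abs_def]
    proof (rule measurable_nn_integral_count_space[OF I])
      fix i assume i: "i \<in> I"
      note [measurable] = b[OF i] J[OF i]
      show "(\<lambda>r. \<integral>\<^sup>+\<rho>. ennreal ((cmod (g i r \<rho>))\<^sup>2) \<partial>lborel) \<in> borel_measurable borel"
        unfolding g_def wave_density_def by measurable
    qed
    then show "(\<lambda>r. w r * ennreal_powr (A r) p) \<in> borel_measurable lborel" by measurable
  qed
  also have "\<dots> \<le> ennreal (2 * pi * (c - a) powr (p - 1)) * (ennreal (K * D) * ennreal_powr B p)"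
    by (intro mult_left_mono wA) simp
  also have "\<dots> = ennreal (2 * pi * (c - a) powr (p - 1) * (K * D)) * ennreal_powr B p"
  proof -
    have "ennreal (2 * pi * (c - a) powr (p - 1) * (K * D)) = ennreal (2 * pi * (c - a) powr (p - 1)) * ennreal (K * D)"
      using K(1) D(1) by (intro ennreal_mult) auto
    then show ?thesis by (simp add: mult.assoc)
  qed
  finally show ?thesis unfolding U_def g_def p_def .
qed

section \<open>Orthonormal series\<close>

definition orthonormal_family :: "'y measure \<Rightarrow> ('i \<Rightarrow> 'y \<Rightarrow> complex) \<Rightarrow> 'i set \<Rightarrow> bool" where
  "orthonormal_family \<mu> e I \<longleftrightarrow> (\<forall>i\<in>I. e i \<in> borel_measurable \<mu>) \<and>
     (\<forall>i\<in>I. \<forall>j\<in>I. integrable \<mu> (\<lambda>y. e i y * cnj (e j y)) \<and> L2_inner \<mu> (e i) (e j) = (if i = j then 1 else 0))"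

lemma orthonormal_sum_norm:
  assumes e: "orthonormal_family \<mu> e I" and F: "finite F" "F \<subseteq> I"
  shows "(\<integral>\<^sup>+y. ennreal ((cmod (\<Sum>i\<in>F. e i y * c i))\<^sup>2) \<partial>\<mu>) = ennreal (\<Sum>i\<in>F. (cmod (c i))\<^sup>2)"
proof -
  have int: "integrable \<mu> (\<lambda>y. e i y * cnj (e j y))" "L2_inner \<mu> (e i) (e j) = (if i = j then 1 else 0)" if "i \<in> F" "j \<in> F" for i j
    using e F(2) that unfolding orthonormal_family_def by blast+
  have eq: "complex_of_real ((cmod (\<Sum>i\<in>F. e i y * c i))\<^sup>2) = (\<Sum>i\<in>F. \<Sum>j\<in>F. (c i * cnj (c j)) * (e i y * cnj (e j y)))" for y
  proof -
    have "complex_of_real ((cmod (\<Sum>i\<in>F. e i y * c i))\<^sup>2) = (\<Sum>i\<in>F. e i y * c i) * cnj (\<Sum>i\<in>F. e i y * c i)"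
      by (rule complex_norm_square)
    also have "\<dots> = (\<Sum>i\<in>F. \<Sum>j\<in>F. (c i * cnj (c j)) * (e i y * cnj (e j y)))"
      unfolding cnj_sum sum_product by (intro sum.cong refl) simp
    finally show ?thesis .
  qed
  have i1: "integrable \<mu> (\<lambda>y. complex_of_real ((cmod (\<Sum>i\<in>F. e i y * c i))\<^sup>2))"
    unfolding eq by (intro Bochner_Integration.integrable_sum integrable_mult_right int)
  have "(\<integral>y. complex_of_real ((cmod (\<Sum>i\<in>F. e i y * c i))\<^sup>2) \<partial>\<mu>) = (\<Sum>i\<in>F. \<Sum>j\<in>F. (c i * cnj (c j)) * L2_inner \<mu> (e i) (e j))"
    unfolding eq L2_inner_def
  proof (subst Bochner_Integration.integral_sum)
    show "integrable \<mu> (\<lambda>y. \<Sum>j\<in>F. (c i * cnj (c j)) * (e i y * cnj (e j y)))" if "i \<in> F" for i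
      using that by (intro Bochner_Integration.integrable_sum integrable_mult_right int)
    show "(\<Sum>i\<in>F. \<integral>y. (\<Sum>j\<in>F. (c i * cnj (c j)) * (e i y * cnj (e j y))) \<partial>\<mu>) = (\<Sum>i\<in>F. \<Sum>j\<in>F. (c i * cnj (c j)) * (\<integral>y. e i y * cnj (e j y) \<partial>\<mu>))"
      by (intro sum.cong refl, subst Bochner_Integration.integral_sum) (auto intro!: integrable_mult_right int)
  qed
  also have "\<dots> = (\<Sum>i\<in>F. \<Sum>j\<in>F. if i = j then c i * cnj (c j) else 0)"
    by (intro sum.cong refl) (simp add: int)
  also have "\<dots> = (\<Sum>i\<in>F. c i * cnj (c i))" using F(1) by (simp add: sum.delta)
  also have "\<dots> = complex_of_real (\<Sum>i\<in>F. (cmod (c i))\<^sup>2)" by (simp only: complex_norm_square[symmetric] of_real_sum)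
  finally have I1: "(\<integral>y. (cmod (\<Sum>i\<in>F. e i y * c i))\<^sup>2 \<partial>\<mu>) = (\<Sum>i\<in>F. (cmod (c i))\<^sup>2)"
    by (simp only: integral_complex_of_real of_real_eq_iff)
  have "integrable \<mu> (\<lambda>y. (cmod (\<Sum>i\<in>F. e i y * c i))\<^sup>2)" using i1 by (simp only: complex_of_real_integrable_eq)
  then show ?thesis by (subst nn_integral_eq_integral) (simp_all add: I1)
qed

lemma Lq_norm_2: "Lq_norm \<mu> 2 (\<lambda>y. ennreal (cmod (h y))) = ennreal_powr (L2_square \<mu> h) (1/2)"
  by (simp add: Lq_norm_def ennreal_powr_ennreal)

lemma has_L2_sum_eventually:
  assumes "has_L2_sum \<mu> g I s" and "\<epsilon> > 0"
  shows "\<forall>\<^sub>F F in finite_subsets_at_top I. (\<integral>\<^sup>+y. ennreal ((cmod (s y - (\<Sum>i\<in>F. g i y)))\<^sup>2) \<partial>\<mu>) \<le> ennreal \<epsilon>"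
proof -
  define d where "d F = (\<integral>\<^sup>+y. ennreal ((cmod (s y - (\<Sum>i\<in>F. g i y)))\<^sup>2) \<partial>\<mu>)" for F
  have "((\<lambda>F. ennreal_powr (d F) (1/2)) \<longlongrightarrow> 0) (finite_subsets_at_top I)"
    using assms(1) unfolding has_L2_sum_def Lq_norm_2 d_def by blast
  moreover have "(0::ennreal) < ennreal (sqrt \<epsilon>)" using assms(2) by (simp add: ennreal_less_zero_iff)
  ultimately have "\<forall>\<^sub>F F in finite_subsets_at_top I. ennreal_powr (d F) (1/2) < ennreal (sqrt \<epsilon>)"
    by (rule order_tendstoD(2))
  then show ?thesis
  proof eventually_elim
    case (elim F)
    have "d F = ennreal_powr (ennreal_powr (d F) (1/2)) 2" by (simp add: ennreal_powr_powr)
    also have "\<dots> \<le> ennreal_powr (ennreal (sqrt \<epsilon>)) 2" using elim by (intro ennreal_powr_mono) auto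
    also have "\<dots> = ennreal \<epsilon>" using assms(2) by (simp add: ennreal_powr_ennreal)
    finally show ?case by (simp add: d_def)
  qed
qed

text \<open>
  For a partial sum \<open>S\<close> one has \<open>|s|^2 \<le> (1 + \<delta>) |S|^2 + (1 + 1/\<delta>) |s - S|^2\<close>, where the last term becomes small for
  fixed \<open>\<delta>\<close>.
\<close>

lemma has_L2_sum_norm_le:
  assumes s: "has_L2_sum \<mu> (\<lambda>i y. e i y * c i) I s" and e: "orthonormal_family \<mu> e I"
  shows "L2_square \<mu> s \<le> (\<integral>\<^sup>+i. ennreal ((cmod (c i))\<^sup>2) \<partial>count_space I)" (is "_ \<le> ?C")
proof (rule ennreal_le_epsilon)
  fix \<eta> :: real assume C: "?C < \<top>" and \<eta>: "0 < \<eta>"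
  have sm: "s \<in> borel_measurable \<mu>" using s by (simp add: has_L2_sum_def)
  obtain C' where C': "?C = ennreal C'" "C' \<ge> 0" using C by (cases ?C) auto
  define \<delta> where "\<delta> = \<eta> / (2 * (C' + 1))"
  have \<delta>: "\<delta> > 0" "\<delta> * C' \<le> \<eta> / 2" using \<eta> C' by (auto simp: \<delta>_def field_simps)
  define \<epsilon> where "\<epsilon> = \<eta> / (2 * (1 + 1/\<delta>))"
  have \<delta>1: "1 + 1/\<delta> > 0" using \<delta> by (intro add_pos_pos) auto
  have "k * (\<eta> / (2 * k)) = \<eta> / 2" if "k > 0" for k using that by simp
  from this[OF \<delta>1] have \<epsilon>: "\<epsilon> > 0" "(1 + 1/\<delta>) * \<epsilon> = \<eta> / 2" using \<eta> \<delta>1 by (simp_all only: \<epsilon>_def) simp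
  have "\<forall>\<^sub>F F in finite_subsets_at_top I. finite F \<and> F \<subseteq> I" by (rule eventually_finite_subsets_at_top_weakI) auto
  with has_L2_sum_eventually[OF s \<epsilon>(1)]
  have "\<forall>\<^sub>F F in finite_subsets_at_top I. (\<integral>\<^sup>+y. ennreal ((cmod (s y - (\<Sum>i\<in>F. e i y * c i)))\<^sup>2) \<partial>\<mu>) \<le> ennreal \<epsilon> \<and> finite F \<and> F \<subseteq> I"
    by (rule eventually_conj)
  then obtain F where F: "(\<integral>\<^sup>+y. ennreal ((cmod (s y - (\<Sum>i\<in>F. e i y * c i)))\<^sup>2) \<partial>\<mu>) \<le> ennreal \<epsilon>" "finite F" "F \<subseteq> I"
    using eventually_happens'[OF finite_subsets_at_top_neq_bot] by blast
  define S where "S y = (\<Sum>i\<in>F. e i y * c i)" for y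
  have Sm: "S \<in> borel_measurable \<mu>"
    unfolding S_def[abs_def] using e F(3) by (intro borel_measurable_sum borel_measurable_times borel_measurable_const) (auto simp: orthonormal_family_def)
  have pt: "ennreal ((cmod (s y))\<^sup>2) \<le> ennreal (1 + \<delta>) * ennreal ((cmod (S y))\<^sup>2) + ennreal (1 + 1/\<delta>) * ennreal ((cmod (s y - S y))\<^sup>2)" for y
  proof -
    define a where "a = cmod (S y)"
    define b where "b = cmod (s y - S y)"
    have "cmod (s y) \<le> a + b" using norm_triangle_ineq[of "S y" "s y - S y"] by (simp add: a_def b_def)
    then have "(cmod (s y))\<^sup>2 \<le> (a + b)\<^sup>2" by (intro power_mono) auto
    also have "\<dots> \<le> (1 + \<delta>) * a\<^sup>2 + (1 + 1/\<delta>) * b\<^sup>2"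
    proof -
      have "0 \<le> (\<delta> * a - b)\<^sup>2 / \<delta>" using \<delta> by simp
      also have "\<dots> = \<delta> * a\<^sup>2 + b\<^sup>2 / \<delta> - 2 * a * b" using \<delta>(1) by (simp add: field_simps power2_eq_square)
      finally show ?thesis by (simp add: power2_sum algebra_simps)
    qed
    finally have "ennreal ((cmod (s y))\<^sup>2) \<le> ennreal ((1 + \<delta>) * a\<^sup>2 + (1 + 1/\<delta>) * b\<^sup>2)" by (rule ennreal_leI)
    also have "\<dots> = ennreal ((1 + \<delta>) * a\<^sup>2) + ennreal ((1 + 1/\<delta>) * b\<^sup>2)" using \<delta> \<delta>1 by (intro ennreal_plus mult_nonneg_nonneg) auto
    also have "\<dots> = ennreal (1 + \<delta>) * ennreal (a\<^sup>2) + ennreal (1 + 1/\<delta>) * ennreal (b\<^sup>2)"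
      using \<delta> \<delta>1 by (intro arg_cong2[where f="(+)"] ennreal_mult) auto
    finally show ?thesis by (simp only: a_def b_def)
  qed
  have fin: "ennreal (\<Sum>i\<in>F. (cmod (c i))\<^sup>2) \<le> ?C"
  proof -
    have "ennreal (\<Sum>i\<in>F. (cmod (c i))\<^sup>2) = (\<Sum>i\<in>F. ennreal ((cmod (c i))\<^sup>2))" by (simp add: sum_ennreal)
    also have "\<dots> = (\<integral>\<^sup>+i. ennreal ((cmod (c i))\<^sup>2) \<partial>count_space F)" using F(2) by (simp add: nn_integral_count_space_finite)
    also have "\<dots> \<le> ?C" using F(3)
      by (auto simp: nn_integral_count_space_indicator intro!: nn_integral_mono split: split_indicator)
    finally show ?thesis .
  qed
  have "L2_square \<mu> s \<le> (\<integral>\<^sup>+y. ennreal (1 + \<delta>) * ennreal ((cmod (S y))\<^sup>2) + ennreal (1 + 1/\<delta>) * ennreal ((cmod (s y - S y))\<^sup>2) \<partial>\<mu>)"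
    by (intro nn_integral_mono pt)
  also have "\<dots> = ennreal (1 + \<delta>) * L2_square \<mu> S + ennreal (1 + 1/\<delta>) * L2_square \<mu> (\<lambda>y. s y - S y)"
    using sm Sm by (simp add: nn_integral_add nn_integral_cmult)
  also have "\<dots> \<le> ennreal (1 + \<delta>) * ennreal C' + ennreal (1 + 1/\<delta>) * ennreal \<epsilon>"
  proof (intro add_mono mult_left_mono)
    show "L2_square \<mu> S \<le> ennreal C'"
      unfolding S_def orthonormal_sum_norm[OF e F(2,3)] using fin C'(1) by simp
    show "L2_square \<mu> (\<lambda>y. s y - S y) \<le> ennreal \<epsilon>"
      unfolding S_def by (rule F(1))
  qed auto
  also have "\<dots> = ennreal ((1 + \<delta>) * C' + (1 + 1/\<delta>) * \<epsilon>)"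
    using \<delta> \<delta>1 C' \<epsilon> by (simp add: ennreal_mult[symmetric] ennreal_plus[symmetric] del: ennreal_plus)
  also have "\<dots> \<le> ennreal (C' + \<eta>)"
    using \<delta>(2) unfolding \<epsilon>(2) by (intro ennreal_leI) (simp add: algebra_simps)
  also have "\<dots> = ?C + ennreal \<eta>" using C' \<eta> by simp
  finally show "L2_square \<mu> s \<le> ?C + ennreal \<eta>" .
qed

lemma has_L2_sum_zero:
  assumes s: "has_L2_sum \<mu> (\<lambda>i y. e i y * c i) I s" and e: "orthonormal_family \<mu> e I"
    and z: "AE y in \<mu>. s y = 0" and j: "j \<in> I"
  shows "c j = 0"
proof -
  have "(cmod (c j))\<^sup>2 \<le> 0 + \<epsilon>" if \<epsilon>: "\<epsilon> > 0" for \<epsilon>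
  proof -
    have 1: "\<forall>\<^sub>F F in finite_subsets_at_top I. finite F \<and> F \<subseteq> I" by (rule eventually_finite_subsets_at_top_weakI) auto
    have 2: "\<forall>\<^sub>F F in finite_subsets_at_top I. j \<in> F"
      unfolding eventually_finite_subsets_at_top using j by (intro exI[of _ "{j}"]) auto
    have "\<forall>\<^sub>F F in finite_subsets_at_top I. (\<integral>\<^sup>+y. ennreal ((cmod (s y - (\<Sum>i\<in>F. e i y * c i)))\<^sup>2) \<partial>\<mu>) \<le> ennreal \<epsilon> \<and> (finite F \<and> F \<subseteq> I) \<and> j \<in> F"
      by (rule eventually_conj[OF has_L2_sum_eventually[OF s \<epsilon>] eventually_conj[OF 1 2]])
    then obtain F where F: "(\<integral>\<^sup>+y. ennreal ((cmod (s y - (\<Sum>i\<in>F. e i y * c i)))\<^sup>2) \<partial>\<mu>) \<le> ennreal \<epsilon>" "finite F" "F \<subseteq> I" "j \<in> F"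
      using eventually_happens'[OF finite_subsets_at_top_neq_bot] by blast
    have "(\<integral>\<^sup>+y. ennreal ((cmod (s y - (\<Sum>i\<in>F. e i y * c i)))\<^sup>2) \<partial>\<mu>) = (\<integral>\<^sup>+y. ennreal ((cmod (\<Sum>i\<in>F. e i y * c i))\<^sup>2) \<partial>\<mu>)"
      by (rule nn_integral_cong_AE) (use z in eventually_elim, simp)
    also have "\<dots> = ennreal (\<Sum>i\<in>F. (cmod (c i))\<^sup>2)" by (rule orthonormal_sum_norm[OF e F(2,3)])
    finally have "ennreal (\<Sum>i\<in>F. (cmod (c i))\<^sup>2) \<le> ennreal \<epsilon>" using F(1) by simp
    then have "(\<Sum>i\<in>F. (cmod (c i))\<^sup>2) \<le> \<epsilon>" using \<epsilon> by (simp add: ennreal_le_iff)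
    moreover have "(cmod (c j))\<^sup>2 \<le> (\<Sum>i\<in>F. (cmod (c i))\<^sup>2)" using F by (intro member_le_sum) auto
    ultimately show ?thesis by simp
  qed
  then have "(cmod (c j))\<^sup>2 \<le> 0" by (rule field_le_epsilon)
  then show ?thesis by simp
qed

text \<open>
  Only countably many modes carry energy; restricted to them the counting measure is sigma-finite and Fubini's theorem
  applies.
\<close>

lemma countable_support_of_finite_nn_integral:
  assumes "(\<integral>\<^sup>+i. f i \<partial>count_space I) < \<infinity>"
  shows "countable {i \<in> I. f i \<noteq> (0::ennreal)}"
proof -
  have fin: "finite {i \<in> I. f i \<ge> ennreal (1 / real (Suc m))}" for m
  proof -
    have "emeasure (count_space I) ({i \<in> I. 1 \<le> ennreal (real (Suc m)) * f i}) \<le> ennreal (real (Suc m)) * (\<integral>\<^sup>+i. f i * indicator I i \<partial>count_space I)"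
      using nn_integral_Markov_inequality[of f I "count_space I" "ennreal (real (Suc m))"] by simp
    also have "\<dots> < \<infinity>" using assms by (simp add: ennreal_mult_less_top cong: nn_integral_cong_simp)
    finally have "finite {i \<in> I. 1 \<le> ennreal (real (Suc m)) * f i}"
      by (metis (no_types, lifting) emeasure_count_space_infinite infinity_ennreal_def less_irrefl mem_Collect_eq subsetI)
    moreover have "{i \<in> I. f i \<ge> ennreal (1 / real (Suc m))} \<subseteq> {i \<in> I. 1 \<le> ennreal (real (Suc m)) * f i}"
    proof safe
      fix i assume "ennreal (1 / real (Suc m)) \<le> f i"
      then have "ennreal (real (Suc m)) * ennreal (1 / real (Suc m)) \<le> ennreal (real (Suc m)) * f i" by (rule mult_left_mono) simp
      then show "1 \<le> ennreal (real (Suc m)) * f i" by (simp add: ennreal_mult[symmetric] del: of_nat_Suc)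
    qed
    ultimately show ?thesis by (rule finite_subset[rotated])
  qed
  have "{i \<in> I. f i \<noteq> 0} \<subseteq> (\<Union>m. {i \<in> I. f i \<ge> ennreal (1 / real (Suc m))})"
  proof
    fix i assume i: "i \<in> {i \<in> I. f i \<noteq> 0}"
    then have "0 < f i" by (simp add: zero_less_iff_neq_zero)
    then obtain r where r: "0 < r" "ennreal r < f i"
      by (metis ennreal_less_zero_iff ennreal_cases dense less_top ennreal_neq_top order_less_le_trans not_less zero_le less_imp_le)
    obtain m where "inverse (real (Suc m)) < r" using reals_Archimedean[OF r(1)] by auto
    then have "ennreal (1 / real (Suc m)) \<le> ennreal r" by (intro ennreal_leI) (simp add: divide_inverse)
    then have "ennreal (1 / real (Suc m)) \<le> f i" using r(2) by simp
    then show "i \<in> (\<Union>m. {i \<in> I. f i \<ge> ennreal (1 / real (Suc m))})" using i by blast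
  qed
  moreover have "countable (\<Union>m. {i \<in> I. f i \<ge> ennreal (1 / real (Suc m))})"
    using fin by (intro countable_UN) (auto intro: countable_finite)
  ultimately show ?thesis by (rule countable_subset)
qed

section \<open>The estimate on the cone\<close>

context closed_manifold begin

lemma cone_function_measurable:
  assumes "smooth_on_cone Y f"
  shows "(\<lambda>z. indicator {0<..} (fst z) *\<^sub>R f (fst z) (snd z)) \<in> borel_measurable (borel \<Otimes>\<^sub>M borel)"
proof -
  define S where "S = {0::real<..} \<times> (UNIV :: 'y set)"
  have oS: "open S" unfolding S_def by (intro open_Times) auto
  have "continuous_on S (\<lambda>z. f (fst z) (snd z))"
  proof (rule continuous_at_imp_continuous_on, rule ballI)
    fix z assume z: "z \<in> S"
    obtain c where c: "c \<in> charts Y" "snd z \<in> fst c" using charts_cover by blast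
    define T where "T = {0::real<..} \<times> fst c"
    have oT: "open T" unfolding T_def by (intro open_Times chart_open(1)[OF c(1)]) auto
    have "smooth_on ({0<..} \<times> coord_image c) (\<lambda>(r, x). f r (coord_inv c x))"
      using assms c(1) unfolding smooth_on_cone_def by blast
    then have "Ck_on 0 ({0<..} \<times> coord_image c) (\<lambda>(r, x). f r (coord_inv c x))" unfolding smooth_on_def by blast
    then have cc: "continuous_on ({0<..} \<times> coord_image c) (\<lambda>(r, x). f r (coord_inv c x))" by simp
    have "continuous_on T (\<lambda>z. (fst z, snd c (snd z)))"
      by (intro continuous_on_Pair continuous_on_fst continuous_on_id continuous_on_compose2[OF chart_cont(1)[OF c(1)] continuous_on_snd[OF continuous_on_id]])
         (auto simp: T_def)
    moreover have "(\<lambda>z. (fst z, snd c (snd z))) ` T \<subseteq> {0<..} \<times> coord_image c"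
      using chart_mem(1)[OF c(1)] by (auto simp: T_def)
    ultimately have "continuous_on T (\<lambda>z. case (fst z, snd c (snd z)) of (r, x) \<Rightarrow> f r (coord_inv c x))"
      by (rule continuous_on_compose2[OF cc])
    then have "continuous_on T (\<lambda>z. f (fst z) (snd z))"
      by (rule continuous_on_eq) (auto simp: T_def chart_inv(1)[OF c(1)])
    moreover have "z \<in> T" using z c(2) by (auto simp: T_def S_def)
    ultimately show "isCont (\<lambda>z. f (fst z) (snd z)) z" using oT by (simp add: continuous_on_eq_continuous_at)
  qed
  from borel_measurable_continuous_on_indicator[OF borel_open[OF oS] this]
  have "(\<lambda>z. indicator S z *\<^sub>R f (fst z) (snd z)) \<in> borel_measurable (borel \<Otimes>\<^sub>M borel)" by (simp add: borel_prod)
  moreover have "indicator S z *\<^sub>R f (fst z) (snd z) = indicator {0<..} (fst z) *\<^sub>R f (fst z) (snd z)" for z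
    by (cases z) (auto simp: S_def indicator_def)
  ultimately show ?thesis by simp
qed

lemma hankel_coeff_measurable:
  assumes f: "smooth_on_cone Y f" and e: "continuous_on UNIV (e (fst i) (snd i))"
  shows "hankel_coeff Y n e f i \<in> borel_measurable borel"
proof -
  interpret finite_measure "vol Y" by (rule finite_measure_vol)
  define \<nu> where "\<nu> = fst i"
  define ei where "ei = e (fst i) (snd i)"
  define F where "F r y = indicator {0<..} r *\<^sub>R f r y" for r :: real and y
  have [measurable]: "ei \<in> borel_measurable borel" unfolding ei_def by (rule borel_measurable_continuous_onI[OF e])
  have Fm0: "(\<lambda>z. F (fst z) (snd z)) \<in> borel_measurable (borel \<Otimes>\<^sub>M vol Y)"
    unfolding F_def using cone_function_measurable[OF f] by (simp cong: measurable_cong_sets sets_pair_measure_cong)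
  have [measurable]: "case_prod F \<in> borel_measurable (borel \<Otimes>\<^sub>M vol Y)" using Fm0 by (simp add: case_prod_beta')
  define A where "A r = (\<integral>y. F r y * cnj (ei y) \<partial>vol Y)" for r
  have [measurable]: "A \<in> borel_measurable borel" unfolding A_def[abs_def] by measurable
  have "hankel_coeff Y n e f i \<rho> = (\<integral>r. indicator {0<..} r *\<^sub>R (complex_of_real (hankel_kernel n \<nu> (r * \<rho>)) * A r * complex_of_real (r ^ (n - 1))) \<partial>lborel)" for \<rho>
    unfolding hankel_coeff_def hankel_def set_lebesgue_integral_def
    by (intro Bochner_Integration.integral_cong refl) (auto simp: indicator_def L2_inner_def A_def F_def ei_def \<nu>_def)
  then have "hankel_coeff Y n e f i = (\<lambda>\<rho>. \<integral>r. indicator {0<..} r *\<^sub>R (complex_of_real (hankel_kernel n \<nu> (r * \<rho>)) * A r * complex_of_real (r ^ (n - 1))) \<partial>lborel)"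
    by (rule ext)
  also have "\<dots> \<in> borel_measurable borel" unfolding hankel_kernel_def by measurable
  finally show ?thesis .
qed

lemma orthonormal_modes:
  assumes "orthonormal_eigenbases Y V0 n d e"
  shows "orthonormal_family (vol Y) (\<lambda>i. e (fst i) (snd i)) (mode_index Y V0 n d)"
    and "i \<in> mode_index Y V0 n d \<Longrightarrow> continuous_on UNIV (e (fst i) (snd i))"
proof -
  have ev: "e (fst i) (snd i) \<in> eigenspace Y V0 n ((fst i)\<^sup>2)" "fst i > 0" if "i \<in> mode_index Y V0 n d" for i
    using assms that by (auto simp: orthonormal_eigenbases_def mode_index_def Lambda_inf_def)
  show ct: "continuous_on UNIV (e (fst i) (snd i))" if "i \<in> mode_index Y V0 n d" for i
    by (rule eigenspace_continuous[OF ev(1)[OF that]])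
  have ip: "L2_inner (vol Y) (e (fst i) (snd i)) (e (fst j) (snd j)) = (if i = j then 1 else 0)"
    if i: "i \<in> mode_index Y V0 n d" and j: "j \<in> mode_index Y V0 n d" for i j
  proof (cases "fst i = fst j")
    case True
    have "\<forall>l\<in>{1..d (fst j)}. \<forall>l'\<in>{1..d (fst j)}. L2_inner (vol Y) (e (fst j) l) (e (fst j) l') = (if l = l' then 1 else 0)"
      using assms j unfolding orthonormal_eigenbases_def mode_index_def by auto
    moreover have "snd i \<in> {1..d (fst j)}" "snd j \<in> {1..d (fst j)}" using i j True by (auto simp: mode_index_def)
    ultimately show ?thesis using True by (simp add: prod_eq_iff)
  next
    case False
    then have "(fst i)\<^sup>2 \<noteq> (fst j)\<^sup>2" using ev(2)[OF i] ev(2)[OF j] by (auto simp: power2_eq_iff)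
    then have "L2_inner (vol Y) (e (fst i) (snd i)) (e (fst j) (snd j)) = 0"
      by (rule eigenfunctions_orthogonal[OF ev(1)[OF i] ev(1)[OF j]])
    then show ?thesis using False by auto
  qed
  have "integrable (vol Y) (\<lambda>y. e (fst i) (snd i) y * cnj (e (fst j) (snd j) y))"
    if "i \<in> mode_index Y V0 n d" "j \<in> mode_index Y V0 n d" for i j
    by (intro continuous_integrable continuous_intros ct that)
  moreover have "e (fst i) (snd i) \<in> borel_measurable (vol Y)" if "i \<in> mode_index Y V0 n d" for i
    using borel_measurable_continuous_onI[OF ct[OF that]] by simp
  ultimately show "orthonormal_family (vol Y) (\<lambda>i. e (fst i) (snd i)) (mode_index Y V0 n d)"
    unfolding orthonormal_family_def using ip by blast
qed

end

lemma strans_wave_density: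
  "(LINT \<rho>:{0<..}|lborel. of_real (hankel_kernel n \<nu> (r * \<rho>) * sin (t * \<rho>)) * b \<rho> * of_real (\<rho> ^ (n - 2)))
    = strans (wave_density n (bessel_J \<nu>) b r) t"
  unfolding set_lebesgue_integral_def strans_def
  by (intro Bochner_Integration.integral_cong refl) (auto simp: indicator_def wave_density_def hankel_kernel_def)

lemma radial_energy_density:
  assumes "n \<ge> 2" and [measurable]: "b \<in> borel_measurable borel"
  shows "(\<integral>\<^sup>+\<rho>. ennreal ((\<rho> powr (-1/2) * cmod (b \<rho>))\<^sup>2) \<partial>radial_measure n)
    = (\<integral>\<^sup>+\<rho>. ennreal (indicator {0<..} \<rho> * ((cmod (b \<rho>))\<^sup>2 * \<rho> ^ (n - 2))) \<partial>lborel)"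
proof -
  have "ennreal (indicator {0<..} \<rho> * \<rho> ^ (n - 1)) * ennreal ((\<rho> powr (-1/2) * cmod (b \<rho>))\<^sup>2)
     = ennreal (indicator {0<..} \<rho> * ((cmod (b \<rho>))\<^sup>2 * \<rho> ^ (n - 2)))" for \<rho>
  proof (cases "\<rho> > 0")
    case True
    have "(\<rho> powr (-1/2))\<^sup>2 = \<rho> powr (-1/2 + -1/2)" unfolding power2_eq_square powr_add by (rule refl)
    also have "\<dots> = inverse \<rho>" using True by (simp add: powr_minus)
    finally have h: "(\<rho> powr (-1/2))\<^sup>2 = inverse \<rho>" .
    have "n - 1 = Suc (n - 2)" using assms(1) by simp
    then have "\<rho> ^ (n - 1) * (inverse \<rho> * (cmod (b \<rho>))\<^sup>2) = (cmod (b \<rho>))\<^sup>2 * \<rho> ^ (n - 2)" using True by simp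
    then have "\<rho> ^ (n - 1) * (\<rho> powr (-1/2) * cmod (b \<rho>))\<^sup>2 = (cmod (b \<rho>))\<^sup>2 * \<rho> ^ (n - 2)"
      by (simp only: power_mult_distrib h)
    moreover have "ennreal (\<rho> ^ (n - 1)) * ennreal ((\<rho> powr (-1/2) * cmod (b \<rho>))\<^sup>2) = ennreal (\<rho> ^ (n - 1) * (\<rho> powr (-1/2) * cmod (b \<rho>))\<^sup>2)"
      using True by (intro ennreal_mult[symmetric]) auto
    ultimately show ?thesis using True by simp
  qed simp
  then show ?thesis by (subst nn_integral_radial) simp_all
qed

text \<open>
  The last inequality says \<open>q > (6n - 4) / (3n - 4)\<close> and follows from \<open>q > 2n / (n - 1)\<close>, which is the larger bound
  for \<open>n \<ge> 2\<close>, with equality for \<open>n = 2\<close>.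
\<close>

lemma exponent_conditions:
  fixes q \<nu>0 :: real
  assumes n: "n \<ge> 2" and q: "q > 2 * real n / (real n - 1)" and "\<nu>0 > 0"
    and q2: "\<nu>0 < (real n - 2) / 2 \<Longrightarrow> q < 2 * real n / (real n - 2 - 2 * \<nu>0)"
  defines "\<alpha> \<equiv> real n - 1 - q * (real n - 2) / 2"
  shows "q > 2" "\<alpha> + 1 + \<nu>0 * q > 0" "\<alpha> + 1 - q/2 < 0" "\<alpha> + 1/3 - q/3 < 0"
proof -
  have n1: "real n \<ge> 2" "real n - 1 > 0" using n by auto
  have qn: "2 * real n < q * (real n - 1)" using q n1 by (simp add: pos_divide_less_eq)
  have "2 * (real n - 1) < q * (real n - 1)" using qn by simp
  then show q2': "q > 2" by (simp only: mult_less_cancel_right_pos[OF n1(2)])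
  show "\<alpha> + 1 - q/2 < 0" using qn by (simp add: \<alpha>_def field_simps)
  show "\<alpha> + 1/3 - q/3 < 0"
  proof -
    have "(6 * real n - 4) * (real n - 1) \<le> 2 * real n * (3 * real n - 4)" using n1 by (simp add: algebra_simps)
    also have "\<dots> < q * (real n - 1) * (3 * real n - 4)" using qn n1 by (intro mult_strict_right_mono) auto
    finally have "(6 * real n - 4) * (real n - 1) < (q * (3 * real n - 4)) * (real n - 1)" by (simp add: mult_ac)
    then have "6 * real n - 4 < q * (3 * real n - 4)" using n1 by simp
    then show ?thesis by (simp add: \<alpha>_def field_simps)
  qed
  show "\<alpha> + 1 + \<nu>0 * q > 0"
  proof (cases "\<nu>0 < (real n - 2) / 2")
    case True
    then have p: "real n - 2 - 2 * \<nu>0 > 0" by simp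
    have "q * (real n - 2 - 2 * \<nu>0) < 2 * real n" using q2[OF True] p by (simp add: pos_less_divide_eq)
    then show ?thesis by (simp add: \<alpha>_def field_simps)
  next
    case False
    then have "q * ((real n - 2) / 2) \<le> q * \<nu>0" using q2' by (intro mult_left_mono) auto
    then show ?thesis using n1 by (simp add: \<alpha>_def mult.commute)
  qed
qed

theorem mainTheorem3:
  fixes Y :: "('y::{t2_space, second_countable_topology}, 'm::finite) riem_manifold"
    and V0 :: "'y \<Rightarrow> real"
    and n :: nat
    and d :: "real \<Rightarrow> nat"
    and e :: "real \<Rightarrow> nat \<Rightarrow> 'y \<Rightarrow> complex"
    and \<nu>0 q C0 :: real
  assumes "n \<ge> 2"
    and "CARD('m) = n - 1"
    and "closed_riemannian_manifold Y"
    and "smooth_map Y V0"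
    and "strictly_positive_link_op Y V0 n"
    and "\<nu>0 > 0"
    and "smallest_eigenvalue Y V0 n (\<nu>0\<^sup>2)"
    and "orthonormal_eigenbases Y V0 n d e"
    and "q > 2 * real n / (real n - 1)"
    and "\<nu>0 < (real n - 2) / 2 \<Longrightarrow> q < 2 * real n / (real n - 2 - 2 * \<nu>0)"
    and "C0 > 1"
  shows "\<exists>C>0. \<forall>M>0. \<forall>f fhat u.
           schwartz_on_cone Y f \<longrightarrow>
           is_distorted_FT Y V0 n d e f fhat \<longrightarrow>
           (\<forall>\<rho>>0. \<rho> \<notin> {M / C0 .. C0 * M} \<longrightarrow> (AE \<omega> in vol Y. fhat \<rho> \<omega> = 0)) \<longrightarrow>
           is_wave_solution Y V0 n d e f u \<longrightarrow>
           mixed_norm Y n q u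
             \<le> ennreal (C * M powr ((real n - 1) / 2 - (real n + 1) / q)) *
               H_minus_half_norm Y V0 n d e f"
proof -
  interpret closed_manifold Y by unfold_locales fact
  define \<alpha> where "\<alpha> = real n - 1 - q * (real n - 2) / 2"
  note ex = exponent_conditions[OF assms(1,9,6,10), folded \<alpha>_def]
  have q0: "q > 0" using ex(1) by simp
  obtain K where K: "K > 0" "\<And>\<nu>. \<nu> \<ge> \<nu>0 \<Longrightarrow> weighted_moment \<alpha> q (bessel_J \<nu>) \<le> ennreal K"
    using bessel_integral_uniform[OF assms(6) q0 ex(2,3,4)] by blast
  define MI where "MI = mode_index Y V0 n d"
  note on = orthonormal_modes(1)[OF assms(8), folded MI_def] and ec = orthonormal_modes(2)[OF assms(8), folded MI_def]
  have nu: "fst i \<ge> \<nu>0" if "i \<in> MI" for i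
  proof -
    have "fst i > 0" "is_eigenvalue Y V0 n ((fst i)\<^sup>2)" using that by (auto simp: MI_def mode_index_def Lambda_inf_def)
    then have "\<nu>0\<^sup>2 \<le> (fst i)\<^sup>2" using assms(7) by (auto simp: smallest_eigenvalue_def)
    then show ?thesis using \<open>fst i > 0\<close> by (intro power2_le_imp_le[of \<nu>0]) auto
  qed
  define C where "C = (2 * pi * C0 powr (q/2 - 1) * (K * C0 powr \<bar>\<alpha> + 1\<bar>)) powr (1/q)"
  have C: "C > 0" using K(1) assms(11) by (simp add: C_def)
  have main: "mixed_norm Y n q u \<le> ennreal (C * M powr ((real n - 1) / 2 - (real n + 1) / q)) * H_minus_half_norm Y V0 n d e f"
    if M: "M > 0" and f: "schwartz_on_cone Y f" and fh: "is_distorted_FT Y V0 n d e f fhat"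
      and supp: "\<forall>\<rho>>0. \<rho> \<notin> {M / C0 .. C0 * M} \<longrightarrow> (AE \<omega> in vol Y. fhat \<rho> \<omega> = 0)"
      and u: "is_wave_solution Y V0 n d e f u" for M f fhat u
  proof -
    define b where "b = hankel_coeff Y n e f"
    have bm: "b i \<in> borel_measurable borel" if "i \<in> MI" for i
      unfolding b_def using f by (intro hankel_coeff_measurable ec[OF that]) (simp add: schwartz_on_cone_def)
    have b0: "b i \<rho> = 0" if i: "i \<in> MI" and \<rho>: "\<rho> > 0" "\<rho> \<notin> {M / C0 .. C0 * M}" for i \<rho>
    proof -
      have "has_L2_sum (vol Y) (\<lambda>i \<omega>. e (fst i) (snd i) \<omega> * b i \<rho>) MI (fhat \<rho>)"
        using fh \<rho>(1) by (simp add: is_distorted_FT_def b_def MI_def)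
      then show ?thesis by (rule has_L2_sum_zero[OF _ on _ i]) (use supp \<rho> in blast)
    qed
    define E where "E i = (\<integral>\<^sup>+\<rho>. ennreal (indicator {0<..} \<rho> * ((cmod (b i \<rho>))\<^sup>2 * \<rho> ^ (n - 2))) \<partial>lborel)" for i
    have EH: "H_minus_half_norm Y V0 n d e f = ennreal_powr (\<integral>\<^sup>+i. E i \<partial>count_space MI) (1/2)"
    proof -
      have "(\<integral>\<^sup>+i. (\<integral>\<^sup>+\<rho>. ennreal ((\<rho> powr (-1/2) * cmod (b i \<rho>))\<^sup>2) \<partial>radial_measure n) \<partial>count_space MI) = (\<integral>\<^sup>+i. E i \<partial>count_space MI)"
        unfolding E_def by (intro nn_integral_cong radial_energy_density assms(1) bm) simp
      then show ?thesis unfolding H_minus_half_norm_def b_def MI_def by simp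
    qed
    show ?thesis
    proof (cases "(\<integral>\<^sup>+i. E i \<partial>count_space MI) < \<infinity>")
      case False
      \<comment> \<open>For data of infinite norm the right-hand side is infinite, as the constant is positive.\<close>
      then have "(\<integral>\<^sup>+i. E i \<partial>count_space MI) = \<top>" by (simp add: not_less top_unique)
      moreover have "C * M powr ((real n - 1) / 2 - (real n + 1) / q) > 0" using C M by simp
      ultimately have "ennreal (C * M powr ((real n - 1) / 2 - (real n + 1) / q)) * H_minus_half_norm Y V0 n d e f = \<top>"
        unfolding EH by (simp add: ennreal_mult_top ennreal_eq_0_iff not_le)
      then show ?thesis by simp
    next
      case True
      \<comment> \<open>Modes outside \<open>I\<close> vanish almost everywhere in \<open>\<rho>\<close>, and with them their part of the solution.\<close>
      define I where "I = {i \<in> MI. E i \<noteq> 0}"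
      have I: "countable I" "I \<subseteq> MI" unfolding I_def using countable_support_of_finite_nn_integral[OF True] by auto
      define c where "c t r i = strans (wave_density n (bessel_J (fst i)) (b i) r) t" for t r i
      have c0: "c t r i = 0" if "i \<in> MI" "i \<notin> I" for t r i
      proof -
        note [measurable] = bm[OF that(1)]
        have "E i = 0" using that by (simp add: I_def)
        then have "AE \<rho> in lborel. ennreal (indicator {0<..} \<rho> * ((cmod (b i \<rho>))\<^sup>2 * \<rho> ^ (n - 2))) = 0"
          unfolding E_def by (subst (asm) nn_integral_0_iff_AE) auto
        then have "AE \<rho> in lborel. complex_of_real (sin (t * \<rho>)) * wave_density n (bessel_J (fst i)) (b i) r \<rho> = 0"
        proof eventually_elim
          case (elim \<rho>)
          show ?case
          proof (cases "\<rho> > 0")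
            case True
            then have "(cmod (b i \<rho>))\<^sup>2 * \<rho> ^ (n - 2) \<le> 0" using elim by (simp add: ennreal_eq_0_iff)
            moreover have "\<rho> ^ (n - 2) > 0" using True by simp
            ultimately have "b i \<rho> = 0" by (simp add: mult_le_0_iff)
            then show ?thesis by (simp add: wave_density_def)
          qed (simp add: wave_density_def)
        qed
        then show ?thesis unfolding c_def strans_def by (rule integral_eq_zero_AE)
      qed
      define S where "S t r = (\<integral>\<^sup>+i. ennreal ((cmod (c t r i))\<^sup>2) \<partial>count_space I)" for t r
      have u2: "Lq_norm (vol Y) 2 (\<lambda>\<theta>. ennreal (cmod (u t r \<theta>))) \<le> ennreal_powr (S t r) (1/2)" if r: "r > 0" for t r
      proof -
        have "has_L2_sum (vol Y) (\<lambda>i \<theta>. e (fst i) (snd i) \<theta> * c t r i) MI (u t r)"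
          using u r unfolding is_wave_solution_def strans_wave_density c_def b_def MI_def by blast
        then have "L2_square (vol Y) (u t r) \<le> (\<integral>\<^sup>+i. ennreal ((cmod (c t r i))\<^sup>2) \<partial>count_space MI)"
          by (rule has_L2_sum_norm_le[OF _ on])
        also have "\<dots> = S t r"
          unfolding S_def by (rule nn_integral_count_space_eq) (use I(2) c0 in auto)
        finally show ?thesis unfolding Lq_norm_2 by (intro ennreal_powr_mono) auto
      qed
      define R where "R = (\<integral>\<^sup>+t. (\<integral>\<^sup>+r. ennreal_powr (S t r) (q/2) \<partial>radial_measure n) \<partial>lborel)"
      have "mixed_norm Y n q u \<le> ennreal_powr R (1/q)"
      proof -
        have rad: "AE r in radial_measure n. r > 0"
          unfolding radial_measure_def by (subst AE_density) (auto simp: indicator_def)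
        have in1: "(\<integral>\<^sup>+r. ennreal_powr (Lq_norm (vol Y) 2 (\<lambda>\<theta>. ennreal (cmod (u t r \<theta>)))) q \<partial>radial_measure n)
           \<le> (\<integral>\<^sup>+r. ennreal_powr (S t r) (q/2) \<partial>radial_measure n)" for t
        proof (rule nn_integral_mono_AE, use rad in eventually_elim)
          fix r :: real assume r: "r > 0"
          have "ennreal_powr (Lq_norm (vol Y) 2 (\<lambda>\<theta>. ennreal (cmod (u t r \<theta>)))) q \<le> ennreal_powr (ennreal_powr (S t r) (1/2)) q"
            by (intro ennreal_powr_mono u2[OF r]) (use q0 in auto)
          then show "ennreal_powr (Lq_norm (vol Y) 2 (\<lambda>\<theta>. ennreal (cmod (u t r \<theta>)))) q \<le> ennreal_powr (S t r) (q/2)"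
            by (simp add: ennreal_powr_powr)
        qed
        have "mixed_norm Y n q u = ennreal_powr (\<integral>\<^sup>+t. (\<integral>\<^sup>+r. ennreal_powr (Lq_norm (vol Y) 2 (\<lambda>\<theta>. ennreal (cmod (u t r \<theta>)))) q \<partial>radial_measure n) \<partial>lborel) (1/q)"
          unfolding mixed_norm_def Lq_norm_def[of lborel] Lq_norm_def[of "radial_measure n"] ennreal_powr_powr using q0 by simp
        also have "\<dots> \<le> ennreal_powr R (1/q)"
          unfolding R_def by (intro ennreal_powr_mono nn_integral_mono in1) (use q0 in simp)
        finally show ?thesis .
      qed
      also have "R \<le> ennreal (2 * pi * (C0 * M - M / C0) powr (q/2 - 1) * (K * (C0 powr \<bar>\<alpha> + 1\<bar> * M powr (-(\<alpha> + 1)))))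
          * ennreal_powr (\<integral>\<^sup>+i. E i \<partial>count_space I) (q/2)"
        unfolding R_def S_def c_def E_def \<alpha>_def
      proof (rule wave_family_estimate[OF assms(1) ex(1) I(1)])
        show "bessel_J (fst i) \<in> borel_measurable borel" for i :: "real \<times> nat" by simp
        show "b i \<in> borel_measurable borel" if "i \<in> I" for i using bm that I(2) by blast
        show "0 < M / C0" using M assms(11) by simp
        show "M / C0 < C0 * M"
        proof -
          have "M / C0 < M" using M assms(11) by (simp add: divide_less_eq)
          also have "M < C0 * M" using M assms(11) by simp
          finally show ?thesis .
        qed
        show "b i \<rho> = 0" if "i \<in> I" "\<rho> > 0" "\<rho> \<notin> {M / C0..C0 * M}" for i \<rho> using b0 that I(2) by blast
        show "K > 0" by fact
        show "(\<integral>\<^sup>+r. ennreal (r powr (real n - 1 - q * (real n - 2) / 2) * \<bar>bessel_J (fst i) r\<bar> powr q) * indicator {0<..} r \<partial>lborel) \<le> ennreal K"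
          if "i \<in> I" for i using K(2)[of "fst i"] nu[of i] that I(2) unfolding \<alpha>_def by blast
        show "0 < C0 powr \<bar>real n - 1 - q * (real n - 2) / 2 + 1\<bar> * M powr - (real n - 1 - q * (real n - 2) / 2 + 1)"
          using assms(11) M by simp
        show "\<rho> powr - (real n - 1 - q * (real n - 2) / 2 + 1) \<le> C0 powr \<bar>real n - 1 - q * (real n - 2) / 2 + 1\<bar> * M powr - (real n - 1 - q * (real n - 2) / 2 + 1)"
          if \<rho>: "M / C0 \<le> \<rho>" "\<rho> \<le> C0 * M" for \<rho>
          unfolding \<alpha>_def[symmetric]
        proof (cases "\<alpha> + 1 \<ge> 0")
          case True
          have "\<rho> powr (-(\<alpha> + 1)) \<le> (M / C0) powr (-(\<alpha> + 1))" using True \<rho> M assms(11) by (intro powr_mono2') auto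
          also have "\<dots> = C0 powr (\<alpha> + 1) * M powr (-(\<alpha> + 1))" unfolding powr_divide powr_minus_divide[of C0 "\<alpha> + 1"] by simp
          finally show "\<rho> powr (-(\<alpha> + 1)) \<le> C0 powr \<bar>\<alpha> + 1\<bar> * M powr (-(\<alpha> + 1))" using True by simp
        next
          case False
          have "\<rho> > 0" using \<rho>(1) M assms(11) by (smt (verit) divide_pos_pos)
          then have "\<rho> powr (-(\<alpha> + 1)) \<le> (C0 * M) powr (-(\<alpha> + 1))" using False \<rho> by (intro powr_mono2) auto
          also have "\<dots> = C0 powr (-(\<alpha> + 1)) * M powr (-(\<alpha> + 1))" by (rule powr_mult)
          finally show "\<rho> powr (-(\<alpha> + 1)) \<le> C0 powr \<bar>\<alpha> + 1\<bar> * M powr (-(\<alpha> + 1))" using False by simp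
        qed
      qed
      also have "(\<integral>\<^sup>+i. E i \<partial>count_space I) = (\<integral>\<^sup>+i. E i \<partial>count_space MI)"
        by (rule nn_integral_count_space_eq) (auto simp: I_def)
      finally have fin: "mixed_norm Y n q u \<le> ennreal_powr (ennreal (2 * pi * (C0 * M - M / C0) powr (q/2 - 1) * (K * (C0 powr \<bar>\<alpha> + 1\<bar> * M powr (-(\<alpha> + 1)))))
          * ennreal_powr (\<integral>\<^sup>+i. E i \<partial>count_space MI) (q/2)) (1/q)"
        using q0 by (simp add: ennreal_powr_mono)
      define k where "k = 2 * pi * (C0 * M - M / C0) powr (q/2 - 1) * (K * (C0 powr \<bar>\<alpha> + 1\<bar> * M powr (-(\<alpha> + 1))))"
      have k0: "k \<ge> 0" using K(1) by (simp add: k_def)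
      have "k powr (1/q) \<le> C * M powr ((real n - 1) / 2 - (real n + 1) / q)"
      proof -
        have MC: "0 \<le> C0 * M - M / C0" "C0 * M - M / C0 \<le> C0 * M"
        proof -
          have "M / C0 \<le> M" using M assms(11) by (simp add: divide_le_eq)
          also have "M \<le> C0 * M" using M assms(11) by simp
          finally show "0 \<le> C0 * M - M / C0" by simp
        qed (use M assms(11) in auto)
        have "k \<le> 2 * pi * (C0 * M) powr (q/2 - 1) * (K * (C0 powr \<bar>\<alpha> + 1\<bar> * M powr (-(\<alpha> + 1))))"
          unfolding k_def using MC K(1) ex(1) by (intro mult_right_mono mult_left_mono powr_mono2) auto
        also have "\<dots> = (2 * pi * C0 powr (q/2 - 1) * (K * C0 powr \<bar>\<alpha> + 1\<bar>)) * (M powr (q/2 - 1) * M powr (-(\<alpha> + 1)))"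
          unfolding powr_mult by simp
        also have "M powr (q/2 - 1) * M powr (-(\<alpha> + 1)) = M powr (q/2 - 1 - (\<alpha> + 1))"
          by (simp only: powr_add[symmetric] diff_conv_add_uminus)
        finally have "k powr (1/q) \<le> ((2 * pi * C0 powr (q/2 - 1) * (K * C0 powr \<bar>\<alpha> + 1\<bar>)) * M powr (q/2 - 1 - (\<alpha> + 1))) powr (1/q)"
          using k0 q0 by (intro powr_mono2) auto
        also have "\<dots> = C * M powr ((q/2 - 1 - (\<alpha> + 1)) * (1/q))" unfolding powr_mult powr_powr C_def ..
        also have "(q/2 - 1 - (\<alpha> + 1)) * (1/q) = (real n - 1) / 2 - (real n + 1) / q"
          using q0 by (simp add: \<alpha>_def field_simps)
        finally show ?thesis .
      qed
      then have kk: "ennreal (k powr (1/q)) \<le> ennreal (C * M powr ((real n - 1) / 2 - (real n + 1) / q))" by (rule ennreal_leI)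
      have "mixed_norm Y n q u \<le> ennreal (k powr (1/q)) * ennreal_powr (\<integral>\<^sup>+i. E i \<partial>count_space MI) (1/2)"
        using fin unfolding k_def[symmetric] ennreal_powr_mult ennreal_powr_powr ennreal_powr_ennreal[OF k0] using q0 by simp
      also have "\<dots> \<le> ennreal (C * M powr ((real n - 1) / 2 - (real n + 1) / q)) * ennreal_powr (\<integral>\<^sup>+i. E i \<partial>count_space MI) (1/2)"
        by (intro mult_right_mono kk) simp
      finally show ?thesis unfolding EH .
    qed
  qed
  show ?thesis using C main by blast
qed

end
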